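(* Suppose there is a constant $C_0$ independent of $\varepsilon$ and $N$ such that the Lagrange interpolant $u^I\in V^N$ of the solution $u$ of the reaction-diffusion problem satisfies $$\|u-u^I\|_0\le C_0N^{-2},\qquad \varepsilon^{1/4}|u-u^I|_1\le C_0N^{-1}\ln N,$$ $$\|u-u^I\|_{\infty,\Omega_0}\le C_0N^{-2},\qquad \|u-u^I\|_{\infty,\Omega\setminus\Omega_0}\le C_0(N^{-1}\ln N)^2 .$$ Let $u^N\in V^N$ be the Galerkin finite element solution with linear or bilinear elements on the Shishkin mesh. Then there is a constant $C$ independent of $\varepsilon$ and $N$ such that $$\varepsilon^{1/4}|u-u^N|_1+\|u-u^N\|_0\le C\left(N^{-1}(\ln N)^{3/2}+N^{-2}\right).$$
   Context: Problem: $\Omega=(0,1)\times(0,1)$, $0<\varepsilon\ll1$ is a small parameter, $c>0$ is a constant, $f$ is sufficiently smooth, and $u$ solves $-\varepsilon\Delta u+cu=f$ in $\Omega$, $u=0$ on $\partial\Omega$. Weak form: $u\in V=H_0^1(\Omega)$ with $\varepsilon(\nabla u,\nabla v)+c(u,v)=(f,v)$ for all $v\in V$, where $(\cdot,\cdot)$ is the $L_2(\Omega)$ inner product. Norms: $\|\cdot\|_0$ is the $L_2(\Omega)$ norm, $|\cdot|_1$ the $H^1(\Omega)$ seminorm, $\|\cdot\|_{\infty,D}$ the $L_\infty(D)$ norm. Mesh: $N$ is a positive integer divisible by 4, and $\lambda=\min\{1/4,\lambda_0\sqrt{\varepsilon/c^*}\,\ln N\}$ with $\lambda_0=2$ and a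 fixed $0<c^*<c$. The Shishkin mesh $\Omega^N$ is the tensor product of two identical one-dimensional meshes on $[0,1]$, each dividing $[0,\lambda]$ and $[1-\lambda,1]$ uniformly into $N/4$ intervals each (step size $h=4\lambda/N$) and $[\lambda,1-\lambda]$ uniformly into $N/2$ intervals (step size $H=2(1-2\lambda)/N$). Put $\Omega_0=(\lambda,1-\lambda)\times(\lambda,1-\lambda)$. Finite element space: $V^N\subset H_0^1(\Omega)$ is either the space of continuous piecewise bilinear functions on the rectangles of $\Omega^N$, or the space of continuous piecewise linear functions on the triangulation obtained from $\Omega^N$ by drawing diagonals, vanishing on $\partial\Omega$. The Galerkin solution $u^N\in V^N$ satisfies $\varepsilon(\nabla u^N,\nabla v)+c(u^N,v)=(f,v)$ for all $v\in V^N$. *)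

theory Defs
  imports "HOL-Analysis.Analysis" "HOL-Probability.Essential_Supremum"
begin

definition \<Omega> :: "(real \<times> real) set" where
  "\<Omega> = {0<..<1} \<times> {0<..<1}"

text \<open>Continuous differentiability up to the boundary: derivatives are taken within \<^term>\<open>S\<close>,
  which is meant to be the closed square (where they are unique) or the whole plane.\<close>

primrec Ck_on :: "(real \<times> real) set \<Rightarrow> nat \<Rightarrow> (real \<times> real \<Rightarrow> real) \<Rightarrow> bool" where
  "Ck_on S 0 f \<longleftrightarrow> continuous_on S f"
| "Ck_on S (Suc k) f \<longleftrightarrow>
     (\<exists>g. (\<forall>p\<in>S. (f has_derivative (\<lambda>h. h \<bullet> g p)) (at p within S)) \<and>
          Ck_on S k (\<lambda>p. fst (g p)) \<and> Ck_on S k (\<lambda>p. snd (g p)))"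

definition test_function :: "(real \<times> real \<Rightarrow> real) \<Rightarrow> bool" where
  "test_function \<phi> \<longleftrightarrow> (\<forall>k. Ck_on UNIV k \<phi>) \<and>
     compact (closure {p. \<phi> p \<noteq> 0}) \<and> closure {p. \<phi> p \<noteq> 0} \<subseteq> \<Omega>"

definition grad :: "(real \<times> real \<Rightarrow> real) \<Rightarrow> real \<times> real \<Rightarrow> real \<times> real" where
  "grad \<phi> p = (frechet_derivative \<phi> (at p) (1, 0), frechet_derivative \<phi> (at p) (0, 1))"

text \<open>Elements of \<open>L\<^sub>2\<close> and \<open>H\<^sup>1\<close> are represented by functions on the plane; only their values on
  \<^term>\<open>\<Omega>\<close>, up to null sets, matter.\<close>

definition L2 :: "(real \<times> real \<Rightarrow> real) set" where
  "L2 = {u. u \<in> borel_measurable (lebesgue_on \<Omega>) \<and> integrable (lebesgue_on \<Omega>) (\<lambda>p. (u p)\<^sup>2)}"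

definition L2_inner :: "(real \<times> real \<Rightarrow> real) \<Rightarrow> (real \<times> real \<Rightarrow> real) \<Rightarrow> real" where
  "L2_inner u v = (LINT p|lebesgue_on \<Omega>. u p * v p)"

definition L2_norm :: "(real \<times> real \<Rightarrow> real) \<Rightarrow> real" where
  "L2_norm u = sqrt (L2_inner u u)"

definition Linf_norm :: "(real \<times> real) set \<Rightarrow> (real \<times> real \<Rightarrow> real) \<Rightarrow> ereal" where
  "Linf_norm D u = esssup (lebesgue_on D) (\<lambda>p. ereal \<bar>u p\<bar>)"

definition weak_gradient :: "(real \<times> real \<Rightarrow> real) \<Rightarrow> (real \<times> real \<Rightarrow> real \<times> real) \<Rightarrow> bool" where
  "weak_gradient u g \<longleftrightarrow> (\<lambda>p. fst (g p)) \<in> L2 \<and> (\<lambda>p. snd (g p)) \<in> L2 \<and>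
     (\<forall>\<phi>. test_function \<phi> \<longrightarrow>
        (LINT p|lebesgue_on \<Omega>. u p *\<^sub>R grad \<phi> p) = - (LINT p|lebesgue_on \<Omega>. \<phi> p *\<^sub>R g p))"

definition H1 :: "(real \<times> real \<Rightarrow> real) set" where
  "H1 = {u \<in> L2. \<exists>g. weak_gradient u g}"

text \<open>The weak gradient is unique up to null sets, so the choice of representative does not
  affect the integrals below.\<close>

definition wgrad :: "(real \<times> real \<Rightarrow> real) \<Rightarrow> real \<times> real \<Rightarrow> real \<times> real" where
  "wgrad u = (SOME g. weak_gradient u g)"

definition grad_inner :: "(real \<times> real \<Rightarrow> real) \<Rightarrow> (real \<times> real \<Rightarrow> real) \<Rightarrow> real" where
  "grad_inner u v = (LINT p|lebesgue_on \<Omega>. wgrad u p \<bullet> wgrad v p)"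

definition H1_seminorm :: "(real \<times> real \<Rightarrow> real) \<Rightarrow> real" where
  "H1_seminorm u = sqrt (grad_inner u u)"

definition H01 :: "(real \<times> real \<Rightarrow> real) set" where
  "H01 = {u \<in> H1. \<exists>\<phi>. (\<forall>n::nat. test_function (\<phi> n)) \<and>
      (\<lambda>n. L2_norm (\<lambda>p. u p - \<phi> n p)) \<longlonglongrightarrow> 0 \<and>
      (\<lambda>n. H1_seminorm (\<lambda>p. u p - \<phi> n p)) \<longlonglongrightarrow> 0}"

definition variational_solution ::
    "real \<Rightarrow> real \<Rightarrow> (real \<times> real \<Rightarrow> real) \<Rightarrow> (real \<times> real \<Rightarrow> real) set \<Rightarrow> (real \<times> real \<Rightarrow> real) \<Rightarrow> bool"
  where "variational_solution \<epsilon> c f W w \<longleftrightarrow> w \<in> W \<and>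
     (\<forall>v\<in>W. \<epsilon> * grad_inner w v + c * L2_inner w v = L2_inner f v)"

text \<open>The weak solution, represented by its version that is continuous on the closed square, so
  that its boundary values and its values at mesh nodes make sense.\<close>

definition solves_reaction_diffusion ::
    "real \<Rightarrow> real \<Rightarrow> (real \<times> real \<Rightarrow> real) \<Rightarrow> (real \<times> real \<Rightarrow> real) \<Rightarrow> bool" where
  "solves_reaction_diffusion \<epsilon> c f u \<longleftrightarrow> variational_solution \<epsilon> c f H01 u \<and>
     continuous_on (closure \<Omega>) u \<and> (\<forall>p\<in>frontier \<Omega>. u p = 0)"

definition mesh_sizes :: "nat set" where
  "mesh_sizes = {N. 0 < N \<and> 4 dvd N}"

text \<open>The transition point for \<open>\<lambda>\<^sub>0 = 2\<close>; \<^term>\<open>cs\<close> is the constant \<open>c\<^sup>*\<close>.\<close>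

definition transition :: "real \<Rightarrow> real \<Rightarrow> nat \<Rightarrow> real" where
  "transition cs \<epsilon> N = min (1/4) (2 * sqrt (\<epsilon> / cs) * ln (real N))"

definition shishkin_node :: "real \<Rightarrow> nat \<Rightarrow> nat \<Rightarrow> real" where
  "shishkin_node l N i =
     (let h = 4 * l / real N; H = 2 * (1 - 2 * l) / real N in
      if i \<le> N div 4 then real i * h
      else if i \<le> 3 * (N div 4) then l + (real i - real N / 4) * H
      else 1 - (real N - real i) * h)"

definition \<Omega>\<^sub>0 :: "real \<Rightarrow> (real \<times> real) set" where
  "\<Omega>\<^sub>0 l = {l<..<1 - l} \<times> {l<..<1 - l}"

definition linear_on :: "(real \<times> real) set \<Rightarrow> (real \<times> real \<Rightarrow> real) \<Rightarrow> bool" where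
  "linear_on D v \<longleftrightarrow> (\<exists>a\<^sub>0 a\<^sub>1 a\<^sub>2. \<forall>(s, t)\<in>D. v (s, t) = a\<^sub>0 + a\<^sub>1 * s + a\<^sub>2 * t)"

definition bilinear_on :: "(real \<times> real) set \<Rightarrow> (real \<times> real \<Rightarrow> real) \<Rightarrow> bool" where
  "bilinear_on D v \<longleftrightarrow>
     (\<exists>a\<^sub>0 a\<^sub>1 a\<^sub>2 a\<^sub>3. \<forall>(s, t)\<in>D. v (s, t) = a\<^sub>0 + a\<^sub>1 * s + a\<^sub>2 * t + a\<^sub>3 * s * t)"

definition rectangle :: "(nat \<Rightarrow> real) \<Rightarrow> nat \<Rightarrow> nat \<Rightarrow> (real \<times> real) set" where
  "rectangle x i j = {x i..x (Suc i)} \<times> {x j..x (Suc j)}"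

text \<open>The two triangles into which a rectangle is cut by one of its diagonals: the one through the
  lower left corner if \<^term>\<open>d i j\<close> holds, the other one otherwise.\<close>

definition triangles ::
    "(nat \<Rightarrow> real) \<Rightarrow> (nat \<Rightarrow> nat \<Rightarrow> bool) \<Rightarrow> nat \<Rightarrow> nat \<Rightarrow> (real \<times> real) set set" where
  "triangles x d i j =
     (let ll = (x i, x j); lr = (x (Suc i), x j);
          ul = (x i, x (Suc j)); ur = (x (Suc i), x (Suc j)) in
      if d i j then {convex hull {ll, lr, ur}, convex hull {ll, ul, ur}}
      else {convex hull {ll, lr, ul}, convex hull {lr, ul, ur}})"

text \<open>\<^term>\<open>x\<close> lists the nodes of the one-dimensional mesh used in both coordinates.\<close>

definition bilinear_elements :: "(nat \<Rightarrow> real) \<Rightarrow> nat \<Rightarrow> (real \<times> real \<Rightarrow> real) set" where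
  "bilinear_elements x N =
     {v. continuous_on (closure \<Omega>) v \<and> (\<forall>p\<in>frontier \<Omega>. v p = 0) \<and>
         (\<forall>i<N. \<forall>j<N. bilinear_on (rectangle x i j) v)}"

definition linear_elements ::
    "(nat \<Rightarrow> real) \<Rightarrow> (nat \<Rightarrow> nat \<Rightarrow> bool) \<Rightarrow> nat \<Rightarrow> (real \<times> real \<Rightarrow> real) set" where
  "linear_elements x d N =
     {v. continuous_on (closure \<Omega>) v \<and> (\<forall>p\<in>frontier \<Omega>. v p = 0) \<and>
         (\<forall>i<N. \<forall>j<N. \<forall>T\<in>triangles x d i j. linear_on T v)}"

definition lagrange_interpolant ::
    "(nat \<Rightarrow> real) \<Rightarrow> nat \<Rightarrow> (real \<times> real \<Rightarrow> real) set \<Rightarrow>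
     (real \<times> real \<Rightarrow> real) \<Rightarrow> (real \<times> real \<Rightarrow> real) \<Rightarrow> bool" where
  "lagrange_interpolant x N V u w \<longleftrightarrow> w \<in> V \<and> (\<forall>i\<le>N. \<forall>j\<le>N. w (x i, x j) = u (x i, x j))"

end

theory Submission
  imports Defs
begin

text \<open>
  Write \<open>e = u - u\<^sup>I\<close> and \<open>\<xi> = u\<^sup>N - u\<^sup>I\<close>, so that the error is \<open>e - \<xi>\<close>, and let
  \<open>a(v, w) = \<epsilon> (\<nabla>v, \<nabla>w) + c (v, w)\<close>. Galerkin orthogonality says \<open>a(\<xi>, v) = a(e, v)\<close> for all discrete
  \<open>v\<close>. Testing with \<open>\<xi>\<close> gives \<open>a(\<xi>, \<xi>) \<le> a(e, e)\<close> (\<open>energy_quasi_best\<close>). In the balanced norm this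
  costs a factor \<open>\<epsilon>\<^bsup>-1/4\<^esup>\<close> in front of \<open>\<parallel>e\<parallel>\<^sub>0 = O(N\<^bsup>-2\<^esup>)\<close>, which is harmless as long as
  \<open>\<epsilon>\<^bsup>1/4\<^esup> \<ge> 1/N\<close>.

  If \<open>\<epsilon>\<^bsup>1/4\<^esup> < 1/N\<close>, the same estimate shows that \<open>\<parallel>\<xi>\<parallel>\<^sub>0\<close> is of order \<open>N\<^bsup>-2\<^esup> ln N\<close>, and this smallness is
  turned into a bound for the gradient by splitting \<open>\<xi> = \<xi>\<^sub>0 + \<xi>\<^sub>1\<close>, where \<open>\<xi>\<^sub>0\<close> keeps the nodal values of
  \<open>\<xi>\<close> in the closure of \<open>\<Omega>\<^sub>0\<close> and has all other nodal values zero. The two parts are small for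
  different reasons.

  \<^item> The function \<open>\<xi>\<^sub>1\<close> is discrete and vanishes on \<open>\<Omega>\<^sub>0\<close>. Testing with it
    (\<open>energy_localised\<close>) therefore sees \<open>L\<^sub>2\<close> norms over the layer region \<open>\<Omega> - \<Omega>\<^sub>0\<close> only. The area of
    that region is \<open>O(\<epsilon>\<^bsup>1/2\<^esup> ln N)\<close>, and this is what converts the maximum norm bound on \<open>e\<close> there into
    an \<open>L\<^sub>2\<close> bound with the missing factor \<open>\<epsilon>\<^bsup>1/4\<^esup>\<close> (\<open>layer_L2_bound\<close>).
  \<^item> The function \<open>\<xi>\<^sub>0\<close> is controlled by inverse estimates. Each of its nodal values belongs to a coarse
    cell, hence is bounded through \<open>\<parallel>\<xi>\<parallel>\<^sub>0\<close>, and \<open>\<xi>\<^sub>0\<close> reaches into the layer region by a single cell of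
    width \<open>h\<close> only. So \<open>|\<xi>\<^sub>0|\<^sub>1\<close> is at most a multiple of \<open>(h H)\<^bsup>-1/2\<^esup> \<parallel>\<xi>\<parallel>\<^sub>0\<close>, and its \<open>L\<^sub>2\<close> norm over the
    layer region is at most a multiple of \<open>(h/H)\<^bsup>1/2\<^esup> \<parallel>\<xi>\<parallel>\<^sub>0\<close> (\<open>grad_truncation_bound\<close>,
    \<open>layer_truncation_bound\<close>).

  The arithmetic with \<open>h\<close>, \<open>H\<close>, \<open>\<lambda>\<close> and \<open>\<epsilon>\<close> is collected in \<open>error_constants\<close>.

  Bilinear elements and linear elements with any choice of diagonals are treated at once. On a cell with
  local coordinates \<open>s\<close>, \<open>t\<close> and corner values \<open>a\<close>, \<open>b\<close>, \<open>c\<close>, \<open>d\<close> each of them equals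
  \<open>a + (b - a) s + (c - a) t + (a + d - b - c) m(s, t)\<close> with \<open>m(s, t)\<close> one of \<open>s t\<close>, \<open>min s t\<close> and
  \<open>max 0 (s + t - 1)\<close>, and the estimates use that \<open>m\<close> is symmetric, monotone and 1-Lipschitz in each
  variable, with the right boundary values.

  Galerkin orthogonality presupposes that the discrete functions lie in \<open>H\<^sup>1\<^sub>0\<close>, that is, that they are
  limits of test functions. This is shown for every Lipschitz function that vanishes outside \<open>\<Omega>\<close> and is
  strictly differentiable almost everywhere (\<open>lipschitz_in_H01\<close>): it is shrunk towards the centre of the
  square and mollified. That weak gradients add up and may be computed pointwise rests on their
  uniqueness (\<open>fundamental_lemma_variations\<close>).
\<close>

section \<open>Smooth functions and bump functions\<close>

lemma Ck_on_SucE: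
  assumes "Ck_on S (Suc k) f"
  obtains g where "\<forall>p\<in>S. (f has_derivative (\<lambda>h. h \<bullet> g p)) (at p within S)"
    "Ck_on S k (\<lambda>p. fst (g p))" "Ck_on S k (\<lambda>p. snd (g p))"
  using assms unfolding Ck_on.simps by blast

lemma Ck_on_SucI:
  assumes "\<forall>p\<in>S. (f has_derivative (\<lambda>h. h \<bullet> g p)) (at p within S)"
    and "Ck_on S k (\<lambda>p. fst (g p))" "Ck_on S k (\<lambda>p. snd (g p))"
  shows "Ck_on S (Suc k) f"
  unfolding Ck_on.simps using assms by blast

lemma Ck_on_continuous: "Ck_on S k f \<Longrightarrow> continuous_on S f"
proof (cases k)
  case (Suc m)
  assume "Ck_on S k f"
  then obtain g where g: "\<forall>p\<in>S. (f has_derivative (\<lambda>h. h \<bullet> g p)) (at p within S)"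
    unfolding Suc by (rule Ck_on_SucE)
  show ?thesis
    by (rule has_derivative_continuous_on[OF g[rule_format]])
qed auto

lemma Ck_on_SucD: "Ck_on S (Suc k) f \<Longrightarrow> Ck_on S k f"
proof (induction k arbitrary: f)
  case 0
  show ?case using Ck_on_continuous[OF 0] by simp
next
  case (Suc k)
  obtain g where "\<forall>p\<in>S. (f has_derivative (\<lambda>h. h \<bullet> g p)) (at p within S)"
      "Ck_on S (Suc k) (\<lambda>p. fst (g p))" "Ck_on S (Suc k) (\<lambda>p. snd (g p))"
    using Suc.prems by (rule Ck_on_SucE)
  with Suc.IH show ?case by (intro Ck_on_SucI[where g = g])
qed

lemma Ck_on_const: "Ck_on S k (\<lambda>p. a)"
proof (induction k arbitrary: a)
  case (Suc k)
  show ?case by (rule Ck_on_SucI[where g = "\<lambda>p. 0"]) (use Suc in simp_all)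
qed auto

lemma Ck_on_add: "Ck_on S k f \<Longrightarrow> Ck_on S k g \<Longrightarrow> Ck_on S k (\<lambda>p. f p + g p)"
proof (induction k arbitrary: f g)
  case (Suc k)
  obtain F where F: "\<forall>p\<in>S. (f has_derivative (\<lambda>h. h \<bullet> F p)) (at p within S)"
      "Ck_on S k (\<lambda>p. fst (F p))" "Ck_on S k (\<lambda>p. snd (F p))" using Suc.prems(1) by (rule Ck_on_SucE)
  obtain G where G: "\<forall>p\<in>S. (g has_derivative (\<lambda>h. h \<bullet> G p)) (at p within S)"
      "Ck_on S k (\<lambda>p. fst (G p))" "Ck_on S k (\<lambda>p. snd (G p))" using Suc.prems(2) by (rule Ck_on_SucE)
  show ?case
    by (rule Ck_on_SucI[where g = "\<lambda>p. F p + G p"])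
      (use F G Suc.IH in \<open>auto simp: inner_add_right intro!: derivative_intros\<close>)
qed (auto intro: continuous_intros)

lemma Ck_on_mult: "Ck_on S k f \<Longrightarrow> Ck_on S k g \<Longrightarrow> Ck_on S k (\<lambda>p. f p * g p)"
proof (induction k arbitrary: f g)
  case (Suc k)
  obtain F where F: "\<forall>p\<in>S. (f has_derivative (\<lambda>h. h \<bullet> F p)) (at p within S)"
      "Ck_on S k (\<lambda>p. fst (F p))" "Ck_on S k (\<lambda>p. snd (F p))" using Suc.prems(1) by (rule Ck_on_SucE)
  obtain G where G: "\<forall>p\<in>S. (g has_derivative (\<lambda>h. h \<bullet> G p)) (at p within S)"
      "Ck_on S k (\<lambda>p. fst (G p))" "Ck_on S k (\<lambda>p. snd (G p))" using Suc.prems(2) by (rule Ck_on_SucE)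
  have D: "((\<lambda>p. f p * g p) has_derivative (\<lambda>h. h \<bullet> (f p *\<^sub>R G p + g p *\<^sub>R F p))) (at p within S)"
    if "p \<in> S" for p
    using has_derivative_mult[OF F(1)[rule_format, OF that] G(1)[rule_format, OF that]]
    by (simp add: inner_add_right algebra_simps)
  have fg: "Ck_on S k f" "Ck_on S k g" using Suc.prems Ck_on_SucD by blast+
  show ?case
    by (rule Ck_on_SucI[where g = "\<lambda>p. f p *\<^sub>R G p + g p *\<^sub>R F p"])
      (use F G D fg in \<open>auto intro!: Ck_on_add Suc.IH\<close>)
qed (auto intro: continuous_intros)

lemma Ck_on_exp: "Ck_on S k f \<Longrightarrow> Ck_on S k (\<lambda>p. exp (f p))"
proof (induction k arbitrary: f)
  case (Suc k)
  obtain F where F: "\<forall>p\<in>S. (f has_derivative (\<lambda>h. h \<bullet> F p)) (at p within S)"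
      "Ck_on S k (\<lambda>p. fst (F p))" "Ck_on S k (\<lambda>p. snd (F p))" using Suc.prems(1) by (rule Ck_on_SucE)
  have D: "((\<lambda>p. exp (f p)) has_derivative (\<lambda>h. h \<bullet> (exp (f p) *\<^sub>R F p))) (at p within S)"
    if "p \<in> S" for p
    using has_derivative_exp[OF F(1)[rule_format, OF that]] by (simp add: algebra_simps)
  have f: "Ck_on S k (\<lambda>p. exp (f p))" using Suc Ck_on_SucD by blast
  show ?case
    by (rule Ck_on_SucI[where g = "\<lambda>p. exp (f p) *\<^sub>R F p"]) (use F D f in \<open>auto intro!: Ck_on_mult\<close>)
qed (auto intro: continuous_intros)

text \<open>The functions \<open>q(1/x) exp(-1/x)\<close>, continued by zero to \<open>x \<le> 0\<close>. Carrying the polynomial \<open>q\<close> along makes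
  the family closed under differentiation, from which smoothness of \<open>exp(-1/x)\<close> follows at once.\<close>

definition flat_exp :: "real poly \<Rightarrow> real \<Rightarrow> real" where
  "flat_exp q x = (if 0 < x then poly q (1 / x) * exp (- (1 / x)) else 0)"

lemma poly_times_exp_tendsto_0: "((\<lambda>y. poly q y * exp (- y)) \<longlongrightarrow> (0::real)) at_top"
proof -
  have "((\<lambda>y. \<Sum>i\<le>degree q. coeff q i * (y ^ i / exp y)) \<longlongrightarrow> (\<Sum>i\<le>degree q. coeff q i * 0)) at_top"
    by (intro tendsto_sum tendsto_mult tendsto_const tendsto_power_div_exp_0)
  then show ?thesis
    by (simp add: poly_altdef sum_distrib_right exp_minus divide_inverse mult.assoc)
qed

text \<open>By the chain rule the polynomial \<open>q(y)\<close> is replaced by \<open>y\<^sup>2 (q(y) - q'(y))\<close>. At the origin both sides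
  vanish because \<open>exp(-1/x)\<close> decays faster than any power of \<open>x\<close>.\<close>

lemma flat_exp_has_derivative:
  "(flat_exp q has_real_derivative flat_exp ([:0, 0, 1:] * (q - pderiv q)) x) (at x)"
proof -
  consider "x > 0" | "x < 0" | "x = 0" by linarith
  then show ?thesis
  proof cases
    case 1
    have "((\<lambda>x. poly q (1 / x) * exp (- (1 / x))) has_real_derivative
        flat_exp ([:0, 0, 1:] * (q - pderiv q)) x) (at x)"
      unfolding flat_exp_def using 1
      by (auto intro!: derivative_eq_intros DERIV_chain'[OF _ poly_DERIV] simp: field_simps power2_eq_square)
    then show ?thesis
      by (rule has_field_derivative_transform_within_open[where S = "{0<..}"])
        (use 1 in \<open>auto simp: flat_exp_def\<close>)
  next
    case 2
    have "((\<lambda>x. 0) has_real_derivative flat_exp ([:0, 0, 1:] * (q - pderiv q)) x) (at x)"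
      using 2 by (auto simp: flat_exp_def)
    then show ?thesis
      by (rule has_field_derivative_transform_within_open[where S = "{..<0}"])
        (use 2 in \<open>auto simp: flat_exp_def\<close>)
  next
    case 3
    have "((\<lambda>h. poly (pCons 0 q) (1 / h) * exp (- (1 / h))) \<longlongrightarrow> 0) (at_right 0)"
      using filterlim_compose[OF poly_times_exp_tendsto_0[of "pCons 0 q"] filterlim_inverse_at_top_right]
      by (simp add: inverse_eq_divide)
    moreover have "\<forall>\<^sub>F h in at_right 0. poly (pCons 0 q) (1 / h) * exp (- (1 / h)) = flat_exp q h / h"
      by (rule eventually_at_right_less[THEN eventually_mono]) (auto simp: flat_exp_def)
    ultimately have R: "((\<lambda>h. flat_exp q h / h) \<longlongrightarrow> 0) (at_right 0)"
      by (rule Lim_transform_eventually)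
    have L: "((\<lambda>h. flat_exp q h / h) \<longlongrightarrow> 0) (at_left 0)"
      by (rule Lim_transform_eventually[OF tendsto_const])
        (auto simp: flat_exp_def eventually_at_left_field intro!: exI[of _ "-1"])
    show ?thesis
      using filterlim_split_at[OF L R] 3 by (simp add: DERIV_def flat_exp_def)
  qed
qed

lemma Ck_on_flat_exp: "Ck_on UNIV k (\<lambda>p. flat_exp q (a + p \<bullet> d))"
proof (induction k arbitrary: q)
  case 0
  have "continuous_on UNIV (flat_exp q)"
    using flat_exp_has_derivative DERIV_continuous_on by blast
  then have "continuous_on UNIV (flat_exp q \<circ> (\<lambda>p. a + p \<bullet> d))"
    by (intro continuous_on_compose continuous_intros) (auto intro: continuous_on_subset)
  then show ?case by (simp add: o_def)
next
  case (Suc k)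
  let ?q = "[:0, 0, 1:] * (q - pderiv q)"
  have D: "((\<lambda>p. flat_exp q (a + p \<bullet> d)) has_derivative (\<lambda>h. h \<bullet> (flat_exp ?q (a + p \<bullet> d) *\<^sub>R d))) (at p)" for p
  proof -
    have "((\<lambda>p. a + p \<bullet> d) has_derivative (\<lambda>h. h \<bullet> d)) (at p)"
      by (auto intro!: derivative_eq_intros)
    from has_derivative_compose[OF this flat_exp_has_derivative[unfolded has_field_derivative_def]]
    show ?thesis by (simp add: algebra_simps)
  qed
  show ?case
    by (rule Ck_on_SucI[where g = "\<lambda>p. flat_exp ?q (a + p \<bullet> d) *\<^sub>R d"])
       (use D in \<open>auto intro!: Ck_on_mult Ck_on_const Suc simp del: mult_pCons_left\<close>)
qed

definition bump :: "real \<times> real \<Rightarrow> real \<times> real \<Rightarrow> real \<times> real \<Rightarrow> real" where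
  "bump a b p = flat_exp 1 (fst p - fst a) * flat_exp 1 (fst b - fst p) *
     (flat_exp 1 (snd p - snd a) * flat_exp 1 (snd b - snd p))"

lemma Ck_on_bump: "Ck_on UNIV k (bump a b)"
proof -
  have "Ck_on UNIV k (\<lambda>p. flat_exp 1 (- fst a + p \<bullet> (1, 0)) * flat_exp 1 (fst b + p \<bullet> (- 1, 0)) *
     (flat_exp 1 (- snd a + p \<bullet> (0, 1)) * flat_exp 1 (snd b + p \<bullet> (0, - 1))))"
    by (intro Ck_on_mult Ck_on_flat_exp)
  moreover have "(\<lambda>p. flat_exp 1 (- fst a + p \<bullet> (1, 0)) * flat_exp 1 (fst b + p \<bullet> (- 1, 0)) *
     (flat_exp 1 (- snd a + p \<bullet> (0, 1)) * flat_exp 1 (snd b + p \<bullet> (0, - 1)))) = bump a b"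
    by (auto simp: bump_def inner_prod_def fun_eq_iff)
  ultimately show ?thesis by simp
qed

lemma bump_nonneg: "0 \<le> bump a b p"
  by (auto simp: bump_def flat_exp_def)

lemma bump_pos_iff: "0 < bump a b p \<longleftrightarrow> p \<in> box a b"
  by (cases a; cases b; cases p)
    (auto simp: bump_def flat_exp_def mem_box Basis_prod_def ball_Un zero_less_mult_iff)

lemma bump_eq_0_iff: "bump a b p = 0 \<longleftrightarrow> p \<notin> box a b"
  using bump_nonneg[of a b p] bump_pos_iff[of a b p] by linarith

section \<open>Square-integrable functions and test functions on the square\<close>

lemma Omega_box: "\<Omega> = box (0, 0) (1, 1)"
  by (auto simp: \<Omega>_def mem_box Basis_prod_def ball_Un)

lemma closure_Omega: "closure \<Omega> = {0..1} \<times> {0..1}"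
  by (simp add: \<Omega>_def closure_Times)

lemma closure_Omega_cbox: "closure \<Omega> = cbox (0, 0) (1, 1)"
  by (simp add: closure_Omega cbox_Pair_eq)

lemma open_Omega: "open \<Omega>"
  by (metis Omega_box open_box)

lemma frontier_Omega: "frontier \<Omega> = closure \<Omega> - \<Omega>"
  by (simp add: frontier_def interior_open[OF open_Omega])

lemma Omega_lmeasurable: "\<Omega> \<in> lmeasurable"
  by (simp add: Omega_box)

lemma Omega_lebesgue [measurable]: "\<Omega> \<in> sets lebesgue"
  by (simp add: Omega_box)

interpretation Omega: finite_measure "lebesgue_on \<Omega>"
  by (rule finite_measure_lebesgue_on[OF Omega_lmeasurable])

lemma measurable_Omega_of_continuous:
  assumes "continuous_on UNIV f" shows "f \<in> borel_measurable (lebesgue_on \<Omega>)"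
  by (rule continuous_imp_measurable_on_sets_lebesgue[OF continuous_on_subset[OF assms subset_UNIV] Omega_lebesgue])

lemma integrable_Omega_of_bounded:
  fixes f :: "real \<times> real \<Rightarrow> 'b::{banach, second_countable_topology}"
  assumes "f \<in> borel_measurable (lebesgue_on \<Omega>)" "\<And>p. p \<in> \<Omega> \<Longrightarrow> norm (f p) \<le> B"
  shows "integrable (lebesgue_on \<Omega>) f"
  by (rule Omega.integrable_const_bound[where B = B]) (use assms in auto)

lemma L2D: "u \<in> L2 \<Longrightarrow> u \<in> borel_measurable (lebesgue_on \<Omega>)"
  "u \<in> L2 \<Longrightarrow> integrable (lebesgue_on \<Omega>) (\<lambda>p. (u p)\<^sup>2)"
  by (auto simp: L2_def)

lemma L2_of_bounded:
  assumes "u \<in> borel_measurable (lebesgue_on \<Omega>)" "\<And>p. p \<in> \<Omega> \<Longrightarrow> \<bar>u p\<bar> \<le> B"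
  shows "u \<in> L2"
proof -
  have "norm ((u p)\<^sup>2) \<le> B\<^sup>2" if "p \<in> \<Omega>" for p
    using power_mono[OF assms(2)[OF that] abs_ge_zero, of 2] by simp
  then show ?thesis
    unfolding L2_def using assms(1) by (auto intro!: integrable_Omega_of_bounded)
qed

lemma integrable_L2_mult:
  assumes "u \<in> L2" "v \<in> L2" shows "integrable (lebesgue_on \<Omega>) (\<lambda>p. u p * v p)"
proof (rule Bochner_Integration.integrable_bound)
  show "integrable (lebesgue_on \<Omega>) (\<lambda>p. (u p)\<^sup>2 + (v p)\<^sup>2)"
    using assms L2D by auto
  show "AE p in lebesgue_on \<Omega>. norm (u p * v p) \<le> norm ((u p)\<^sup>2 + (v p)\<^sup>2)"
  proof (rule AE_I2)
    fix p
    have "2 * \<bar>u p * v p\<bar> \<le> (u p)\<^sup>2 + (v p)\<^sup>2"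
      using zero_le_power2[of "\<bar>u p\<bar> - \<bar>v p\<bar>"] by (simp add: power2_diff abs_mult)
    moreover have "0 \<le> \<bar>u p * v p\<bar>" by simp
    ultimately show "norm (u p * v p) \<le> norm ((u p)\<^sup>2 + (v p)\<^sup>2)"
      unfolding real_norm_def by linarith
  qed
qed (use assms L2D in auto)

lemma L2_indicator_mult:
  assumes A: "A \<in> sets lebesgue" and v: "v \<in> L2"
  shows "(\<lambda>p. indicator A p * v p) \<in> L2"
  unfolding L2_def
proof safe
  have "(\<lambda>p. indicator A p :: real) \<in> borel_measurable (lebesgue_on \<Omega>)"
    by (intro measurable_restrict_space1 borel_measurable_indicator A)
  then show m: "(\<lambda>p. indicator A p * v p) \<in> borel_measurable (lebesgue_on \<Omega>)"
    by (intro borel_measurable_times L2D(1)[OF v])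
  show "integrable (lebesgue_on \<Omega>) (\<lambda>p. (indicator A p * v p)\<^sup>2)"
  proof (rule Bochner_Integration.integrable_bound[OF L2D(2)[OF v]])
    show "AE p in lebesgue_on \<Omega>. norm ((indicator A p * v p)\<^sup>2) \<le> norm ((v p)\<^sup>2)"
      by (intro AE_I2) (auto simp: indicator_def)
  qed (intro borel_measurable_power m)
qed

lemma L2_add: "u \<in> L2 \<Longrightarrow> v \<in> L2 \<Longrightarrow> (\<lambda>p. u p + v p) \<in> L2"
  using integrable_L2_mult[of u v] by (auto simp: L2_def power2_sum mult.assoc)

lemma L2_cmult: "u \<in> L2 \<Longrightarrow> (\<lambda>p. a * u p) \<in> L2"
  by (auto simp: L2_def power_mult_distrib)

lemma L2_diff: "u \<in> L2 \<Longrightarrow> v \<in> L2 \<Longrightarrow> (\<lambda>p. u p - v p) \<in> L2"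
  using L2_add[OF _ L2_cmult[of v "-1"]] by auto

lemma integrable_L2: "u \<in> L2 \<Longrightarrow> integrable (lebesgue_on \<Omega>) u"
  using integrable_L2_mult[of u "\<lambda>p. 1"] L2_of_bounded[of "\<lambda>p. 1" 1] by simp

lemma L2_inner_commute: "L2_inner u v = L2_inner v u"
  by (simp add: L2_inner_def mult.commute)

lemma L2_inner_diff_left:
  "u \<in> L2 \<Longrightarrow> v \<in> L2 \<Longrightarrow> w \<in> L2 \<Longrightarrow> L2_inner (\<lambda>p. u p - v p) w = L2_inner u w - L2_inner v w"
  by (simp add: L2_inner_def left_diff_distrib integrable_L2_mult)

lemma L2_inner_diff_right:
  "u \<in> L2 \<Longrightarrow> v \<in> L2 \<Longrightarrow> w \<in> L2 \<Longrightarrow> L2_inner w (\<lambda>p. u p - v p) = L2_inner w u - L2_inner w v"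
  using L2_inner_diff_left[of u v w] by (simp add: L2_inner_commute)

lemma L2_inner_nonneg: "0 \<le> L2_inner u u"
  by (simp add: L2_inner_def)

lemma L2_inner_cong_AE:
  assumes "AE p in lebesgue_on \<Omega>. u p = u' p" "AE p in lebesgue_on \<Omega>. v p = v' p"
    "u \<in> L2" "v \<in> L2" "u' \<in> L2" "v' \<in> L2"
  shows "L2_inner u v = L2_inner u' v'"
  unfolding L2_inner_def
  by (rule integral_cong_AE) (use assms L2D(1) in auto)

lemma test_function_has_derivative:
  assumes "test_function \<phi>" shows "(\<phi> has_derivative (\<lambda>h. h \<bullet> grad \<phi> p)) (at p)"
    and "continuous_on UNIV (grad \<phi>)" "Ck_on UNIV k (\<lambda>p. fst (grad \<phi> p))" "Ck_on UNIV k (\<lambda>p. snd (grad \<phi> p))"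
proof -
  have *: "(\<forall>p. (\<phi> has_derivative (\<lambda>h. h \<bullet> grad \<phi> p)) (at p)) \<and>
    Ck_on UNIV k (\<lambda>p. fst (grad \<phi> p)) \<and> Ck_on UNIV k (\<lambda>p. snd (grad \<phi> p))" for k
  proof -
    have "Ck_on UNIV (Suc k) \<phi>" using assms unfolding test_function_def by blast
    then obtain g where g: "\<forall>p\<in>UNIV. (\<phi> has_derivative (\<lambda>h. h \<bullet> g p)) (at p)"
      "Ck_on UNIV k (\<lambda>p. fst (g p))" "Ck_on UNIV k (\<lambda>p. snd (g p))" by (rule Ck_on_SucE)
    have "grad \<phi> p = g p" for p
      unfolding grad_def frechet_derivative_at[OF g(1)[rule_format, OF UNIV_I], symmetric]
      by (simp add: inner_prod_def prod_eq_iff)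
    then show ?thesis using g by (simp add: fun_eq_iff)
  qed
  show "(\<phi> has_derivative (\<lambda>h. h \<bullet> grad \<phi> p)) (at p)" using *[of 0] by blast
  show "Ck_on UNIV k (\<lambda>p. fst (grad \<phi> p))" "Ck_on UNIV k (\<lambda>p. snd (grad \<phi> p))" using *[of k] by blast+
  have "continuous_on UNIV (\<lambda>p. (fst (grad \<phi> p), snd (grad \<phi> p)))"
    using *[of 0] by (intro continuous_on_Pair) auto
  then show "continuous_on UNIV (grad \<phi>)" by simp
qed

lemma test_function_continuous: "test_function \<phi> \<Longrightarrow> continuous_on UNIV \<phi>"
  using Ck_on_continuous[of UNIV 0 \<phi>] unfolding test_function_def by blast

lemma test_function_outside:
  assumes "test_function \<phi>" "p \<notin> \<Omega>" shows "\<phi> p = 0" "grad \<phi> p = 0"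
proof -
  let ?U = "- closure {p. \<phi> p \<noteq> 0}"
  have U: "open ?U" "p \<in> ?U" using assms by (auto simp: test_function_def)
  have 0: "\<phi> q = 0" if "q \<in> ?U" for q
    using that closure_subset[of "{p. \<phi> p \<noteq> 0}"] by auto
  show "\<phi> p = 0" using 0 U by blast
  have "((\<lambda>q. 0) has_derivative (\<lambda>h. h \<bullet> grad \<phi> p)) (at p)"
    by (rule has_derivative_transform_within_open[OF test_function_has_derivative(1)[OF assms(1)] U 0])
  from has_derivative_unique[OF this has_derivative_const]
  have "h \<bullet> grad \<phi> p = 0" for h by meson
  from this[of "grad \<phi> p"] show "grad \<phi> p = 0" by simp
qed

lemma bounded_of_continuous_zero_outside:
  fixes f :: "real \<times> real \<Rightarrow> 'b::real_normed_vector"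
  assumes "continuous_on UNIV f" "\<And>p. p \<notin> \<Omega> \<Longrightarrow> f p = 0"
  shows "\<exists>B>0. \<forall>p. norm (f p) \<le> B"
proof -
  have "bounded (f ` closure \<Omega>)"
    using continuous_on_subset[OF assms(1) subset_UNIV]
    by (intro compact_imp_bounded compact_continuous_image) (auto simp: closure_Omega_cbox)
  then obtain B where B: "0 < B" "\<And>p. p \<in> closure \<Omega> \<Longrightarrow> norm (f p) \<le> B"
    by (auto simp: bounded_pos)
  have "norm (f p) \<le> B" for p
    using B(1) B(2)[OF subsetD[OF closure_subset]] assms(2) by (cases "p \<in> \<Omega>") simp_all
  then show ?thesis using B(1) by blast
qed

lemma test_function_bounded:
  assumes "test_function \<phi>"
  shows "\<exists>B>0. (\<forall>p. \<bar>\<phi> p\<bar> \<le> B) \<and> (\<forall>p. norm (grad \<phi> p) \<le> B)"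
proof -
  obtain B1 where B1: "0 < B1" "\<forall>p. norm (\<phi> p) \<le> B1"
    using bounded_of_continuous_zero_outside[OF test_function_continuous[OF assms] test_function_outside(1)[OF assms]] by blast
  obtain B2 where B2: "0 < B2" "\<forall>p. norm (grad \<phi> p) \<le> B2"
    using bounded_of_continuous_zero_outside[OF test_function_has_derivative(2)[OF assms] test_function_outside(2)[OF assms]] by blast
  have "\<bar>\<phi> p\<bar> \<le> B1 + B2" "norm (grad \<phi> p) \<le> B1 + B2" for p
    using B1(1) B1(2)[rule_format, of p] B2(1) B2(2)[rule_format, of p] by simp_all
  moreover have "0 < B1 + B2" using B1(1) B2(1) by simp
  ultimately show ?thesis by blast
qed

lemma test_function_L2:
  assumes "test_function \<phi>"
  shows "\<phi> \<in> L2" "(\<lambda>p. fst (grad \<phi> p)) \<in> L2" "(\<lambda>p. snd (grad \<phi> p)) \<in> L2"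
proof -
  obtain B where bd: "0 < B \<and> (\<forall>p. \<bar>\<phi> p\<bar> \<le> B) \<and> (\<forall>p. norm (grad \<phi> p) \<le> B)"
    using test_function_bounded[OF assms] ..
  have B: "\<bar>\<phi> p\<bar> \<le> B" "norm (grad \<phi> p) \<le> B" for p
    using bd by blast+
  show "\<phi> \<in> L2"
    by (intro L2_of_bounded[of _ B] measurable_Omega_of_continuous test_function_continuous assms B)
  have c: "continuous_on UNIV (\<lambda>p. fst (grad \<phi> p))" "continuous_on UNIV (\<lambda>p. snd (grad \<phi> p))"
    using test_function_has_derivative(2)[OF assms] by (intro continuous_intros; simp)+
  have b: "\<bar>fst (grad \<phi> p)\<bar> \<le> B" "\<bar>snd (grad \<phi> p)\<bar> \<le> B" for p
    using B(2)[of p] norm_fst_le[of "fst (grad \<phi> p)" "snd (grad \<phi> p)"]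
      norm_snd_le[of "snd (grad \<phi> p)" "fst (grad \<phi> p)"] by simp_all
  show "(\<lambda>p. fst (grad \<phi> p)) \<in> L2"
    by (intro L2_of_bounded[of _ B] measurable_Omega_of_continuous c b)
  show "(\<lambda>p. snd (grad \<phi> p)) \<in> L2"
    by (intro L2_of_bounded[of _ B] measurable_Omega_of_continuous c b)
qed

lemma integrable_PairI:
  fixes f g :: "_ \<Rightarrow> real"
  assumes "integrable M f" "integrable M g"
  shows "integrable M (\<lambda>x. (f x, g x))"
proof -
  have "integrable M (\<lambda>x. f x *\<^sub>R (1, 0) + g x *\<^sub>R (0, 1) :: real \<times> real)"
    using assms by (intro Bochner_Integration.integrable_add integrable_scaleR_left) auto
  then show ?thesis by simp
qed

lemma integral_Pair:
  fixes f g :: "_ \<Rightarrow> real"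
  assumes "integrable M f" "integrable M g"
  shows "(LINT x|M. (f x, g x)) = (LINT x|M. f x, LINT x|M. g x)"
  using integral_bounded_linear[OF bounded_linear_fst integrable_PairI[OF assms]]
    integral_bounded_linear[OF bounded_linear_snd integrable_PairI[OF assms]]
  by (simp add: prod_eq_iff)

text \<open>The pair-valued integrals in the definition of the weak gradient, split into components, so that only
  scalar \<open>L\<^sub>2\<close> products remain.\<close>

lemma weak_gradient_iff:
  assumes "u \<in> L2"
  shows "weak_gradient u g \<longleftrightarrow> (\<lambda>p. fst (g p)) \<in> L2 \<and> (\<lambda>p. snd (g p)) \<in> L2 \<and>
    (\<forall>\<phi>. test_function \<phi> \<longrightarrow>
      L2_inner u (\<lambda>p. fst (grad \<phi> p)) = - L2_inner \<phi> (\<lambda>p. fst (g p)) \<and>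
      L2_inner u (\<lambda>p. snd (grad \<phi> p)) = - L2_inner \<phi> (\<lambda>p. snd (g p)))"
proof -
  have "(LINT p|lebesgue_on \<Omega>. u p *\<^sub>R grad \<phi> p) = - (LINT p|lebesgue_on \<Omega>. \<phi> p *\<^sub>R g p) \<longleftrightarrow>
      L2_inner u (\<lambda>p. fst (grad \<phi> p)) = - L2_inner \<phi> (\<lambda>p. fst (g p)) \<and>
      L2_inner u (\<lambda>p. snd (grad \<phi> p)) = - L2_inner \<phi> (\<lambda>p. snd (g p))"
    if "(\<lambda>p. fst (g p)) \<in> L2" "(\<lambda>p. snd (g p)) \<in> L2" "test_function \<phi>" for \<phi>
  proof -
    have 1: "(\<lambda>p. u p *\<^sub>R grad \<phi> p) = (\<lambda>p. (u p * fst (grad \<phi> p), u p * snd (grad \<phi> p)))"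
      by (auto simp: fun_eq_iff prod_eq_iff)
    have 2: "(\<lambda>p. \<phi> p *\<^sub>R g p) = (\<lambda>p. (\<phi> p * fst (g p), \<phi> p * snd (g p)))"
      by (auto simp: fun_eq_iff prod_eq_iff)
    show ?thesis
      unfolding 1 2 L2_inner_def
      by (subst (1 2) integral_Pair) (use that assms test_function_L2 in \<open>auto intro!: integrable_L2_mult\<close>)
  qed
  then show ?thesis unfolding weak_gradient_def by auto
qed

lemma integral_Omega:
  fixes f :: "real \<times> real \<Rightarrow> real"
  assumes "continuous_on UNIV f"
  shows "(LINT p|lebesgue_on \<Omega>. f p) = integral (cbox (0, 0) (1, 1)) f"
proof -
  have "bounded (f ` closure \<Omega>)"
    using continuous_on_subset[OF assms(1) subset_UNIV]
    by (intro compact_imp_bounded compact_continuous_image) (auto simp: closure_Omega_cbox)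
  then obtain B where B: "\<And>p. p \<in> closure \<Omega> \<Longrightarrow> norm (f p) \<le> B"
    by (auto simp: bounded_pos)
  have "integrable (lebesgue_on \<Omega>) f"
    by (rule integrable_Omega_of_bounded[where B = B])
      (use B[OF subsetD[OF closure_subset]] measurable_Omega_of_continuous[OF assms] in simp_all)
  from lebesgue_integral_eq_integral[OF this Omega_lebesgue]
  show ?thesis by (simp add: Omega_box integral_open_interval)
qed

text \<open>Integrate along the lines parallel to the axes: the inner integral of each partial derivative is a
  difference of boundary values of \<open>\<Phi>\<close>. Applied to a product of two test functions this is
  integration by parts.\<close>

lemma integral_gradient_eq_0:
  assumes D: "\<And>p. (\<Phi> has_derivative (\<lambda>h. h \<bullet> G p)) (at p)"
    and cont: "continuous_on UNIV G" and 0: "\<And>p. p \<notin> \<Omega> \<Longrightarrow> \<Phi> p = 0"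
  shows "(LINT p|lebesgue_on \<Omega>. fst (G p)) = 0" "(LINT p|lebesgue_on \<Omega>. snd (G p)) = 0"
proof -
  have c: "continuous_on UNIV (\<lambda>p. fst (G p))" "continuous_on UNIV (\<lambda>p. snd (G p))"
    using cont by (intro continuous_intros; simp)+
  have x: "((\<lambda>x. \<Phi> (x, y)) has_vector_derivative fst (G (x, y))) (at x within {0..1})" for x y
  proof -
    have "((\<lambda>x. (x, y)) has_derivative (\<lambda>h. (h, 0))) (at x within {0..1})"
      by (auto intro!: derivative_eq_intros)
    from has_derivative_compose[OF this D] show ?thesis
      by (simp add: has_vector_derivative_def inner_prod_def)
  qed
  have y: "((\<lambda>y. \<Phi> (x, y)) has_vector_derivative snd (G (x, y))) (at y within {0..1})" for x y
  proof -
    have "((\<lambda>y. (x, y)) has_derivative (\<lambda>h. (0, h))) (at y within {0..1})"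
      by (auto intro!: derivative_eq_intros)
    from has_derivative_compose[OF this D] show ?thesis
      by (simp add: has_vector_derivative_def inner_prod_def)
  qed
  have xi: "integral (cbox 0 1) (\<lambda>x. fst (G (x, y))) = 0" for y
    using integral_unique[OF fundamental_theorem_of_calculus[OF _ x, of y]] 0 by (simp add: \<Omega>_def)
  have yi: "integral (cbox 0 1) (\<lambda>y. snd (G (x, y))) = 0" for x
    using integral_unique[OF fundamental_theorem_of_calculus[OF _ y, of x]] 0 by (simp add: \<Omega>_def)
  have "integral (cbox (0, 0) (1, 1)) (\<lambda>p. snd (G p)) = 0"
    using integral_prod_continuous[OF continuous_on_subset[OF c(2) subset_UNIV]] yi by simp
  then show "(LINT p|lebesgue_on \<Omega>. snd (G p)) = 0" using c by (simp add: integral_Omega)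
  have "integral (cbox (0, 0) (1, 1)) (\<lambda>p. fst (G p)) =
      integral (cbox 0 1) (\<lambda>x. integral (cbox 0 1) (\<lambda>y. fst (G (x, y))))"
    by (rule integral_prod_continuous[OF continuous_on_subset[OF c(1) subset_UNIV]])
  also have "\<dots> = integral (cbox 0 1) (\<lambda>y. integral (cbox 0 1) (\<lambda>x. fst (G (x, y))))"
    using continuous_on_subset[OF c(1) subset_UNIV]
    by (intro integral_swap_continuous) (simp add: case_prod_unfold)
  finally have "integral (cbox (0, 0) (1, 1)) (\<lambda>p. fst (G p)) = 0" by (simp only: xi) simp
  then show "(LINT p|lebesgue_on \<Omega>. fst (G p)) = 0" using c by (simp add: integral_Omega)
qed

lemma weak_gradient_test_function:
  assumes "test_function \<phi>" shows "weak_gradient \<phi> (grad \<phi>)"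
  unfolding weak_gradient_iff[OF test_function_L2(1)[OF assms]]
proof (intro conjI allI impI)
  show "(\<lambda>p. fst (grad \<phi> p)) \<in> L2" "(\<lambda>p. snd (grad \<phi> p)) \<in> L2" using test_function_L2 assms by auto
next
  fix \<psi> assume psi: "test_function \<psi>"
  let ?G = "\<lambda>p. \<phi> p *\<^sub>R grad \<psi> p + \<psi> p *\<^sub>R grad \<phi> p"
  have D: "((\<lambda>p. \<phi> p * \<psi> p) has_derivative (\<lambda>h. h \<bullet> ?G p)) (at p)" for p
    using has_derivative_mult[OF test_function_has_derivative(1)[OF assms] test_function_has_derivative(1)[OF psi]]
    by (simp add: inner_add_right algebra_simps)
  have c: "continuous_on UNIV ?G"
    using assms psi by (intro continuous_intros test_function_continuous test_function_has_derivative)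
  have 0: "\<phi> p * \<psi> p = 0" if "p \<notin> \<Omega>" for p using test_function_outside assms that by simp
  note I = integral_gradient_eq_0[OF D c 0]
  show "L2_inner \<phi> (\<lambda>p. fst (grad \<psi> p)) = - L2_inner \<psi> (\<lambda>p. fst (grad \<phi> p))"
    using I(1) assms psi by (simp add: L2_inner_def test_function_L2 integrable_L2_mult)
  show "L2_inner \<phi> (\<lambda>p. snd (grad \<psi> p)) = - L2_inner \<psi> (\<lambda>p. snd (grad \<phi> p))"
    using I(2) assms psi by (simp add: L2_inner_def test_function_L2 integrable_L2_mult)
qed

section \<open>Uniqueness of weak gradients\<close>

lemma test_functionI:
  assumes "\<And>k. Ck_on UNIV k \<phi>" "\<And>p. p \<notin> cbox a b \<Longrightarrow> \<phi> p = 0" "cbox a b \<subseteq> \<Omega>"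
  shows "test_function \<phi>"
proof -
  have "{p. \<phi> p \<noteq> 0} \<subseteq> cbox a b" using assms(2) by blast
  then have *: "closure {p. \<phi> p \<noteq> 0} \<subseteq> cbox a b" by (rule closure_minimal) (rule closed_cbox)
  then have "compact (closure {p. \<phi> p \<noteq> 0})"
    by (metis bounded_cbox bounded_subset closed_closure compact_eq_bounded_closed)
  then show ?thesis unfolding test_function_def using assms(1,3) * by blast
qed

lemma One_pair: "(One :: real \<times> real) = (1, 1)"
  by (simp add: prod_eq_iff Basis_prod_def sum.union_disjoint image_iff disjoint_iff fst_sum snd_sum
    sum.reindex inj_on_def)

text \<open>The indicator of a box is the bounded pointwise limit of the test functions \<open>1 - exp(- n b)\<close>, where \<open>b\<close> is
  a bump function that is positive exactly on the box.\<close>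

lemma integral_box_eq_0:
  assumes d: "d \<in> L2" and 0: "\<And>\<phi>. test_function \<phi> \<Longrightarrow> L2_inner \<phi> d = 0" and ab: "cbox a b \<subseteq> \<Omega>"
  shows "(LINT p|lebesgue_on \<Omega>. indicator (box a b) p * d p) = 0"
proof -
  define \<phi> where "\<phi> n p = 1 + (- 1) * exp (- real n * bump a b p)" for n p
  have "test_function (\<phi> n)" for n
  proof (rule test_functionI[OF _ _ ab])
    show "Ck_on UNIV k (\<phi> n)" for k
      unfolding \<phi>_def by (intro Ck_on_add Ck_on_mult Ck_on_exp Ck_on_const Ck_on_bump)
    show "\<phi> n p = 0" if "p \<notin> cbox a b" for p
      using that bump_eq_0_iff[of a b p] box_subset_cbox[of a b] by (auto simp: \<phi>_def)
  qed
  then have z: "(LINT p|lebesgue_on \<Omega>. \<phi> n p * d p) = 0" for n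
    using 0 by (simp add: L2_inner_def)
  have m: "\<phi> n \<in> borel_measurable (lebesgue_on \<Omega>)" for n
    using \<open>test_function (\<phi> n)\<close> test_function_L2 L2D by blast
  have lim: "(\<lambda>n. \<phi> n p) \<longlonglongrightarrow> indicator (box a b) p" for p
  proof (cases "p \<in> box a b")
    case True
    then have "bump a b p > 0" by (simp add: bump_pos_iff)
    then have "(\<lambda>n. exp (- real n * bump a b p)) \<longlonglongrightarrow> 0"
      by real_asymp
    then have "(\<lambda>n. 1 + (- 1) * exp (- real n * bump a b p)) \<longlonglongrightarrow> 1 + (-1) * 0"
      by (intro tendsto_intros)
    then show ?thesis using True by (simp add: \<phi>_def)
  next
    case False
    then have "bump a b p = 0" by (simp add: bump_eq_0_iff)
    then show ?thesis using False by (simp add: \<phi>_def)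
  qed
  have bd: "\<bar>\<phi> n p\<bar> \<le> 1" for n p
    using bump_nonneg[of a b p] by (simp add: \<phi>_def)
  have "(\<lambda>n. LINT p|lebesgue_on \<Omega>. \<phi> n p * d p) \<longlonglongrightarrow> (LINT p|lebesgue_on \<Omega>. indicator (box a b) p * d p)"
  proof (rule integral_dominated_convergence[where w = "\<lambda>p. \<bar>d p\<bar>"])
    show "integrable (lebesgue_on \<Omega>) (\<lambda>p. \<bar>d p\<bar>)" using integrable_L2[OF d] by simp
    show "AE p in lebesgue_on \<Omega>. (\<lambda>n. \<phi> n p * d p) \<longlonglongrightarrow> indicator (box a b) p * d p"
      using lim by (intro AE_I2 tendsto_mult tendsto_const)
    show "AE p in lebesgue_on \<Omega>. norm (\<phi> n p * d p) \<le> \<bar>d p\<bar>" for n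
      using bd by (intro AE_I2) (simp add: abs_mult mult_left_le_one_le)
    show "(\<lambda>p. \<phi> n p * d p) \<in> borel_measurable (lebesgue_on \<Omega>)" for n
      using m L2D(1)[OF d] by auto
    have "(\<lambda>p. indicator (box a b) p :: real) \<in> borel_measurable (lebesgue_on \<Omega>)"
      by (intro measurable_restrict_space1 borel_measurable_indicator) simp
    then show "(\<lambda>p. indicator (box a b) p * d p) \<in> borel_measurable (lebesgue_on \<Omega>)"
      using L2D(1)[OF d] by (intro borel_measurable_times)
  qed
  then show ?thesis unfolding z by (simp add: LIMSEQ_const_iff)
qed

text \<open>All integrals of \<open>d\<close> over small boxes vanish, hence so does \<open>d\<close> at almost every point, by Lebesgue
  differentiation along shrinking boxes.\<close>

lemma fundamental_lemma_variations:
  assumes d: "d \<in> L2" and 0: "\<And>\<phi>. test_function \<phi> \<Longrightarrow> L2_inner \<phi> d = 0"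
  shows "AE p in lebesgue_on \<Omega>. d p = 0"
proof -
  define f where "f p = (if p \<in> \<Omega> then d p else 0)" for p
  have int: "integrable lebesgue f"
    unfolding f_def using Lebesgue_Measure.integrable_restrict_UNIV[OF Omega_lebesgue] integrable_L2[OF d] by blast
  then have ai: "f absolutely_integrable_on UNIV" by (simp add: set_integrable_def)
  have intc: "f integrable_on cbox a b" for a b
    using ai absolutely_integrable_on_subcbox set_lebesgue_integral_eq_integral(1) by blast
  have zero: "integral (cbox a b) f = 0" if ab: "cbox a b \<subseteq> \<Omega>" for a b
  proof -
    have "integral (cbox a b) f = integral (box a b) f" by (simp add: integral_open_interval)
    also have "\<dots> = (LINT p:box a b|lebesgue. f p)"
      by (intro set_lebesgue_integral_eq_integral(2)[symmetric] set_integrable_subset[OF ai]) auto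
    also have "\<dots> = (LINT p|lebesgue. indicator \<Omega> p *\<^sub>R (indicator (box a b) p * d p))"
      unfolding set_lebesgue_integral_def
      by (rule Bochner_Integration.integral_cong) (auto simp: f_def indicator_def)
    also have "\<dots> = (LINT p|lebesgue_on \<Omega>. indicator (box a b) p * d p)"
      by (rule integral_restrict_space[symmetric]) simp
    also have "\<dots> = 0" by (rule integral_box_eq_0[OF d 0 ab])
    finally show ?thesis .
  qed
  obtain N where N: "negligible N" and diff: "\<And>x e. \<lbrakk>x \<notin> N; 0 < e\<rbrakk> \<Longrightarrow>
      \<exists>r>0. \<forall>h. 0 < h \<and> h < r \<longrightarrow> norm (integral (cbox x (x + h *\<^sub>R One)) f /\<^sub>R h ^ DIM(real \<times> real) - f x) < e"
    using integrable_ccontinuous_explicit[OF intc] by metis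
  have "d p = 0" if p: "p \<in> \<Omega>" "p \<notin> N" for p
  proof (rule ccontr)
    assume "d p \<noteq> 0"
    then have "0 < \<bar>f p\<bar>" using p by (simp add: f_def)
    from diff[OF p(2) this] obtain r where r: "r > 0"
      "\<And>h. 0 < h \<Longrightarrow> h < r \<Longrightarrow> norm (integral (cbox p (p + h *\<^sub>R One)) f /\<^sub>R h ^ DIM(real \<times> real) - f p) < \<bar>f p\<bar>"
      by auto
    \<comment> \<open>Small enough for the box at \<open>p\<close> with side \<open>h\<close> to stay inside \<open>\<Omega>\<close>.\<close>
    define h where "h = min (r / 2) (min ((1 - fst p) / 2) ((1 - snd p) / 2))"
    have p': "0 < fst p" "fst p < 1" "0 < snd p" "snd p < 1" using p(1) by (auto simp: \<Omega>_def)
    have "h \<le> r / 2" by (simp add: h_def)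
    with r(1) have h1: "h < r" by linarith
    have "h \<le> (1 - fst p) / 2" unfolding h_def by (rule min.coboundedI2, rule min.cobounded1)
    with p' have h2: "fst p + h < 1" by argo
    have "h \<le> (1 - snd p) / 2" unfolding h_def by (rule min.coboundedI2, rule min.cobounded2)
    with p' have h3: "snd p + h < 1" by argo
    have "0 < h" using r(1) p' by (simp add: h_def)
    note h = this h1 h2 h3
    have "cbox p (p + h *\<^sub>R One) \<subseteq> \<Omega>"
      using h p(1) by (cases p) (auto simp: One_pair \<Omega>_def)
    from r(2)[OF h(1,2)] zero[OF this] show False by simp
  qed
  moreover have "N \<in> null_sets lebesgue" using N negligible_iff_null_sets by blast
  ultimately have "AE p in lebesgue. p \<in> \<Omega> \<longrightarrow> d p = 0"
    by (intro AE_I'[of N]) auto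
  then show ?thesis by (simp add: AE_restrict_space_iff)
qed

lemma weak_gradient_unique:
  assumes u: "u \<in> L2" and g: "weak_gradient u g" and h: "weak_gradient u h"
  shows "AE p in lebesgue_on \<Omega>. g p = h p"
proof -
  note g' = g[unfolded weak_gradient_iff[OF u]] and h' = h[unfolded weak_gradient_iff[OF u]]
  have "AE p in lebesgue_on \<Omega>. fst (g p) - fst (h p) = 0"
    by (rule fundamental_lemma_variations)
      (use g' h' in \<open>auto simp: L2_diff L2_inner_diff_right test_function_L2\<close>)
  moreover have "AE p in lebesgue_on \<Omega>. snd (g p) - snd (h p) = 0"
    by (rule fundamental_lemma_variations)
      (use g' h' in \<open>auto simp: L2_diff L2_inner_diff_right test_function_L2\<close>)
  ultimately show ?thesis by eventually_elim (simp add: prod_eq_iff)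
qed

lemma H1_L2: "u \<in> H1 \<Longrightarrow> u \<in> L2"
  by (simp add: H1_def)

lemma H01_H1: "u \<in> H01 \<Longrightarrow> u \<in> H1"
  by (simp add: H01_def)

lemma weak_gradient_wgrad: "u \<in> H1 \<Longrightarrow> weak_gradient u (wgrad u)"
  unfolding H1_def wgrad_def by (auto simp: some_eq_ex[of "weak_gradient u"])

lemma wgrad_AE_eq: "u \<in> L2 \<Longrightarrow> weak_gradient u g \<Longrightarrow> AE p in lebesgue_on \<Omega>. wgrad u p = g p"
  using weak_gradient_unique weak_gradient_wgrad unfolding H1_def by blast

lemma weak_gradient_diff:
  assumes "u \<in> L2" "v \<in> L2" "weak_gradient u g" "weak_gradient v h"
  shows "weak_gradient (\<lambda>p. u p - v p) (\<lambda>p. g p - h p)"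
  using assms(3,4) unfolding weak_gradient_iff[OF assms(1)] weak_gradient_iff[OF assms(2)]
    weak_gradient_iff[OF L2_diff[OF assms(1,2)]]
  using assms(1,2) by (auto simp: L2_diff L2_inner_diff_right L2_inner_diff_left test_function_L2)

lemma weak_gradient_L2:
  assumes "weak_gradient u g" shows "(\<lambda>p. fst (g p)) \<in> L2" "(\<lambda>p. snd (g p)) \<in> L2"
  using assms by (auto simp: weak_gradient_def)

lemma grad_inner_eq:
  assumes u: "u \<in> L2" "weak_gradient u g" and v: "v \<in> L2" "weak_gradient v h"
  shows "grad_inner u v = L2_inner (\<lambda>p. fst (g p)) (\<lambda>p. fst (h p)) + L2_inner (\<lambda>p. snd (g p)) (\<lambda>p. snd (h p))"
proof -
  have wu: "weak_gradient u (wgrad u)" and wv: "weak_gradient v (wgrad v)"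
    using assms by (auto intro!: weak_gradient_wgrad simp: H1_def)
  have "grad_inner u v = L2_inner (\<lambda>p. fst (wgrad u p)) (\<lambda>p. fst (wgrad v p))
      + L2_inner (\<lambda>p. snd (wgrad u p)) (\<lambda>p. snd (wgrad v p))"
    using weak_gradient_L2[OF wu] weak_gradient_L2[OF wv]
    by (simp add: grad_inner_def inner_prod_def L2_inner_def integrable_L2_mult)
  also have "L2_inner (\<lambda>p. fst (wgrad u p)) (\<lambda>p. fst (wgrad v p)) = L2_inner (\<lambda>p. fst (g p)) (\<lambda>p. fst (h p))"
    using wgrad_AE_eq[OF u] wgrad_AE_eq[OF v] weak_gradient_L2 wu wv u v
    by (intro L2_inner_cong_AE) auto
  also have "L2_inner (\<lambda>p. snd (wgrad u p)) (\<lambda>p. snd (wgrad v p)) = L2_inner (\<lambda>p. snd (g p)) (\<lambda>p. snd (h p))"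
    using wgrad_AE_eq[OF u] wgrad_AE_eq[OF v] weak_gradient_L2 wu wv u v
    by (intro L2_inner_cong_AE) auto
  finally show ?thesis .
qed

lemma H1_diff: "u \<in> H1 \<Longrightarrow> v \<in> H1 \<Longrightarrow> (\<lambda>p. u p - v p) \<in> H1"
  unfolding H1_def using weak_gradient_diff L2_diff by blast

lemma grad_inner_commute: "grad_inner u v = grad_inner v u"
  by (simp add: grad_inner_def inner_commute)

lemma grad_inner_nonneg: "0 \<le> grad_inner u u"
  by (simp add: grad_inner_def)

lemma grad_inner_diff_left:
  assumes "u \<in> H1" "v \<in> H1" "w \<in> H1"
  shows "grad_inner (\<lambda>p. u p - v p) w = grad_inner u w - grad_inner v w"
proof -
  note L = assms[THEN H1_L2] and W = assms[THEN weak_gradient_wgrad]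
  note G = W(1)[THEN weak_gradient_L2(1)] W(2)[THEN weak_gradient_L2(1)] W(3)[THEN weak_gradient_L2(1)]
    W(1)[THEN weak_gradient_L2(2)] W(2)[THEN weak_gradient_L2(2)] W(3)[THEN weak_gradient_L2(2)]
  show ?thesis
    unfolding grad_inner_eq[OF L2_diff[OF L(1,2)] weak_gradient_diff[OF L(1,2) W(1,2)] L(3) W(3)]
      grad_inner_eq[OF L(1) W(1) L(3) W(3)] grad_inner_eq[OF L(2) W(2) L(3) W(3)]
    using G by (simp add: L2_inner_diff_left)
qed

lemma L2_cong:
  assumes "\<And>p. p \<in> \<Omega> \<Longrightarrow> u p = v p" shows "u \<in> L2 \<longleftrightarrow> v \<in> L2"
proof -
  have "u \<in> borel_measurable (lebesgue_on \<Omega>) \<longleftrightarrow> v \<in> borel_measurable (lebesgue_on \<Omega>)"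
    by (rule measurable_cong) (use assms in simp)
  moreover have "integrable (lebesgue_on \<Omega>) (\<lambda>p. (u p)\<^sup>2) \<longleftrightarrow> integrable (lebesgue_on \<Omega>) (\<lambda>p. (v p)\<^sup>2)"
    by (rule Bochner_Integration.integrable_cong) (use assms in auto)
  ultimately show ?thesis by (simp add: L2_def)
qed

lemma L2_inner_cong:
  assumes "\<And>p. p \<in> \<Omega> \<Longrightarrow> u p * v p = u' p * v' p" shows "L2_inner u v = L2_inner u' v'"
  unfolding L2_inner_def by (rule Bochner_Integration.integral_cong) (use assms in auto)

lemma wgrad_cong:
  assumes "\<And>p. p \<in> \<Omega> \<Longrightarrow> u p = v p" shows "weak_gradient u = weak_gradient v" "wgrad u = wgrad v"
proof -
  have "(LINT p|lebesgue_on \<Omega>. u p *\<^sub>R grad \<phi> p) = (LINT p|lebesgue_on \<Omega>. v p *\<^sub>R grad \<phi> p)" for \<phi>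
    by (rule Bochner_Integration.integral_cong) (use assms in auto)
  then show "weak_gradient u = weak_gradient v" by (simp add: weak_gradient_def fun_eq_iff)
  then show "wgrad u = wgrad v" by (simp add: wgrad_def)
qed

lemma H01_cong:
  assumes "\<And>p. p \<in> \<Omega> \<Longrightarrow> u p = v p" "u \<in> H01" shows "v \<in> H01"
proof -
  have 1: "L2_norm (\<lambda>p. u p - \<phi> p) = L2_norm (\<lambda>p. v p - \<phi> p)" for \<phi>
    unfolding L2_norm_def using L2_inner_cong[of "\<lambda>p. u p - \<phi> p" "\<lambda>p. u p - \<phi> p" "\<lambda>p. v p - \<phi> p" "\<lambda>p. v p - \<phi> p"] assms(1) by simp
  have 2: "H1_seminorm (\<lambda>p. u p - \<phi> p) = H1_seminorm (\<lambda>p. v p - \<phi> p)" for \<phi>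
    unfolding H1_seminorm_def grad_inner_def using wgrad_cong(2)[of "\<lambda>p. u p - \<phi> p" "\<lambda>p. v p - \<phi> p"] assms(1) by simp
  have 3: "v \<in> H1" if "u \<in> H1" using that L2_cong[OF assms(1)] wgrad_cong(1)[OF assms(1)] by (simp add: H1_def)
  show ?thesis using assms(2) 3 by (simp add: H01_def 1 2)
qed

section \<open>Convolution with a mollifier\<close>

lemma continuous_on_comp_UNIV:
  "continuous_on UNIV g \<Longrightarrow> continuous_on S f \<Longrightarrow> continuous_on S (\<lambda>x. g (f x))"
  by (rule continuous_on_compose2[of UNIV g]) auto

lemma continuous_on_kernel:
  fixes g :: "real \<times> real \<Rightarrow> 'b::real_normed_vector"
  assumes "continuous_on UNIV w" "continuous_on UNIV g"
  shows "continuous_on S (\<lambda>x. w (snd x) *\<^sub>R g (snd x - (b + r *\<^sub>R fst x)))"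
    and "continuous_on T (\<lambda>q. w q *\<^sub>R g (q - (b + r *\<^sub>R p)))"
proof -
  have "continuous_on S (\<lambda>x. w (snd x))" for S
    by (rule continuous_on_comp_UNIV[OF assms(1)]) (intro continuous_intros)
  moreover have "continuous_on S (\<lambda>x. g (snd x - (b + r *\<^sub>R fst x)))" for S
    by (rule continuous_on_comp_UNIV[OF assms(2)]) (intro continuous_intros)
  ultimately show *: "continuous_on S (\<lambda>x. w (snd x) *\<^sub>R g (snd x - (b + r *\<^sub>R fst x)))" for S
    by (intro continuous_on_scaleR)
  have "continuous_on T (\<lambda>q. (p, q))" by (intro continuous_intros)
  from continuous_on_comp_UNIV[OF *[of UNIV] this]
  show "continuous_on T (\<lambda>q. w q *\<^sub>R g (q - (b + r *\<^sub>R p)))" by simp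
qed

text \<open>The kernel is evaluated at \<open>q - (b + r p)\<close>, so that differentiation in \<open>p\<close> falls on the kernel \<open>\<eta>\<close>
  and reproduces a convolution of the same form with \<open>- r\<close> times a partial derivative of \<open>\<eta>\<close>. For this
  reason the induction generalises over \<open>\<eta>\<close>. The affine argument is that of the dilation
  used below to push supports into the interior of the square.\<close>

lemma Ck_on_convolution:
  fixes b :: "real \<times> real"
  assumes w: "continuous_on UNIV w"
  shows "Ck_on UNIV k \<eta> \<Longrightarrow>
    Ck_on UNIV k (\<lambda>p. integral (cbox (0, 0) (1, 1)) (\<lambda>q. w q * \<eta> (q - (b + r *\<^sub>R p))))"
proof (induction k arbitrary: \<eta>)
  case 0
  then have "continuous_on (UNIV \<times> cbox (0, 0) (1, 1)) (\<lambda>x. w (snd x) *\<^sub>R \<eta> (snd x - (b + r *\<^sub>R fst x)))"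
    by (intro continuous_on_kernel w) simp
  then show ?case
    unfolding Ck_on.simps by (intro integral_continuous_on_param) (simp add: case_prod_unfold)
next
  case (Suc k)
  obtain g where g: "\<forall>p\<in>UNIV. (\<eta> has_derivative (\<lambda>h. h \<bullet> g p)) (at p)"
      "Ck_on UNIV k (\<lambda>p. fst (g p))" "Ck_on UNIV k (\<lambda>p. snd (g p))"
    using Suc.prems by (rule Ck_on_SucE)
  have cg: "continuous_on UNIV g"
    using continuous_on_Pair[OF g(2)[THEN Ck_on_continuous] g(3)[THEN Ck_on_continuous]] by simp
  have c\<eta>: "continuous_on UNIV \<eta>" using Suc.prems by (rule Ck_on_continuous)
  let ?B = "cbox (0, 0) (1, 1) :: (real \<times> real) set"
  let ?v = "\<lambda>p q. (w q * (- r)) *\<^sub>R g (q - (b + r *\<^sub>R p))"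
  have w': "continuous_on UNIV (\<lambda>q. w q * (- r))" by (intro continuous_intros w)
  have cv: "continuous_on (UNIV \<times> ?B) (\<lambda>x. ?v (fst x) (snd x))"
    by (rule continuous_on_kernel(1)[OF w' cg])
  have vi: "?v p integrable_on ?B" for p
    by (intro integrable_continuous continuous_on_kernel(2)[OF w' cg])
  show ?case
  proof (rule Ck_on_SucI[where g = "\<lambda>p. integral ?B (?v p)"])
    show "\<forall>p\<in>UNIV. ((\<lambda>p. integral ?B (\<lambda>q. w q * \<eta> (q - (b + r *\<^sub>R p)))) has_derivative
        (\<lambda>h. h \<bullet> integral ?B (?v p))) (at p)"
    proof
      fix p
      have "((\<lambda>p. integral ?B (\<lambda>q. w q * \<eta> (q - (b + r *\<^sub>R p)))) has_derivative
          integral ?B (\<lambda>q. blinfun_inner_left (?v p q))) (at p within UNIV)"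
      proof (rule leibniz_rule)
        show "((\<lambda>p. w q * \<eta> (q - (b + r *\<^sub>R p))) has_derivative
            blinfun_apply (blinfun_inner_left (?v p q))) (at p within UNIV)" for p q
        proof -
          have "((\<lambda>p. q - (b + r *\<^sub>R p)) has_derivative (\<lambda>h. - (r *\<^sub>R h))) (at p)"
            by (auto intro!: derivative_eq_intros)
          from has_derivative_compose[OF this g(1)[rule_format, OF UNIV_I]]
          have "((\<lambda>p. w q * \<eta> (q - (b + r *\<^sub>R p))) has_derivative
              (\<lambda>h. w q * (- (r *\<^sub>R h) \<bullet> g (q - (b + r *\<^sub>R p))))) (at p)"
            by (rule has_derivative_mult_right)
          then show ?thesis by (simp add: mult.assoc)
        qed
        show "(\<lambda>q. w q * \<eta> (q - (b + r *\<^sub>R p))) integrable_on ?B" for p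
          using continuous_on_kernel(2)[OF w c\<eta>] by (intro integrable_continuous) simp
        have "continuous_on (UNIV \<times> ?B) (\<lambda>x. blinfun_inner_left (?v (fst x) (snd x)))"
          by (rule bounded_linear.continuous_on[OF bounded_linear_blinfun_inner_left cv])
        then show "continuous_on (UNIV \<times> ?B) (\<lambda>(p, q). blinfun_inner_left (?v p q))"
          by (simp add: case_prod_unfold)
      qed auto
      moreover have "integral ?B (\<lambda>q. blinfun_inner_left (?v p q)) = blinfun_inner_left (integral ?B (?v p))"
        using integral_linear[OF vi bounded_linear_blinfun_inner_left] by (simp add: o_def)
      ultimately show "((\<lambda>p. integral ?B (\<lambda>q. w q * \<eta> (q - (b + r *\<^sub>R p)))) has_derivative
        (\<lambda>h. h \<bullet> integral ?B (?v p))) (at p)" by simp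
    qed
    have f: "fst (integral ?B (?v p)) = integral ?B (\<lambda>q. w q * ((- r) * fst (g (q - (b + r *\<^sub>R p)))))" for p
      using integral_linear[OF vi bounded_linear_fst, symmetric] by (simp add: o_def mult.assoc)
    show "Ck_on UNIV k (\<lambda>p. fst (integral ?B (?v p)))"
      unfolding f by (rule Suc.IH[where \<eta> = "\<lambda>z. (- r) * fst (g z)"]) (intro Ck_on_mult Ck_on_const g(2))
    have s: "snd (integral ?B (?v p)) = integral ?B (\<lambda>q. w q * ((- r) * snd (g (q - (b + r *\<^sub>R p)))))" for p
      using integral_linear[OF vi bounded_linear_snd, symmetric] by (simp add: o_def mult.assoc)
    show "Ck_on UNIV k (\<lambda>p. snd (integral ?B (?v p)))"
      unfolding s by (rule Suc.IH[where \<eta> = "\<lambda>z. (- r) * snd (g z)"]) (intro Ck_on_mult Ck_on_const g(3))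
  qed
qed

definition mollifier :: "real \<Rightarrow> (real \<times> real \<Rightarrow> real) \<Rightarrow> bool" where
  "mollifier \<delta> \<eta> \<longleftrightarrow> (\<forall>k. Ck_on UNIV k \<eta>) \<and> (\<forall>z. 0 \<le> \<eta> z) \<and>
     (\<forall>z. z \<notin> box (- \<delta>, - \<delta>) (\<delta>, \<delta>) \<longrightarrow> \<eta> z = 0) \<and> (LINT z|lborel. \<eta> z) = 1"

lemma integrable_mult_compact_support:
  fixes F \<eta> :: "real \<times> real \<Rightarrow> real"
  assumes "continuous_on UNIV F" "continuous_on UNIV \<eta>" "\<And>z. z \<notin> box a b \<Longrightarrow> \<eta> z = 0"
  shows "integrable lborel (\<lambda>z. F z * \<eta> z)"
proof -
  have "continuous_on (cbox a b) (\<lambda>z. F z * \<eta> z)"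
    by (rule continuous_on_subset[OF _ subset_UNIV]) (intro continuous_intros assms)
  from borel_integrable_compact[OF compact_cbox this]
  have "integrable lborel (\<lambda>z. indicator (cbox a b) z *\<^sub>R (F z * \<eta> z))" .
  moreover have "(\<lambda>z. indicator (cbox a b) z *\<^sub>R (F z * \<eta> z)) = (\<lambda>z. F z * \<eta> z)"
  proof
    fix z show "indicator (cbox a b) z *\<^sub>R (F z * \<eta> z) = F z * \<eta> z"
      using assms(3)[of z] box_subset_cbox[of a b] by (cases "z \<in> box a b") (auto simp: indicator_def)
  qed
  ultimately show ?thesis by metis
qed

lemma mollifier_exists:
  assumes "\<delta> > 0" shows "\<exists>\<eta>. mollifier \<delta> \<eta>"
proof -
  let ?b = "bump (- \<delta>, - \<delta>) (\<delta>, \<delta>)"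
  have c: "continuous_on UNIV ?b" using Ck_on_bump Ck_on_continuous by blast
  have int: "integrable lborel ?b"
    using integrable_mult_compact_support[OF continuous_on_const[of _ 1] c] by (simp add: bump_eq_0_iff)
  have "(LINT z|lborel. ?b z) \<noteq> 0"
  proof
    assume "(LINT z|lborel. ?b z) = 0"
    then have "AE z in lborel. ?b z = 0"
      using integral_nonneg_eq_0_iff_AE[OF int] bump_nonneg by simp
    then have "AE z in lborel. z \<notin> box (- \<delta>, - \<delta>) (\<delta>, \<delta>)" by (simp add: bump_eq_0_iff)
    then have "emeasure lborel (box (- \<delta>, - \<delta>) (\<delta>, \<delta>)) = 0"
      by (subst (asm) AE_iff_null_sets[symmetric]) auto
    then show False using assms by (simp add: emeasure_lborel_box_eq Basis_prod_def ball_Un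
        prod.union_disjoint image_iff disjoint_iff prod.reindex inj_on_def split: if_splits)
  qed
  then have Z: "(LINT z|lborel. ?b z) > 0"
    using Bochner_Integration.integral_nonneg[of lborel ?b] bump_nonneg[of "(- \<delta>, - \<delta>)" "(\<delta>, \<delta>)"] by (simp add: less_le)
  let ?\<eta> = "\<lambda>z. (1 / (LINT z|lborel. ?b z)) * ?b z"
  have "Ck_on UNIV k ?\<eta>" for k
    by (intro Ck_on_mult Ck_on_const Ck_on_bump)
  moreover have "0 \<le> ?\<eta> z" for z
    using Z bump_nonneg[of "(- \<delta>, - \<delta>)" "(\<delta>, \<delta>)" z] by simp
  moreover have "?\<eta> z = 0" if "z \<notin> box (- \<delta>, - \<delta>) (\<delta>, \<delta>)" for z
    using that by (simp add: bump_eq_0_iff)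
  moreover have "(LINT z|lborel. ?\<eta> z) = 1" using Z by simp
  ultimately have "mollifier \<delta> ?\<eta>" unfolding mollifier_def by blast
  then show ?thesis by blast
qed

lemma mollifier_continuous: "mollifier \<delta> \<eta> \<Longrightarrow> continuous_on UNIV \<eta>"
  using Ck_on_continuous unfolding mollifier_def by blast

text \<open>An average against a probability density inherits the pointwise bounds of the averaged function. Both
  the convergence of mollifications and the bounds on their gradients are instances.\<close>

lemma mollifier_average_bound:
  assumes \<eta>: "mollifier \<delta> \<eta>" and F: "continuous_on UNIV F"
    and B: "\<And>z. z \<in> box (- \<delta>, - \<delta>) (\<delta>, \<delta>) \<Longrightarrow> \<bar>F z\<bar> \<le> B"
  shows "\<bar>LINT z|lborel. F z * \<eta> z\<bar> \<le> B"
proof -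
  note i = integrable_mult_compact_support[OF _ mollifier_continuous[OF \<eta>], of _ "(- \<delta>, - \<delta>)" "(\<delta>, \<delta>)"]
  have 0: "\<And>z. z \<notin> box (- \<delta>, - \<delta>) (\<delta>, \<delta>) \<Longrightarrow> \<eta> z = 0" "\<And>z. 0 \<le> \<eta> z" "(LINT z|lborel. \<eta> z) = 1"
    using \<eta> unfolding mollifier_def by blast+
  have "\<bar>LINT z|lborel. F z * \<eta> z\<bar> \<le> (LINT z|lborel. \<bar>F z * \<eta> z\<bar>)"
    using integral_norm_bound[of lborel "\<lambda>z. F z * \<eta> z"] by simp
  also have "\<dots> \<le> (LINT z|lborel. B * \<eta> z)"
  proof (rule Bochner_Integration.integral_mono)
    show "integrable lborel (\<lambda>z. \<bar>F z * \<eta> z\<bar>)" by (intro integrable_abs i F 0)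
    show "integrable lborel (\<lambda>z. B * \<eta> z)" by (intro i continuous_on_const 0)
    show "\<bar>F z * \<eta> z\<bar> \<le> B * \<eta> z" for z
      using B[of z] 0(1)[of z] 0(2)[of z] by (cases "\<eta> z = 0") (auto simp: abs_mult mult_right_mono)
  qed
  also have "\<dots> = B" by (simp add: 0)
  finally show ?thesis .
qed

text \<open>The left-hand side shows smoothness in \<open>a\<close>, since only the smooth kernel depends on it. The right-hand
  side shows that differences of values are averages of differences of values of \<open>w\<close>.\<close>

lemma convolution_shift:
  fixes w \<eta> :: "real \<times> real \<Rightarrow> real"
  assumes w: "continuous_on UNIV w" "\<And>q. q \<notin> \<Omega> \<Longrightarrow> w q = 0" and \<eta>: "continuous_on UNIV \<eta>"
  shows "integral (cbox (0, 0) (1, 1)) (\<lambda>q. w q * \<eta> (q - a)) = (LINT z|lborel. w (a + z) * \<eta> z)"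
proof -
  let ?B = "cbox (0, 0) (1, 1) :: (real \<times> real) set"
  let ?f = "\<lambda>q. w q * \<eta> (q - a)"
  have c: "continuous_on UNIV ?f"
    using continuous_on_kernel(2)[OF w(1) \<eta>, of _ a 0] by simp
  have "set_integrable lborel ?B ?f"
    unfolding set_integrable_def by (rule borel_integrable_compact[OF compact_cbox continuous_on_subset[OF c subset_UNIV]])
  then have "integral ?B ?f = (LINT q:?B|lborel. ?f q)"
    by (simp add: set_borel_integral_eq_integral)
  also have "\<dots> = (LINT q|lborel. ?f q)"
  proof -
    have "indicator ?B q *\<^sub>R ?f q = ?f q" for q
      using w(2)[of q] closure_subset[of \<Omega>] unfolding closure_Omega_cbox
      by (cases "q \<in> \<Omega>") (auto simp: indicator_def)
    then show ?thesis unfolding set_lebesgue_integral_def by metis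
  qed
  also have "\<dots> = (LINT q|distr lborel borel ((+) a). ?f q)"
    by (simp add: lborel_distr_plus)
  also have "\<dots> = (LINT z|lborel. ?f (a + z))"
    by (rule integral_distr) (auto intro!: borel_measurable_continuous_onI c)
  finally show ?thesis by simp
qed

lemma has_derivative_direction_bound:
  fixes f :: "real \<times> real \<Rightarrow> real"
  assumes D: "(f has_derivative D) (at p)"
    and B: "\<forall>\<^sub>F t in at_right 0. \<bar>f (p + t *\<^sub>R d) - f p - t * c\<bar> \<le> K * t"
  shows "\<bar>D d - c\<bar> \<le> K"
proof -
  have lin: "linear D" using D has_derivative_linear by blast
  have "((\<lambda>t. p + t *\<^sub>R d) has_derivative (\<lambda>h. h *\<^sub>R d)) (at 0)"
    by (auto intro!: derivative_eq_intros)
  moreover have "(f has_derivative D) (at (p + 0 *\<^sub>R d))" using D by simp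
  ultimately have "((\<lambda>t. f (p + t *\<^sub>R d)) has_derivative (\<lambda>h. D (h *\<^sub>R d))) (at 0)"
    by (rule has_derivative_compose)
  moreover have "(\<lambda>h. D (h *\<^sub>R d)) = (*) (D d)"
    by (rule ext) (simp add: linear_cmul[OF lin] mult.commute)
  ultimately have "((\<lambda>t. f (p + t *\<^sub>R d)) has_real_derivative D d) (at 0)"
    by (simp add: has_field_derivative_def)
  then have "((\<lambda>t. (f (p + t *\<^sub>R d) - f p) / t) \<longlongrightarrow> D d) (at 0)"
    by (simp add: DERIV_def)
  then have "((\<lambda>t. \<bar>(f (p + t *\<^sub>R d) - f p) / t - c\<bar>) \<longlongrightarrow> \<bar>D d - c\<bar>) (at_right 0)"
    by (intro tendsto_intros filterlim_at_within_not_equal) (auto intro: tendsto_within_subset)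
  moreover have "\<forall>\<^sub>F t in at_right 0. \<bar>(f (p + t *\<^sub>R d) - f p) / t - c\<bar> \<le> K"
    using B eventually_at_right_less[of 0]
  proof eventually_elim
    case (elim t)
    have "(f (p + t *\<^sub>R d) - f p) / t - c = (f (p + t *\<^sub>R d) - f p - t * c) / t"
      using elim by (simp add: field_simps)
    then show ?case using elim by (simp add: abs_divide divide_le_eq)
  qed
  ultimately show ?thesis by (rule tendsto_upperbound) simp
qed

section \<open>Approximation of Lipschitz functions by test functions\<close>

lemma norm_le_of_box:
  assumes "z \<in> box (- \<delta>, - \<delta>) (\<delta>, \<delta>)" shows "norm z \<le> 2 * \<delta>"
proof -
  have "\<bar>fst z\<bar> \<le> \<delta> \<and> \<bar>snd z\<bar> \<le> \<delta>"
    using assms by (cases z) (auto simp: mem_box Basis_prod_def ball_Un)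
  then show ?thesis using norm_Pair_le[of "fst z" "snd z"] by simp
qed

text \<open>The dilation by \<open>r\<close> about the centre \<open>(1/2, 1/2)\<close> of the square. For \<open>r > 1\<close>, composing with it shrinks
  supports towards the centre.\<close>

definition dilation :: "real \<Rightarrow> real \<times> real \<Rightarrow> real \<times> real" where
  "dilation r p = ((1 - r) / 2, (1 - r) / 2) + r *\<^sub>R p"

definition contracted_mollification ::
    "real \<Rightarrow> (real \<times> real \<Rightarrow> real) \<Rightarrow> (real \<times> real \<Rightarrow> real) \<Rightarrow> real \<times> real \<Rightarrow> real" where
  "contracted_mollification r \<eta> w p = integral (cbox (0, 0) (1, 1)) (\<lambda>q. w q * \<eta> (q - dilation r p))"

lemma contracted_mollification_eq:
  assumes "continuous_on UNIV w" "\<And>q. q \<notin> \<Omega> \<Longrightarrow> w q = 0" "mollifier \<delta> \<eta>"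
  shows "contracted_mollification r \<eta> w p = (LINT z|lborel. w (dilation r p + z) * \<eta> z)"
  unfolding contracted_mollification_def
  by (rule convolution_shift[OF assms(1,2) mollifier_continuous[OF assms(3)]])

text \<open>The number \<open>s\<close> is chosen so that \<open>r s = 1/2 + \<delta>\<close>: outside the square of half-width \<open>s\<close> the dilated point
  has left the unit square by more than the radius \<open>\<delta>\<close> of the mollifier. As \<open>s < 1/2\<close>, the mollified function
  has compact support in \<open>\<Omega>\<close>.\<close>

lemma dilation_exits_Omega:
  assumes "0 < \<delta>" "r = 1 + 4 * \<delta>" "s = (1 / 2 + \<delta>) / r"
    and p: "p \<notin> cbox (1 / 2 - s, 1 / 2 - s) (1 / 2 + s, 1 / 2 + s)" and z: "z \<in> box (- \<delta>, - \<delta>) (\<delta>, \<delta>)"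
  shows "dilation r p + z \<notin> \<Omega>"
proof -
  obtain x y where xy: "p = (x, y)" by (cases p)
  obtain a b where ab: "z = (a, b)" by (cases z)
  have r: "r > 0" using assms by simp
  have rs: "r * s = 1 / 2 + \<delta>" using r assms(3) by simp
  have abd: "\<bar>a\<bar> < \<delta> \<and> \<bar>b\<bar> < \<delta>" using z unfolding ab by (auto simp: mem_box Basis_prod_def ball_Un)
  have *: "v \<le> 0 \<or> 1 \<le> v"
    if "t < 1 / 2 - s \<or> 1 / 2 + s < t" "\<bar>e\<bar> < \<delta>" "v = (1 - r) / 2 + r * t + e" for t e v
    using that(1)
  proof
    assume "t < 1 / 2 - s"
    from mult_strict_left_mono[OF this r] have "r * t < r / 2 - (1 / 2 + \<delta>)" using rs by (simp add: right_diff_distrib)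
    then have "v \<le> 0" using that(2,3) by argo
    then show ?thesis ..
  next
    assume "1 / 2 + s < t"
    from mult_strict_left_mono[OF this r] have "r * t > r / 2 + (1 / 2 + \<delta>)" using rs by (simp add: distrib_left)
    then have "1 \<le> v" using that(2,3) by argo
    then show ?thesis ..
  qed
  have "(x < 1 / 2 - s \<or> 1 / 2 + s < x) \<or> (y < 1 / 2 - s \<or> 1 / 2 + s < y)"
    using p unfolding xy by auto
  then show ?thesis
  proof
    assume "x < 1 / 2 - s \<or> 1 / 2 + s < x"
    from *[OF this, of a "(1 - r) / 2 + r * x + a"] show ?thesis
      using abd by (auto simp: \<Omega>_def dilation_def xy ab)
  next
    assume "y < 1 / 2 - s \<or> 1 / 2 + s < y"
    from *[OF this, of b "(1 - r) / 2 + r * y + b"] show ?thesis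
      using abd by (auto simp: \<Omega>_def dilation_def xy ab)
  qed
qed

lemma test_function_contracted_mollification:
  assumes "0 < \<delta>" "r = 1 + 4 * \<delta>" and w: "continuous_on UNIV w" "\<And>q. q \<notin> \<Omega> \<Longrightarrow> w q = 0"
    and \<eta>: "mollifier \<delta> \<eta>"
  shows "test_function (contracted_mollification r \<eta> w)"
proof -
  define s where "s = (1 / 2 + \<delta>) / r"
  have s: "s < 1 / 2" using assms(1,2) by (simp add: s_def field_simps)
  show ?thesis
  proof (rule test_functionI)
    show "Ck_on UNIV k (contracted_mollification r \<eta> w)" for k
      unfolding contracted_mollification_def[abs_def] dilation_def
      using Ck_on_convolution[OF w(1)] \<eta> unfolding mollifier_def by blast
    show "contracted_mollification r \<eta> w p = 0"
      if p: "p \<notin> cbox (1 / 2 - s, 1 / 2 - s) (1 / 2 + s, 1 / 2 + s)" for p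
    proof -
      have "w (dilation r p + z) * \<eta> z = 0" for z
      proof (cases "z \<in> box (- \<delta>, - \<delta>) (\<delta>, \<delta>)")
        case True
        then show ?thesis using w(2)[OF dilation_exits_Omega[OF assms(1,2) s_def p True]] by simp
      next
        case False
        then have "\<eta> z = 0" using \<eta> unfolding mollifier_def by blast
        then show ?thesis by simp
      qed
      then have z: "(\<lambda>z. w (dilation r p + z) * \<eta> z) = (\<lambda>z. 0)" ..
      have "contracted_mollification r \<eta> w p = (LINT z|lborel. w (dilation r p + z) * \<eta> z)"
        by (rule contracted_mollification_eq[OF w \<eta>])
      then show ?thesis unfolding z by simp
    qed
    show "cbox (1 / 2 - s, 1 / 2 - s) (1 / 2 + s, 1 / 2 + s) \<subseteq> \<Omega>"
      using s unfolding cbox_Pair_eq \<Omega>_def by auto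
  qed
qed

text \<open>Mollification does not increase the distance to an affine function, measured by a Lipschitz constant on
  a set. With \<open>G = 0\<close> it bounds the gradient; with small \<open>\<kappa>\<close> it shows that gradients
  converge, without any derivative of \<open>w\<close> appearing under an integral.\<close>

lemma contracted_mollification_local:
  assumes w: "continuous_on UNIV w" "\<And>q. q \<notin> \<Omega> \<Longrightarrow> w q = 0" and \<eta>: "mollifier \<delta> \<eta>" and r: "0 \<le> r"
    and U: "\<And>q q'. q \<in> U \<Longrightarrow> q' \<in> U \<Longrightarrow> \<bar>w q - w q' - (q - q') \<bullet> G\<bar> \<le> \<kappa> * norm (q - q')"
    and p: "\<And>z. z \<in> box (- \<delta>, - \<delta>) (\<delta>, \<delta>) \<Longrightarrow> dilation r p + z \<in> U"
    and p': "\<And>z. z \<in> box (- \<delta>, - \<delta>) (\<delta>, \<delta>) \<Longrightarrow> dilation r p' + z \<in> U"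
  shows "\<bar>contracted_mollification r \<eta> w p - contracted_mollification r \<eta> w p' - r * ((p - p') \<bullet> G)\<bar>
    \<le> \<kappa> * r * norm (p - p')"
proof -
  let ?F = "\<lambda>z. w (dilation r p + z) - w (dilation r p' + z) - r * ((p - p') \<bullet> G)"
  have 0: "\<And>z. z \<notin> box (- \<delta>, - \<delta>) (\<delta>, \<delta>) \<Longrightarrow> \<eta> z = 0" "(LINT z|lborel. \<eta> z) = 1"
    using \<eta> unfolding mollifier_def by blast+
  have c: "continuous_on UNIV (\<lambda>z. w (a + z))" for a
    by (rule continuous_on_comp_UNIV[OF w(1)]) (intro continuous_intros)
  have i: "integrable lborel (\<lambda>z. w (a + z) * \<eta> z)" for a
    by (rule integrable_mult_compact_support[OF c mollifier_continuous[OF \<eta>] 0(1)])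
  have i1: "integrable lborel (\<lambda>z. K * \<eta> z)" for K
    by (rule integrable_mult_compact_support[OF continuous_on_const mollifier_continuous[OF \<eta>] 0(1)])
  have "(LINT z|lborel. ?F z * \<eta> z) = (LINT z|lborel. w (dilation r p + z) * \<eta> z)
      - (LINT z|lborel. w (dilation r p' + z) * \<eta> z) - (LINT z|lborel. r * ((p - p') \<bullet> G) * \<eta> z)"
    unfolding left_diff_distrib
    by (subst Bochner_Integration.integral_diff, rule Bochner_Integration.integrable_diff[OF i i], rule i1,
        subst Bochner_Integration.integral_diff[OF i i], rule refl)
  then have "contracted_mollification r \<eta> w p - contracted_mollification r \<eta> w p' - r * ((p - p') \<bullet> G) =
      (LINT z|lborel. ?F z * \<eta> z)"
    using 0(2) contracted_mollification_eq[OF w \<eta>] by simp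
  also have "\<bar>\<dots>\<bar> \<le> \<kappa> * r * norm (p - p')"
  proof (rule mollifier_average_bound[OF \<eta>])
    show "continuous_on UNIV ?F" by (intro continuous_intros c)
    show "\<bar>?F z\<bar> \<le> \<kappa> * r * norm (p - p')" if z: "z \<in> box (- \<delta>, - \<delta>) (\<delta>, \<delta>)" for z
    proof -
      have d: "dilation r p + z - (dilation r p' + z) = r *\<^sub>R (p - p')"
        by (simp add: dilation_def algebra_simps)
      show ?thesis using U[OF p[OF z] p'[OF z]] r unfolding d by (simp add: mult.assoc)
    qed
  qed
  finally show ?thesis .
qed

lemma test_function_grad_bound:
  assumes "test_function \<phi>" and K: "0 \<le> K"
    and "\<forall>\<^sub>F p' in nhds p. \<bar>\<phi> p' - \<phi> p - (p' - p) \<bullet> G\<bar> \<le> K * norm (p' - p)"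
  shows "norm (grad \<phi> p - G) \<le> K"
proof -
  let ?d = "grad \<phi> p - G"
  have "\<bar>?d \<bullet> grad \<phi> p - ?d \<bullet> G\<bar> \<le> K * norm ?d"
  proof (rule has_derivative_direction_bound[OF test_function_has_derivative(1)[OF assms(1)]])
    have "((\<lambda>t. p + t *\<^sub>R ?d) \<longlongrightarrow> p + 0 *\<^sub>R ?d) (at_right 0)" by (intro tendsto_intros)
    then have "((\<lambda>t. p + t *\<^sub>R ?d) \<longlongrightarrow> p) (at_right 0)" by simp
    from eventually_compose_filterlim[OF assms(3) this]
    have "\<forall>\<^sub>F t in at_right 0. \<bar>\<phi> (p + t *\<^sub>R ?d) - \<phi> p - (p + t *\<^sub>R ?d - p) \<bullet> G\<bar> \<le> K * norm (p + t *\<^sub>R ?d - p)" .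
    then show "\<forall>\<^sub>F t in at_right 0. \<bar>\<phi> (p + t *\<^sub>R ?d) - \<phi> p - t * (?d \<bullet> G)\<bar> \<le> K * norm ?d * t"
      using eventually_at_right_less[of 0]
    proof eventually_elim
      case (elim t)
      then show ?case by (simp add: ac_simps)
    qed
  qed
  then have "(norm ?d)\<^sup>2 \<le> K * norm ?d"
    by (simp add: power2_norm_eq_inner inner_diff_right[symmetric])
  then show ?thesis
    using K by (cases "?d = 0") (auto simp: power2_eq_square)
qed

text \<open>The condition on \<open>\<rho>\<close> makes the ball about \<open>p\<close> contain every point that the dilation by \<open>1 + 4 \<delta>\<close> and the
  mollifier of radius \<open>\<delta>\<close> can reach from points near \<open>p\<close>.\<close>

lemma strict_lipschitz_mollification_grad:
  assumes w: "continuous_on UNIV w" "\<And>q. q \<notin> \<Omega> \<Longrightarrow> w q = 0" and \<eta>: "mollifier \<delta> \<eta>"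
    and \<delta>: "0 < \<delta>" "r = 1 + 4 * \<delta>" and \<kappa>: "0 \<le> \<kappa>" and \<rho>: "4 * \<delta> * norm (p - (1/2, 1/2)) + 2 * \<delta> < \<rho>"
    and U: "\<And>q q'. q \<in> ball p \<rho> \<Longrightarrow> q' \<in> ball p \<rho> \<Longrightarrow> \<bar>w q - w q' - (q - q') \<bullet> G\<bar> \<le> \<kappa> * norm (q - q')"
  shows "norm (grad (contracted_mollification r \<eta> w) p - r *\<^sub>R G) \<le> \<kappa> * r"
proof (rule test_function_grad_bound)
  show "test_function (contracted_mollification r \<eta> w)"
    by (rule test_function_contracted_mollification[OF \<delta> w \<eta>])
  show "0 \<le> \<kappa> * r" using \<delta> \<kappa> by simp
  define \<sigma> where "\<sigma> = (\<rho> - (4 * \<delta> * norm (p - (1/2, 1/2)) + 2 * \<delta>)) / r"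
  have r0: "0 < r" using \<delta> by simp
  have \<sigma>: "0 < \<sigma>" unfolding \<sigma>_def using \<rho> r0 by simp
  have dist: "norm (dilation r p' + z - p) < \<rho>"
    if "z \<in> box (- \<delta>, - \<delta>) (\<delta>, \<delta>)" "norm (p' - p) < \<sigma>" for z p'
  proof -
    have "dilation r p' + z - p = r *\<^sub>R (p' - p) + (4 * \<delta>) *\<^sub>R (p - (1/2, 1/2)) + z"
      using \<delta>(2) by (cases p; cases p'; cases z) (simp add: dilation_def algebra_simps add_divide_distrib diff_divide_distrib)
    then have "norm (dilation r p' + z - p) \<le> norm (r *\<^sub>R (p' - p)) + norm ((4 * \<delta>) *\<^sub>R (p - (1/2, 1/2))) + norm z"
      by (metis norm_triangle_le add_mono_thms_linordered_semiring(1) norm_triangle_ineq order_refl)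
    also have "\<dots> \<le> r * norm (p' - p) + 4 * \<delta> * norm (p - (1/2, 1/2)) + 2 * \<delta>"
      using norm_le_of_box[OF that(1)] r0 \<delta> by simp
    also have "r * norm (p' - p) < r * \<sigma>" using that(2) r0 by simp
    also have "r * \<sigma> = \<rho> - (4 * \<delta> * norm (p - (1/2, 1/2)) + 2 * \<delta>)" using r0 by (simp add: \<sigma>_def)
    finally show ?thesis by simp
  qed
  have "\<forall>\<^sub>F p' in nhds p. norm (p' - p) < \<sigma>"
    using \<sigma> by (auto simp: eventually_nhds_metric dist_norm)
  then show "\<forall>\<^sub>F p' in nhds p. \<bar>contracted_mollification r \<eta> w p' - contracted_mollification r \<eta> w p
      - (p' - p) \<bullet> (r *\<^sub>R G)\<bar> \<le> \<kappa> * r * norm (p' - p)"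
  proof eventually_elim
    case (elim p')
    have b: "dilation r p' + z \<in> ball p \<rho>" "dilation r p + z \<in> ball p \<rho>"
      if "z \<in> box (- \<delta>, - \<delta>) (\<delta>, \<delta>)" for z
      using dist[OF that elim] dist[OF that, of p] \<sigma> by (simp_all add: dist_norm norm_minus_commute)
    have "\<bar>contracted_mollification r \<eta> w p' - contracted_mollification r \<eta> w p - r * ((p' - p) \<bullet> G)\<bar>
        \<le> \<kappa> * r * norm (p' - p)"
      by (rule contracted_mollification_local[OF w \<eta> less_imp_le[OF r0] U b])
    then show ?case by simp
  qed
qed

text \<open>Strict differentiability with gradient \<open>G\<close>: difference quotients converge when both end points tend to
  \<open>p\<close>. Unlike ordinary differentiability it bounds the local Lipschitz constant of \<open>w\<close> minus its
  linearisation, which is the quantity that mollification preserves.\<close>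

definition strict_gradient :: "(real \<times> real \<Rightarrow> real) \<Rightarrow> real \<times> real \<Rightarrow> real \<times> real \<Rightarrow> bool" where
  "strict_gradient w p G \<longleftrightarrow> (\<forall>\<kappa>>0. \<exists>\<rho>>0. \<forall>q\<in>ball p \<rho>. \<forall>q'\<in>ball p \<rho>.
     \<bar>w q - w q' - (q - q') \<bullet> G\<bar> \<le> \<kappa> * norm (q - q'))"

text \<open>The radii \<open>\<delta> n\<close> tend to zero and are at most \<open>1/4\<close>, so that the dilation factors \<open>r n = 1 + 4 \<delta> n\<close> stay below
  \<open>2\<close>; this gives the uniform bounds.\<close>

lemma lipschitz_test_function_approximation:
  fixes w :: "real \<times> real \<Rightarrow> real"
  assumes lip: "\<And>q q'. \<bar>w q - w q'\<bar> \<le> L * norm (q - q')" and zero: "\<And>q. q \<notin> \<Omega> \<Longrightarrow> w q = 0"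
  shows "\<exists>\<phi>. (\<forall>n::nat. test_function (\<phi> n)) \<and> (\<forall>p. (\<lambda>n. \<phi> n p) \<longlonglongrightarrow> w p) \<and>
    (\<forall>n p. \<bar>\<phi> n p\<bar> \<le> 4 * L) \<and> (\<forall>n p. norm (grad (\<phi> n) p) \<le> 2 * L) \<and>
    (\<forall>p G. strict_gradient w p G \<longrightarrow> (\<lambda>n. grad (\<phi> n) p) \<longlonglongrightarrow> G)"
proof -
  have L: "0 \<le> L"
    using lip[of "(1, 0)" 0] abs_ge_zero order_trans by (fastforce simp: norm_prod_def)
  have cont: "continuous_on UNIV w"
    by (rule lipschitz_on_continuous_on[of L]) (use lip L in \<open>auto intro!: lipschitz_onI simp: dist_norm\<close>)
  define \<delta> where "\<delta> n = 1 / (4 * real (Suc n))" for n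
  define r where "r n = 1 + 4 * \<delta> n" for n
  have \<delta>: "0 < \<delta> n" "\<delta> n \<le> 1 / 4" for n by (auto simp: \<delta>_def field_simps)
  have r: "0 < r n" "r n \<le> 2" for n using \<delta>[of n] by (auto simp: r_def)
  obtain \<eta> where \<eta>: "\<forall>n. mollifier (\<delta> n) (\<eta> n)"
    using mollifier_exists[OF \<delta>(1)] by metis
  note \<eta> = \<eta>[rule_format]
  have \<delta>0: "\<delta> \<longlonglongrightarrow> 0" unfolding \<delta>_def by real_asymp
  define \<phi> where "\<phi> n = contracted_mollification (r n) (\<eta> n) w" for n
  have test: "test_function (\<phi> n)" for n
    unfolding \<phi>_def by (rule test_function_contracted_mollification[OF \<delta>(1) r_def cont zero \<eta>])
  have dist: "\<bar>\<phi> n p - w p\<bar> \<le> L * (\<delta> n * (4 * norm (p - (1/2, 1/2)) + 2))" for n p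
  proof -
    have 0: "\<And>z. z \<notin> box (- \<delta> n, - \<delta> n) (\<delta> n, \<delta> n) \<Longrightarrow> \<eta> n z = 0" "(LINT z|lborel. \<eta> n z) = 1"
      using \<eta>[of n] unfolding mollifier_def by blast+
    have c: "continuous_on UNIV (\<lambda>z. w (a + z))" for a
      by (rule continuous_on_comp_UNIV[OF cont]) (intro continuous_intros)
    have i: "integrable lborel (\<lambda>z. w (a + z) * \<eta> n z)" for a
      by (rule integrable_mult_compact_support[OF c mollifier_continuous[OF \<eta>] 0(1)])
    have i1: "integrable lborel (\<lambda>z. K * \<eta> n z)" for K
      by (rule integrable_mult_compact_support[OF continuous_on_const mollifier_continuous[OF \<eta>] 0(1)])
    have "\<phi> n p - w p = (LINT z|lborel. w (dilation (r n) p + z) * \<eta> n z) - (LINT z|lborel. w p * \<eta> n z)"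
      using 0(2) contracted_mollification_eq[OF cont zero \<eta>[of n]] by (simp add: \<phi>_def)
    also have "\<dots> = (LINT z|lborel. (w (dilation (r n) p + z) - w p) * \<eta> n z)"
      unfolding left_diff_distrib by (rule Bochner_Integration.integral_diff[OF i i1, symmetric])
    also have "\<bar>\<dots>\<bar> \<le> L * (\<delta> n * (4 * norm (p - (1/2, 1/2)) + 2))"
    proof (rule mollifier_average_bound[OF \<eta>])
      show "continuous_on UNIV (\<lambda>z. w (dilation (r n) p + z) - w p)" by (intro continuous_intros c)
      show "\<bar>w (dilation (r n) p + z) - w p\<bar> \<le> L * (\<delta> n * (4 * norm (p - (1/2, 1/2)) + 2))"
        if z: "z \<in> box (- \<delta> n, - \<delta> n) (\<delta> n, \<delta> n)" for z
      proof -
        have "dilation (r n) p + z - p = (4 * \<delta> n) *\<^sub>R (p - (1/2, 1/2)) + z"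
          by (cases p; cases z) (simp add: r_def dilation_def algebra_simps add_divide_distrib diff_divide_distrib)
        then have "norm (dilation (r n) p + z - p) \<le> norm ((4 * \<delta> n) *\<^sub>R (p - (1/2, 1/2))) + norm z"
          by (metis norm_triangle_ineq)
        also have "\<dots> \<le> 4 * \<delta> n * norm (p - (1/2, 1/2)) + 2 * \<delta> n"
          using norm_le_of_box[OF z] \<delta>[of n] by simp
        also have "\<dots> = \<delta> n * (4 * norm (p - (1/2, 1/2)) + 2)" by (simp add: distrib_left)
        finally show ?thesis using lip[of "dilation (r n) p + z" p] L by (meson mult_left_mono order_trans)
      qed
    qed
    finally show ?thesis .
  qed
  have conv: "(\<lambda>n. \<phi> n p) \<longlonglongrightarrow> w p" for p
  proof -
    have "(\<lambda>n. L * (\<delta> n * (4 * norm (p - (1/2, 1/2)) + 2))) \<longlonglongrightarrow> L * (0 * (4 * norm (p - (1/2, 1/2)) + 2))"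
      by (intro tendsto_intros \<delta>0)
    then have "(\<lambda>n. \<phi> n p - w p) \<longlonglongrightarrow> 0"
      by (intro Lim_null_comparison[of "\<lambda>n. \<phi> n p - w p"]) (use dist in auto)
    then show ?thesis by (simp add: LIM_zero_iff)
  qed
  have bd: "\<bar>\<phi> n p\<bar> \<le> 4 * L" for n p
  proof (cases "p \<in> \<Omega>")
    case True
    obtain x y where xy: "p = (x, y)" by (cases p)
    have 1: "norm p \<le> 2"
      using norm_Pair_le[of x y] True by (simp add: xy \<Omega>_def)
    have "\<bar>x - 1/2\<bar> \<le> 1/2" "\<bar>y - 1/2\<bar> \<le> 1/2"
      using True unfolding xy \<Omega>_def abs_le_iff by auto
    then have n2: "norm (p - (1/2, 1/2)) \<le> 1"
      using norm_Pair_le[of "x - 1/2" "y - 1/2"] by (simp add: xy)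
    have "\<delta> n * (4 * norm (p - (1/2, 1/2)) + 2) \<le> (1 / 4) * 6"
      by (rule mult_mono) (use \<delta>[of n] n2 in auto)
    then have "\<bar>\<phi> n p - w p\<bar> \<le> L * 2" using order_trans[OF dist mult_left_mono[OF _ L]] by simp
    moreover have "\<bar>w p\<bar> \<le> L * 2"
    proof -
      have "w 0 = 0" by (rule zero) (simp add: \<Omega>_def zero_prod_def)
      then show ?thesis using lip[of p 0] mult_left_mono[OF 1 L] by simp
    qed
    ultimately show ?thesis by linarith
  qed (use test_function_outside[OF test] L in auto)
  have gb: "norm (grad (\<phi> n) p) \<le> 2 * L" for n p
  proof -
    have "norm (grad (\<phi> n) p - r n *\<^sub>R 0) \<le> L * r n"
      unfolding \<phi>_def
      by (rule strict_lipschitz_mollification_grad[OF cont zero \<eta> \<delta>(1) r_def L,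
            where p = p and \<rho> = "4 * \<delta> n * norm (p - (1/2, 1/2)) + 2 * \<delta> n + 1"])
        (use lip in auto)
    also have "\<dots> \<le> 2 * L" using mult_left_mono[OF r(2) L] by (simp add: mult.commute)
    finally show ?thesis by simp
  qed
  have gc: "(\<lambda>n. grad (\<phi> n) p) \<longlonglongrightarrow> G" if G: "strict_gradient w p G" for p G
  proof -
    have rG: "(\<lambda>n. r n *\<^sub>R G) \<longlonglongrightarrow> G"
      using tendsto_scaleR[OF tendsto_add[OF tendsto_const[of 1] tendsto_mult[OF tendsto_const[of 4] \<delta>0]] tendsto_const[of G]]
      by (simp add: r_def)
    have "(\<lambda>n. grad (\<phi> n) p - r n *\<^sub>R G) \<longlonglongrightarrow> 0"
    proof (rule LIMSEQ_I)
      fix e :: real assume e: "0 < e"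
      obtain \<rho> where \<rho>: "\<rho> > 0" "\<forall>q\<in>ball p \<rho>. \<forall>q'\<in>ball p \<rho>. \<bar>w q - w q' - (q - q') \<bullet> G\<bar> \<le> e / 4 * norm (q - q')"
        using G e unfolding strict_gradient_def by (metis zero_less_divide_iff zero_less_numeral)
      have "(\<lambda>n. 4 * \<delta> n * norm (p - (1/2, 1/2)) + 2 * \<delta> n) \<longlonglongrightarrow> 4 * 0 * norm (p - (1/2, 1/2)) + 2 * 0"
        by (intro tendsto_intros \<delta>0)
      then have "\<forall>\<^sub>F n in sequentially. 4 * \<delta> n * norm (p - (1/2, 1/2)) + 2 * \<delta> n < \<rho>"
        using \<rho>(1) by (simp add: order_tendsto_iff)
      then have "\<forall>\<^sub>F n in sequentially. norm (grad (\<phi> n) p - r n *\<^sub>R G - 0) < e"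
      proof eventually_elim
        case (elim n)
        have "norm (grad (\<phi> n) p - r n *\<^sub>R G) \<le> e / 4 * r n"
          unfolding \<phi>_def
          by (rule strict_lipschitz_mollification_grad[OF cont zero \<eta> \<delta>(1) r_def _ elim]) (use e \<rho>(2) in auto)
        also have "\<dots> \<le> e / 4 * 2" by (rule mult_left_mono) (use r[of n] e in auto)
        also have "\<dots> < e" using e by simp
        finally show ?case by simp
      qed
      then show "\<exists>no. \<forall>n\<ge>no. norm (grad (\<phi> n) p - r n *\<^sub>R G - 0) < e"
        by (simp add: eventually_sequentially)
    qed
    from tendsto_add[OF this rG] show ?thesis by simp
  qed
  show ?thesis
    using test conv bd gb gc by blast
qed

section \<open>Lipschitz functions belong to \<open>H\<^sup>1\<^sub>0\<close>\<close>

lemma L2_inner_dominated_convergence: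
  assumes u: "\<And>n. u n \<in> borel_measurable (lebesgue_on \<Omega>)" "u' \<in> borel_measurable (lebesgue_on \<Omega>)"
    and v: "v \<in> L2" and bd: "\<And>n p. p \<in> \<Omega> \<Longrightarrow> \<bar>u n p\<bar> \<le> B"
    and lim: "AE p in lebesgue_on \<Omega>. (\<lambda>n. u n p) \<longlonglongrightarrow> u' p"
  shows "(\<lambda>n. L2_inner (u n) v) \<longlonglongrightarrow> L2_inner u' v"
  unfolding L2_inner_def
proof (rule integral_dominated_convergence[where w = "\<lambda>p. B * \<bar>v p\<bar>"])
  show "integrable (lebesgue_on \<Omega>) (\<lambda>p. B * \<bar>v p\<bar>)" using integrable_L2[OF v] by simp
  show "AE p in lebesgue_on \<Omega>. (\<lambda>n. u n p * v p) \<longlonglongrightarrow> u' p * v p"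
    using lim by eventually_elim (intro tendsto_intros)
  show "AE p in lebesgue_on \<Omega>. norm (u n p * v p) \<le> B * \<bar>v p\<bar>" for n
    using bd by (intro AE_I2) (simp add: abs_mult mult_right_mono)
qed (use u L2D(1)[OF v] in auto)

lemma L2_inner_self_tendsto_0:
  assumes u: "\<And>n. u n \<in> borel_measurable (lebesgue_on \<Omega>)"
    and bd: "\<And>n p. p \<in> \<Omega> \<Longrightarrow> \<bar>u n p\<bar> \<le> B"
    and lim: "AE p in lebesgue_on \<Omega>. (\<lambda>n. u n p) \<longlonglongrightarrow> 0"
  shows "(\<lambda>n. L2_inner (u n) (u n)) \<longlonglongrightarrow> 0"
proof -
  have "(\<lambda>n. L2_inner (\<lambda>p. (u n p)\<^sup>2) (\<lambda>p. 1)) \<longlonglongrightarrow> L2_inner (\<lambda>p. 0) (\<lambda>p. 1)"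
  proof (rule L2_inner_dominated_convergence[where B = "B\<^sup>2"])
    show "(\<lambda>p. 1) \<in> L2" by (rule L2_of_bounded[of _ 1]) auto
    show "\<bar>(u n p)\<^sup>2\<bar> \<le> B\<^sup>2" if "p \<in> \<Omega>" for n p
      using power_mono[OF bd[OF that] abs_ge_zero, of n 2] by simp
    show "AE p in lebesgue_on \<Omega>. (\<lambda>n. (u n p)\<^sup>2) \<longlonglongrightarrow> 0"
      using lim
    proof eventually_elim
      case (elim p)
      from tendsto_power[OF this, of 2] show ?case by simp
    qed
  qed (use u in auto)
  then show ?thesis by (simp add: L2_inner_def power2_eq_square)
qed

text \<open>The approximating test functions and their gradients are uniformly bounded and converge almost
  everywhere, so dominated convergence gives both the weak gradient and the approximation in the norm
  of \<open>H\<^sup>1\<close>.\<close>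

lemma lipschitz_in_H01:
  fixes w :: "real \<times> real \<Rightarrow> real"
  assumes lip: "\<And>q q'. \<bar>w q - w q'\<bar> \<le> L * norm (q - q')" and zero: "\<And>q. q \<notin> \<Omega> \<Longrightarrow> w q = 0"
    and N: "N \<in> null_sets lebesgue" and G: "\<And>p. p \<in> \<Omega> \<Longrightarrow> p \<notin> N \<Longrightarrow> strict_gradient w p (G p)"
  shows "w \<in> H01" "AE p in lebesgue_on \<Omega>. wgrad w p = G p"
proof -
  let ?M = "lebesgue_on \<Omega>"
  obtain \<phi> :: "nat \<Rightarrow> _" where \<phi>: "(\<forall>n. test_function (\<phi> n)) \<and> (\<forall>p. (\<lambda>n. \<phi> n p) \<longlonglongrightarrow> w p) \<and>
    (\<forall>n p. \<bar>\<phi> n p\<bar> \<le> 4 * L) \<and> (\<forall>n p. norm (grad (\<phi> n) p) \<le> 2 * L) \<and>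
    (\<forall>p G. strict_gradient w p G \<longrightarrow> (\<lambda>n. grad (\<phi> n) p) \<longlonglongrightarrow> G)"
    using lipschitz_test_function_approximation[OF lip zero] ..
  have test: "test_function (\<phi> n)" and conv: "(\<lambda>n. \<phi> n p) \<longlonglongrightarrow> w p" and bd: "\<bar>\<phi> n p\<bar> \<le> 4 * L"
    and gbd: "norm (grad (\<phi> n) p) \<le> 2 * L"
    and gconv: "strict_gradient w p g \<Longrightarrow> (\<lambda>n. grad (\<phi> n) p) \<longlonglongrightarrow> g" for n p g
    using \<phi> by blast+
  \<comment> \<open>The values of \<open>G\<close> on \<open>N\<close> are arbitrary. Set to zero there, \<open>H\<close> is an everywhere limit of measurable functions.\<close>
  define H where "H p = (if p \<in> \<Omega> \<and> p \<notin> N then G p else 0)" for p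
  have NO: "AE p in ?M. p \<in> \<Omega> \<and> p \<notin> N"
  proof -
    have "AE p in lebesgue. p \<notin> N" using N AE_not_in by blast
    then show ?thesis by (auto simp: AE_restrict_space_iff elim: eventually_mono)
  qed
  have gH: "AE p in ?M. (\<lambda>n. grad (\<phi> n) p) \<longlonglongrightarrow> H p"
    using NO by eventually_elim (simp add: H_def gconv G)
  have meas\<phi>: "\<phi> n \<in> borel_measurable ?M" "(\<lambda>p. fst (grad (\<phi> n) p)) \<in> borel_measurable ?M"
    "(\<lambda>p. snd (grad (\<phi> n) p)) \<in> borel_measurable ?M" for n
    using test_function_L2[OF test] L2D(1) by blast+
  have measw: "w \<in> borel_measurable ?M"
    by (rule borel_measurable_LIMSEQ_real[OF conv meas\<phi>(1)])
  have NM: "{p \<in> space ?M. p \<in> \<Omega> \<and> p \<notin> N} \<in> sets ?M"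
  proof -
    have "{p \<in> space ?M. p \<in> \<Omega> \<and> p \<notin> N} = \<Omega> \<inter> (- N)" by auto
    moreover have "- N \<in> sets lebesgue" using sets.compl_sets[OF null_setsD2[OF N]] by (simp add: Compl_eq_Diff_UNIV)
    ultimately show ?thesis by (simp add: sets_restrict_space)
  qed
  have HM: "(\<lambda>p. T (H p)) \<in> borel_measurable ?M"
    if T: "bounded_linear T" "\<And>n. (\<lambda>p. T (grad (\<phi> n) p)) \<in> borel_measurable ?M" for T :: "real \<times> real \<Rightarrow> real"
  proof (rule borel_measurable_LIMSEQ_real)
    show "(\<lambda>p. if p \<in> \<Omega> \<and> p \<notin> N then T (grad (\<phi> n) p) else 0) \<in> borel_measurable ?M" for n
      by (rule measurable_If[OF T(2) _ NM]) simp
    show "(\<lambda>n. if p \<in> \<Omega> \<and> p \<notin> N then T (grad (\<phi> n) p) else 0) \<longlonglongrightarrow> T (H p)" for p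
      using bounded_linear.tendsto[OF T(1) gconv[OF G]] linear_0[OF bounded_linear.linear[OF T(1)]]
      by (auto simp: H_def)
  qed
  have measH: "(\<lambda>p. fst (H p)) \<in> borel_measurable ?M" "(\<lambda>p. snd (H p)) \<in> borel_measurable ?M"
    by (rule HM[OF bounded_linear_fst meas\<phi>(2)], rule HM[OF bounded_linear_snd meas\<phi>(3)])
  have bdH: "norm (H p) \<le> 2 * L" for p
  proof (cases "p \<in> \<Omega> \<and> p \<notin> N")
    case True
    then have "(\<lambda>n. grad (\<phi> n) p) \<longlonglongrightarrow> H p" using gconv G by (simp add: H_def)
    then show ?thesis by (rule Lim_bounded[OF tendsto_norm, where M = 0]) (use gbd in auto)
  next
    case False
    then show ?thesis using order_trans[OF norm_ge_zero gbd] by (auto simp: H_def)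
  qed
  have fs: "\<bar>fst (H p)\<bar> \<le> 2 * L" "\<bar>snd (H p)\<bar> \<le> 2 * L" for p
    using bdH[of p] norm_fst_le[of "fst (H p)" "snd (H p)"] norm_snd_le[of "snd (H p)" "fst (H p)"] by simp_all
  have fsg: "\<bar>fst (grad (\<phi> n) p)\<bar> \<le> 2 * L" "\<bar>snd (grad (\<phi> n) p)\<bar> \<le> 2 * L" for n p
    using gbd[of n p] norm_fst_le[of "fst (grad (\<phi> n) p)" "snd (grad (\<phi> n) p)"]
      norm_snd_le[of "snd (grad (\<phi> n) p)" "fst (grad (\<phi> n) p)"] by simp_all
  have bdw: "\<bar>w p\<bar> \<le> 4 * L" for p
    by (rule Lim_bounded[OF tendsto_rabs[OF conv], where M = 0]) (use bd in auto)
  have wL2: "w \<in> L2" by (rule L2_of_bounded[OF measw bdw])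
  have HL2: "(\<lambda>p. fst (H p)) \<in> L2" "(\<lambda>p. snd (H p)) \<in> L2"
    by (rule L2_of_bounded[OF measH(1) fs(1)], rule L2_of_bounded[OF measH(2) fs(2)])
  have gH': "AE p in ?M. (\<lambda>n. fst (grad (\<phi> n) p)) \<longlonglongrightarrow> fst (H p)" "AE p in ?M. (\<lambda>n. snd (grad (\<phi> n) p)) \<longlonglongrightarrow> snd (H p)"
    by (rule AE_mp[OF gH], rule AE_I2, rule impI, erule tendsto_fst,
        rule AE_mp[OF gH], rule AE_I2, rule impI, erule tendsto_snd)
  have wg: "weak_gradient w H"
    unfolding weak_gradient_iff[OF wL2]
  proof (intro conjI allI impI HL2)
    fix \<psi> assume \<psi>: "test_function \<psi>"
    note W = weak_gradient_test_function[OF test, unfolded weak_gradient_iff[OF test_function_L2(1)[OF test]]]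
    have l: "(\<lambda>n. L2_inner (\<phi> n) v) \<longlonglongrightarrow> L2_inner w v" if "v \<in> L2" for v
      by (rule L2_inner_dominated_convergence[OF meas\<phi>(1) measw that bd]) (use conv in simp)
    have r: "(\<lambda>n. - L2_inner \<psi> (\<lambda>p. fst (grad (\<phi> n) p))) \<longlonglongrightarrow> - L2_inner \<psi> (\<lambda>p. fst (H p))"
      "(\<lambda>n. - L2_inner \<psi> (\<lambda>p. snd (grad (\<phi> n) p))) \<longlonglongrightarrow> - L2_inner \<psi> (\<lambda>p. snd (H p))"
      unfolding L2_inner_commute[of \<psi>]
      by (intro tendsto_minus L2_inner_dominated_convergence[OF meas\<phi>(2) measH(1) test_function_L2(1)[OF \<psi>] fsg(1) gH'(1)],
          intro tendsto_minus L2_inner_dominated_convergence[OF meas\<phi>(3) measH(2) test_function_L2(1)[OF \<psi>] fsg(2) gH'(2)])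
    have e: "L2_inner (\<phi> n) (\<lambda>p. fst (grad \<psi> p)) = - L2_inner \<psi> (\<lambda>p. fst (grad (\<phi> n) p))"
      "L2_inner (\<phi> n) (\<lambda>p. snd (grad \<psi> p)) = - L2_inner \<psi> (\<lambda>p. snd (grad (\<phi> n) p))" for n
      using W[of n] \<psi> by blast+
    show "L2_inner w (\<lambda>p. fst (grad \<psi> p)) = - L2_inner \<psi> (\<lambda>p. fst (H p))"
      by (rule LIMSEQ_unique[OF l[OF test_function_L2(2)[OF \<psi>]] r(1)[folded e]])
    show "L2_inner w (\<lambda>p. snd (grad \<psi> p)) = - L2_inner \<psi> (\<lambda>p. snd (H p))"
      by (rule LIMSEQ_unique[OF l[OF test_function_L2(3)[OF \<psi>]] r(2)[folded e]])
  qed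
  show "AE p in ?M. wgrad w p = G p"
    using wgrad_AE_eq[OF wL2 wg] NO by eventually_elim (simp add: H_def)
  have A: "(\<lambda>n. L2_norm (\<lambda>p. w p - \<phi> n p)) \<longlonglongrightarrow> 0"
  proof -
    have "(\<lambda>n. L2_inner (\<lambda>p. w p - \<phi> n p) (\<lambda>p. w p - \<phi> n p)) \<longlonglongrightarrow> 0"
    proof (rule L2_inner_self_tendsto_0[where B = "8 * L"])
      show "\<bar>w p - \<phi> n p\<bar> \<le> 8 * L" for n p using bdw[of p] bd[of n p] by linarith
      show "AE p in ?M. (\<lambda>n. w p - \<phi> n p) \<longlonglongrightarrow> 0"
      proof (rule AE_I2)
        fix p
        from tendsto_diff[OF tendsto_const conv, of "w p" p] show "(\<lambda>n. w p - \<phi> n p) \<longlonglongrightarrow> 0" by simp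
      qed
    qed (use measw meas\<phi> in auto)
    from tendsto_real_sqrt[OF this] show ?thesis by (simp add: L2_norm_def)
  qed
  have B: "(\<lambda>n. H1_seminorm (\<lambda>p. w p - \<phi> n p)) \<longlonglongrightarrow> 0"
  proof -
    let ?D = "\<lambda>n p. H p - grad (\<phi> n) p"
    have wgd: "weak_gradient (\<lambda>p. w p - \<phi> n p) (?D n)" "(\<lambda>p. w p - \<phi> n p) \<in> L2" for n
      using weak_gradient_diff[OF wL2 test_function_L2(1)[OF test] wg weak_gradient_test_function[OF test]]
        L2_diff[OF wL2 test_function_L2(1)[OF test]] by auto
    have "(\<lambda>n. L2_inner (\<lambda>p. fst (?D n p)) (\<lambda>p. fst (?D n p))) \<longlonglongrightarrow> 0"
    proof (rule L2_inner_self_tendsto_0[where B = "4 * L"])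
      show "\<bar>fst (?D n p)\<bar> \<le> 4 * L" for n p using fs(1)[of p] fsg(1)[of n p] by (simp; linarith)
      show "AE p in ?M. (\<lambda>n. fst (?D n p)) \<longlonglongrightarrow> 0"
        using gH'(1)
      proof eventually_elim
        case (elim p)
        from tendsto_diff[OF tendsto_const this, of "fst (H p)"] show ?case by simp
      qed
    qed (use measH meas\<phi> in auto)
    moreover have "(\<lambda>n. L2_inner (\<lambda>p. snd (?D n p)) (\<lambda>p. snd (?D n p))) \<longlonglongrightarrow> 0"
    proof (rule L2_inner_self_tendsto_0[where B = "4 * L"])
      show "\<bar>snd (?D n p)\<bar> \<le> 4 * L" for n p using fs(2)[of p] fsg(2)[of n p] by (simp; linarith)
      show "AE p in ?M. (\<lambda>n. snd (?D n p)) \<longlonglongrightarrow> 0"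
        using gH'(2)
      proof eventually_elim
        case (elim p)
        from tendsto_diff[OF tendsto_const this, of "snd (H p)"] show ?case by simp
      qed
    qed (use measH meas\<phi> in auto)
    ultimately have "(\<lambda>n. grad_inner (\<lambda>p. w p - \<phi> n p) (\<lambda>p. w p - \<phi> n p)) \<longlonglongrightarrow> 0"
      unfolding grad_inner_eq[OF wgd(2,1) wgd(2,1)] using tendsto_add[of _ 0 _ _ 0] by fastforce
    from tendsto_real_sqrt[OF this] show ?thesis by (simp add: H1_seminorm_def)
  qed
  have "w \<in> H1" using wL2 wg by (auto simp: H1_def)
  then show "w \<in> H01" unfolding H01_def using test A B by blast
qed

section \<open>Shape functions on one mesh cell\<close>

text \<open>The shape \<open>s t\<close> belongs to bilinear elements. The other two belong to linear elements: \<open>min\<close> to a cell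
  cut along the diagonal through its lower left corner, \<open>max 0 (s + t - 1)\<close> to the other diagonal. (In
  probability theory these are the independence copula and the two extremal copulas.)\<close>

definition element_shapes :: "(real \<Rightarrow> real \<Rightarrow> real) set" where
  "element_shapes = {\<lambda>s t. s * t, min, \<lambda>s t. max 0 (s + t - 1)}"

lemma element_shapes_cases:
  assumes "m \<in> element_shapes"
  obtains "m = (\<lambda>s t. s * t)" | "m = min" | "m = (\<lambda>s t. max 0 (s + t - 1))"
  using assms by (auto simp: element_shapes_def)

lemma shape_commute: "m \<in> element_shapes \<Longrightarrow> m s t = m t s"
  by (erule element_shapes_cases) (auto simp: mult.commute min.commute add.commute)

lemma shape_boundary:
  assumes "m \<in> element_shapes" "0 \<le> s" "s \<le> 1"
  shows "m s 0 = 0" "m s 1 = s" "m 0 s = 0" "m 1 s = s"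
  using assms by (auto elim!: element_shapes_cases simp: min_def max_def)

lemma shape_increment:
  assumes "m \<in> element_shapes" "0 \<le> s" "s \<le> s'" "s' \<le> 1" "0 \<le> t" "t \<le> 1"
  shows "0 \<le> m s' t - m s t" "m s' t - m s t \<le> s' - s"
proof -
  have "0 \<le> (s' - s) * t" "0 \<le> (s' - s) * (1 - t)" using assms by auto
  then show "0 \<le> m s' t - m s t" "m s' t - m s t \<le> s' - s"
    using assms(1,3-6) by (auto elim!: element_shapes_cases simp: min_def max_def algebra_simps)
qed

lemma shape_lipschitz:
  assumes m: "m \<in> element_shapes" and "0 \<le> s" "s \<le> 1" "0 \<le> s'" "s' \<le> 1" "0 \<le> t" "t \<le> 1" "0 \<le> t'" "t' \<le> 1"
  shows "\<bar>m s t - m s' t'\<bar> \<le> \<bar>s - s'\<bar> + \<bar>t - t'\<bar>"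
proof -
  have *: "\<bar>m s t - m s' t\<bar> \<le> \<bar>s - s'\<bar>" if "0 \<le> s" "s \<le> 1" "0 \<le> s'" "s' \<le> 1" "0 \<le> t" "t \<le> 1" for s s' t
    using shape_increment[OF m, of s s' t] shape_increment[OF m, of s' s t] that by (cases "s \<le> s'") auto
  have "\<bar>m s t - m s' t\<bar> \<le> \<bar>s - s'\<bar>" "\<bar>m t s' - m t' s'\<bar> \<le> \<bar>t - t'\<bar>"
    using *[of s s' t] *[of t t' s'] assms by auto
  then show ?thesis using shape_commute[OF m, of t s'] shape_commute[OF m, of t' s'] by linarith
qed

text \<open>The finite element function on a cell in local coordinates, with values \<open>a\<close>, \<open>b\<close>, \<open>c\<close>, \<open>d\<close> at the lower
  left, lower right, upper left and upper right corner.\<close>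

definition cell_form :: "(real \<Rightarrow> real \<Rightarrow> real) \<Rightarrow> real \<Rightarrow> real \<Rightarrow> real \<Rightarrow> real \<Rightarrow> real \<Rightarrow> real \<Rightarrow> real" where
  "cell_form m a b c d s t = a + (b - a) * s + (c - a) * t + (a + d - b - c) * m s t"

lemma cell_form_transpose:
  "m \<in> element_shapes \<Longrightarrow> cell_form m a b c d s t = cell_form m a c b d t s"
  by (simp add: cell_form_def shape_commute[of m s t])

text \<open>The increment in \<open>s\<close> is a combination of \<open>d - c\<close> and \<open>b - a\<close> whose weights are nonnegative and add up to
  \<open>s' - s\<close>.\<close>

lemma cell_form_lipschitz1:
  assumes m: "m \<in> element_shapes" and M: "\<bar>a\<bar> \<le> M" "\<bar>b\<bar> \<le> M" "\<bar>c\<bar> \<le> M" "\<bar>d\<bar> \<le> M"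
    and st: "0 \<le> s" "s \<le> 1" "0 \<le> s'" "s' \<le> 1" "0 \<le> t" "t \<le> 1"
  shows "\<bar>cell_form m a b c d s' t - cell_form m a b c d s t\<bar> \<le> 2 * M * \<bar>s' - s\<bar>"
proof -
  have *: "\<bar>cell_form m a b c d s' t - cell_form m a b c d s t\<bar> \<le> 2 * M * (s' - s)"
    if "s \<le> s'" "0 \<le> s" "s' \<le> 1" for s s'
  proof -
    define x y where "x = m s' t - m s t" and "y = s' - s - x"
    have xy: "0 \<le> x" "0 \<le> y" using shape_increment[OF m that(2,1,3) st(5,6)] by (auto simp: x_def y_def)
    have e: "cell_form m a b c d s' t - cell_form m a b c d s t = (d - c) * x + (b - a) * y"
      by (simp add: cell_form_def x_def y_def algebra_simps)
    have "\<bar>(d - c) * x\<bar> \<le> 2 * M * x" "\<bar>(b - a) * y\<bar> \<le> 2 * M * y"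
      unfolding abs_mult abs_of_nonneg[OF xy(1)] abs_of_nonneg[OF xy(2)]
      by (rule mult_right_mono; use M xy in linarith)+
    moreover have "2 * M * (s' - s) = 2 * M * x + 2 * M * y" by (simp add: y_def algebra_simps)
    ultimately show ?thesis unfolding e by linarith
  qed
  show ?thesis
    using *[of s s'] *[of s' s] st by (cases "s \<le> s'") (auto simp: abs_minus_commute)
qed

lemma cell_form_lipschitz2:
  assumes m: "m \<in> element_shapes" and M: "\<bar>a\<bar> \<le> M" "\<bar>b\<bar> \<le> M" "\<bar>c\<bar> \<le> M" "\<bar>d\<bar> \<le> M"
    and st: "0 \<le> s" "s \<le> 1" "0 \<le> t" "t \<le> 1" "0 \<le> t'" "t' \<le> 1"
  shows "\<bar>cell_form m a b c d s t' - cell_form m a b c d s t\<bar> \<le> 2 * M * \<bar>t' - t\<bar>"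
  using cell_form_lipschitz1[OF m M(1,3,2,4) st(3-6,1,2)] cell_form_transpose[OF m] by simp

lemma cell_form_diff:
  assumes m: "m \<in> element_shapes" and M: "\<bar>a\<bar> \<le> M" "\<bar>b\<bar> \<le> M" "\<bar>c\<bar> \<le> M" "\<bar>d\<bar> \<le> M"
    and st: "0 \<le> s" "s \<le> 1" "0 \<le> s'" "s' \<le> 1" "0 \<le> t" "t \<le> 1" "0 \<le> t'" "t' \<le> 1"
  shows "\<bar>cell_form m a b c d s' t' - cell_form m a b c d s t\<bar> \<le> 2 * M * \<bar>s' - s\<bar> + 2 * M * \<bar>t' - t\<bar>"
  using cell_form_lipschitz1[OF m M st(1-6)] cell_form_lipschitz2[OF m M st(3,4,5-8)] by linarith

lemma cell_form_corners:
  assumes "m \<in> element_shapes"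
  shows "cell_form m a b c d 0 0 = a" "cell_form m a b c d 1 0 = b"
    "cell_form m a b c d 0 1 = c" "cell_form m a b c d 1 1 = d"
  using shape_boundary[OF assms] by (auto simp: cell_form_def)

lemma cell_form_bound:
  assumes m: "m \<in> element_shapes" and M: "\<bar>a\<bar> \<le> M" "\<bar>b\<bar> \<le> M" "\<bar>c\<bar> \<le> M" "\<bar>d\<bar> \<le> M"
    and st: "0 \<le> s" "s \<le> 1" "0 \<le> t" "t \<le> 1"
  shows "\<bar>cell_form m a b c d s t\<bar> \<le> 5 * M"
proof -
  have "2 * M * \<bar>s - 0\<bar> \<le> 2 * M * 1" "2 * M * \<bar>t - 0\<bar> \<le> 2 * M * 1"
    by (rule mult_left_mono; use M(1) st in simp)+
  then show ?thesis
    using cell_form_diff[OF m M, of 0 s 0 t] st M(1) cell_form_corners(1)[OF m, of a b c d] by simp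
qed

text \<open>Off the two diagonals of the unit square each shape is given by a single polynomial, determined by the
  side of either diagonal on which the point lies.\<close>

lemma shape_locally_bilinear:
  assumes "m \<in> element_shapes" "s \<noteq> t" "s + t \<noteq> 1"
  shows "\<exists>b0 b1 b2 b3. \<forall>s' t'. (s' < t' \<longleftrightarrow> s < t) \<and> (s' + t' < 1 \<longleftrightarrow> s + t < 1) \<longrightarrow>
    m s' t' = b0 + b1 * s' + b2 * t' + b3 * s' * t'"
  using assms(1)
proof (cases rule: element_shapes_cases)
  case 1
  show ?thesis by (rule exI[of _ 0], rule exI[of _ 0], rule exI[of _ 0], rule exI[of _ 1]) (simp add: 1)
next
  case 2
  show ?thesis
    by (rule exI[of _ 0], rule exI[of _ "if s < t then 1 else 0"], rule exI[of _ "if s < t then 0 else 1"],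
        rule exI[of _ 0]) (simp add: 2 min_def)
next
  case 3
  show ?thesis
    by (rule exI[of _ "if s + t < 1 then 0 else -1"], rule exI[of _ "if s + t < 1 then 0 else 1"],
        rule exI[of _ "if s + t < 1 then 0 else 1"], rule exI[of _ 0]) (simp add: 3 max_def)
qed

lemma abs_coords_le_norm: "\<bar>fst z\<bar> \<le> norm z" "\<bar>snd z\<bar> \<le> norm z" for z :: "real \<times> real"
  using norm_fst_le[of "fst z" "snd z"] norm_snd_le[of "snd z" "fst z"] by simp_all

lemma strict_gradient_bilinear:
  assumes U: "open U" "p \<in> U" and f: "\<And>q. q \<in> U \<Longrightarrow> f q = a0 + a1 * fst q + a2 * snd q + a3 * fst q * snd q"
  shows "\<exists>G. strict_gradient f p G"
proof -
  obtain r where r: "r > 0" "ball p r \<subseteq> U" using U openE by blast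
  let ?G = "(a1 + a3 * snd p, a2 + a3 * fst p)"
  have "strict_gradient f p ?G"
    unfolding strict_gradient_def
  proof (intro allI impI)
    fix \<kappa> :: real assume \<kappa>: "\<kappa> > 0"
    \<comment> \<open>The gradient of the polynomial varies over the ball by at most \<open>2 \<bar>a3\<bar> \<rho>\<close>; the \<open>1\<close> avoids division by zero.\<close>
    define \<rho> where "\<rho> = min r (\<kappa> / (2 * \<bar>a3\<bar> + 1))"
    have \<rho>: "\<rho> > 0" "\<rho> \<le> r" using r \<kappa> by (auto simp: \<rho>_def)
    have "\<rho> \<le> \<kappa> / (2 * \<bar>a3\<bar> + 1)" by (simp add: \<rho>_def)
    then have "\<rho> * (2 * \<bar>a3\<bar> + 1) \<le> \<kappa>" by (simp add: pos_le_divide_eq)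
    then have ak: "\<bar>a3\<bar> * (\<rho> + \<rho>) \<le> \<kappa>" using \<rho> by (simp add: algebra_simps)
    have "\<bar>f q - f q' - (q - q') \<bullet> ?G\<bar> \<le> \<kappa> * norm (q - q')"
      if q: "q \<in> ball p \<rho>" "q' \<in> ball p \<rho>" for q q'
    proof -
      have n: "norm (q - p) < \<rho>" "norm (q' - p) < \<rho>"
        using q by (auto simp: dist_norm norm_minus_commute)
      have c: "\<bar>snd q - snd p\<bar> \<le> \<rho>" "\<bar>fst q' - fst p\<bar> \<le> \<rho>"
        using n abs_coords_le_norm(2)[of "q - p"] abs_coords_le_norm(1)[of "q' - p"] by auto
      have d: "\<bar>fst q - fst q'\<bar> \<le> norm (q - q')" "\<bar>snd q - snd q'\<bar> \<le> norm (q - q')"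
        using abs_coords_le_norm[of "q - q'"] by auto
      have "q \<in> U" "q' \<in> U" using n r \<rho>(2) by (auto simp: dist_norm norm_minus_commute)
      then have "f q - f q' - (q - q') \<bullet> ?G =
          a3 * ((fst q - fst q') * (snd q - snd p) + (snd q - snd q') * (fst q' - fst p))"
        by (simp add: f inner_prod_def algebra_simps)
      also have "\<bar>\<dots>\<bar> \<le> \<bar>a3\<bar> * (norm (q - q') * \<rho> + norm (q - q') * \<rho>)"
      proof -
        have "\<bar>(fst q - fst q') * (snd q - snd p)\<bar> \<le> norm (q - q') * \<rho>"
          "\<bar>(snd q - snd q') * (fst q' - fst p)\<bar> \<le> norm (q - q') * \<rho>"
          unfolding abs_mult by (intro mult_mono c d norm_ge_zero abs_ge_zero)+
        then show ?thesis
          unfolding abs_mult[of a3] by (intro mult_left_mono abs_ge_zero) linarith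
      qed
      also have "\<dots> = \<bar>a3\<bar> * (\<rho> + \<rho>) * norm (q - q')" by (simp add: algebra_simps)
      also have "\<dots> \<le> \<kappa> * norm (q - q')" by (rule mult_right_mono[OF ak norm_ge_zero])
      finally show ?thesis .
    qed
    then show "\<exists>\<rho>>0. \<forall>q\<in>ball p \<rho>. \<forall>q'\<in>ball p \<rho>. \<bar>f q - f q' - (q - q') \<bullet> ?G\<bar> \<le> \<kappa> * norm (q - q')"
      using \<rho>(1) by blast
  qed
  then show ?thesis ..
qed

lemma strict_gradient_bound:
  assumes G: "strict_gradient w p G" and d: "norm d = 1" and r: "0 < r"
    and K: "\<And>h. 0 < h \<Longrightarrow> h < r \<Longrightarrow> \<bar>w (p + h *\<^sub>R d) - w p\<bar> \<le> K * h"
  shows "\<bar>d \<bullet> G\<bar> \<le> K"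
proof (rule field_le_epsilon)
  fix e :: real assume "e > 0"
  then obtain \<rho> where \<rho>: "\<rho> > 0"
    "\<forall>q\<in>ball p \<rho>. \<forall>q'\<in>ball p \<rho>. \<bar>w q - w q' - (q - q') \<bullet> G\<bar> \<le> e * norm (q - q')"
    using G unfolding strict_gradient_def by blast
  define h where "h = min r \<rho> / 2"
  have h: "0 < h" "h < r" "h < \<rho>" using r \<rho>(1) by (auto simp: h_def min_def)
  have "p + h *\<^sub>R d \<in> ball p \<rho>" "p \<in> ball p \<rho>" using h \<rho>(1) d by (auto simp: dist_norm)
  then have "\<bar>w (p + h *\<^sub>R d) - w p - (p + h *\<^sub>R d - p) \<bullet> G\<bar> \<le> e * norm (p + h *\<^sub>R d - p)" using \<rho>(2) by blast
  then have "\<bar>w (p + h *\<^sub>R d) - w p - h * (d \<bullet> G)\<bar> \<le> e * h" using d h by simp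
  with K[OF h(1,2)] have "\<bar>h * (d \<bullet> G)\<bar> \<le> K * h + e * h" by linarith
  then have "h * \<bar>d \<bullet> G\<bar> \<le> h * (K + e)" using h by (simp add: abs_mult algebra_simps)
  then show "\<bar>d \<bullet> G\<bar> \<le> K + e" using h by simp
qed

section \<open>Nodal interpolation on a tensor-product mesh\<close>

lemma sum_lessThan_split:
  fixes f :: "nat \<Rightarrow> real"
  assumes "J < N" "\<And>j. J < j \<Longrightarrow> j < N \<Longrightarrow> f j = 0"
  shows "(\<Sum>j<N. f j) = (\<Sum>j<J. f j) + f J"
proof -
  have "(\<Sum>j<N. f j) = (\<Sum>j<Suc J. f j)"
    by (rule sum.mono_neutral_right) (use assms in auto)
  then show ?thesis by simp
qed

definition mixed_difference :: "(nat \<Rightarrow> nat \<Rightarrow> real) \<Rightarrow> nat \<Rightarrow> nat \<Rightarrow> real" where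
  "mixed_difference W i j = W i j + W (Suc i) (Suc j) - W (Suc i) j - W i (Suc j)"

lemma sum_mixed_difference1: "(\<Sum>i<n. mixed_difference W i j) = (W n (Suc j) - W n j) - (W 0 (Suc j) - W 0 j)"
  using sum_lessThan_telescope[of "\<lambda>i. W i (Suc j) - W i j" n] by (simp add: mixed_difference_def algebra_simps)

lemma sum_mixed_difference2: "(\<Sum>j<n. mixed_difference W i j) = (W (Suc i) n - W i n) - (W (Suc i) 0 - W i 0)"
  using sum_lessThan_telescope[of "\<lambda>j. W (Suc i) j - W i j" n] by (simp add: mixed_difference_def algebra_simps)

locale mesh =
  fixes x :: "nat \<Rightarrow> real" and N :: nat
  assumes x_0: "x 0 = 0" and x_N: "x N = 1" and x_step: "\<And>i. i < N \<Longrightarrow> x i < x (Suc i)"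
begin

lemma x_less: "i < j \<Longrightarrow> j \<le> N \<Longrightarrow> x i < x j"
proof (induction j)
  case (Suc j)
  then show ?case using x_step[of j] by (cases "i = j") force+
qed simp

lemma x_mono: "i \<le> j \<Longrightarrow> j \<le> N \<Longrightarrow> x i \<le> x j"
  using x_less[of i j] by (cases "i = j") auto

lemma x_range: "i \<le> N \<Longrightarrow> 0 \<le> x i" "i \<le> N \<Longrightarrow> x i \<le> 1"
  using x_mono[of 0 i] x_mono[of i N] x_0 x_N by auto

lemma N_pos: "0 < N"
  using x_0 x_N by (cases N) auto

definition width :: "nat \<Rightarrow> real" where "width i = x (Suc i) - x i"

lemma width_pos: "i < N \<Longrightarrow> 0 < width i"
  using x_step by (simp add: width_def)

definition local_coord :: "nat \<Rightarrow> real \<Rightarrow> real" where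
  "local_coord i s = (s - x i) / width i"

definition clamped :: "nat \<Rightarrow> real \<Rightarrow> real" where
  "clamped i s = max 0 (min 1 (local_coord i s))"

lemma clamped_range: "0 \<le> clamped i s" "clamped i s \<le> 1"
  by (auto simp: clamped_def)

lemma local_coord_range:
  assumes "i < N" "x i \<le> s" "s \<le> x (Suc i)" shows "0 \<le> local_coord i s" "local_coord i s \<le> 1"
  using width_pos[OF assms(1)] assms by (auto simp: local_coord_def width_def divide_simps)

lemma clamped_inside:
  assumes "i < N" "x i \<le> s" "s \<le> x (Suc i)" shows "clamped i s = local_coord i s"
  using local_coord_range[OF assms] by (simp add: clamped_def)

lemma clamped_right:
  assumes "i < N" "x (Suc i) \<le> s" shows "clamped i s = 1"
proof -
  have "1 \<le> local_coord i s" using width_pos[OF assms(1)] assms by (simp add: local_coord_def width_def)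
  then show ?thesis by (simp add: clamped_def)
qed

lemma clamped_left:
  assumes "i < N" "s \<le> x i" shows "clamped i s = 0"
proof -
  have "local_coord i s \<le> 0" using width_pos[OF assms(1)] assms by (simp add: local_coord_def divide_le_0_iff)
  then show ?thesis by (simp add: clamped_def)
qed

lemma clamped_lipschitz:
  assumes "i < N" shows "\<bar>clamped i s - clamped i s'\<bar> \<le> \<bar>s - s'\<bar> / width i"
proof -
  have "\<bar>clamped i s - clamped i s'\<bar> \<le> \<bar>local_coord i s - local_coord i s'\<bar>"
    unfolding clamped_def by linarith
  also have "local_coord i s - local_coord i s' = (s - s') / width i"
    by (simp add: local_coord_def diff_divide_distrib)
  also have "\<bar>\<dots>\<bar> = \<bar>s - s'\<bar> / width i" using width_pos[OF assms] by (simp add: abs_divide)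
  finally show ?thesis .
qed

text \<open>Twofold summation by parts of the nodal values: a single formula on the whole plane, in which each cell
  contributes its mixed second difference, and \<open>clamped\<close> freezes the local coordinates at \<open>0\<close> before
  the cell and at \<open>1\<close> behind it. Being a finite sum of Lipschitz functions it is continuous across
  cell edges, so no gluing argument is needed.\<close>

definition nodal_interpolant ::
    "(nat \<Rightarrow> nat \<Rightarrow> real \<Rightarrow> real \<Rightarrow> real) \<Rightarrow> (nat \<Rightarrow> nat \<Rightarrow> real) \<Rightarrow> real \<times> real \<Rightarrow> real" where
  "nodal_interpolant m W p =
     (\<Sum>i<N. \<Sum>j<N. mixed_difference W i j * m i j (clamped i (fst p)) (clamped j (snd p)))"

definition zero_boundary :: "(nat \<Rightarrow> nat \<Rightarrow> real) \<Rightarrow> bool" where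
  "zero_boundary W \<longleftrightarrow> (\<forall>i\<le>N. W i 0 = 0 \<and> W i N = 0 \<and> W 0 i = 0 \<and> W N i = 0)"

definition cell_value ::
    "(nat \<Rightarrow> nat \<Rightarrow> real \<Rightarrow> real \<Rightarrow> real) \<Rightarrow> (nat \<Rightarrow> nat \<Rightarrow> real) \<Rightarrow> nat \<Rightarrow> nat \<Rightarrow> real \<times> real \<Rightarrow> real" where
  "cell_value m W i j p = cell_form (m i j) (W i j) (W (Suc i) j) (W i (Suc j)) (W (Suc i) (Suc j))
     (local_coord i (fst p)) (local_coord j (snd p))"

text \<open>To the left of the cell \<open>(I, J)\<close> the clamped coordinates are \<open>1\<close>, to the right they are \<open>0\<close>, and the
  mixed differences of the cells to the left telescope to the corner values of the cell.\<close>

lemma nodal_interpolant_on_cell: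
  assumes m: "\<And>i j. m i j \<in> element_shapes" and W: "zero_boundary W"
    and I: "I < N" "J < N" and p: "p \<in> rectangle x I J"
  shows "nodal_interpolant m W p = cell_value m W I J p"
proof -
  let ?s = "fst p" and ?t = "snd p"
  have s: "x I \<le> ?s" "?s \<le> x (Suc I)" and t: "x J \<le> ?t" "?t \<le> x (Suc J)"
    using p by (auto simp: rectangle_def)
  have c1: "clamped i ?s = 1" if "i < I" for i
    using that x_mono[of "Suc i" I] I s by (intro clamped_right) auto
  have c2: "clamped j ?t = 1" if "j < J" for j
    using that x_mono[of "Suc j" J] I t by (intro clamped_right) auto
  have d1: "clamped i ?s = 0" if "I < i" "i < N" for i
    using that x_mono[of "Suc I" i] s by (intro clamped_left) auto
  have d2: "clamped j ?t = 0" if "J < j" "j < N" for j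
    using that x_mono[of "Suc J" j] t by (intro clamped_left) auto
  define \<sigma> \<tau> where "\<sigma> = local_coord I ?s" and "\<tau> = local_coord J ?t"
  have \<sigma>: "clamped I ?s = \<sigma>" and \<tau>: "clamped J ?t = \<tau>"
    unfolding \<sigma>_def \<tau>_def using clamped_inside s t I by auto
  have \<tau>r: "0 \<le> \<tau>" "\<tau> \<le> 1" using clamped_range \<tau> by metis+
  let ?D = "mixed_difference W"
  have W0: "W i 0 = 0" "W 0 i = 0" if "i \<le> N" for i using W that by (auto simp: zero_boundary_def)
  have inner: "(\<Sum>j<N. ?D i j * m i j (clamped i ?s) (clamped j ?t)) =
      clamped i ?s * (W (Suc i) J - W i J) + ?D i J * m i J (clamped i ?s) \<tau>" if i: "i < N" for i
  proof -
    have "(\<Sum>j<N. ?D i j * m i j (clamped i ?s) (clamped j ?t)) =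
        (\<Sum>j<J. ?D i j * m i j (clamped i ?s) (clamped j ?t)) + ?D i J * m i J (clamped i ?s) (clamped J ?t)"
      by (rule sum_lessThan_split[OF I(2)]) (simp add: d2 shape_boundary[OF m clamped_range])
    also have "(\<Sum>j<J. ?D i j * m i j (clamped i ?s) (clamped j ?t)) = (\<Sum>j<J. clamped i ?s * ?D i j)"
      by (rule sum.cong) (auto simp: c2 shape_boundary[OF m clamped_range])
    also have "\<dots> = clamped i ?s * (W (Suc i) J - W i J)"
      using i by (simp add: sum_distrib_left[symmetric] sum_mixed_difference2 W0)
    finally show ?thesis by (simp add: \<tau>)
  qed
  have "nodal_interpolant m W p = (\<Sum>i<N. clamped i ?s * (W (Suc i) J - W i J) + ?D i J * m i J (clamped i ?s) \<tau>)"
    unfolding nodal_interpolant_def by (rule sum.cong) (simp_all add: inner)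
  also have "\<dots> = (\<Sum>i<I. clamped i ?s * (W (Suc i) J - W i J) + ?D i J * m i J (clamped i ?s) \<tau>)
      + (clamped I ?s * (W (Suc I) J - W I J) + ?D I J * m I J (clamped I ?s) \<tau>)"
    by (rule sum_lessThan_split[OF I(1)]) (simp add: d1 shape_boundary[OF m \<tau>r])
  also have "(\<Sum>i<I. clamped i ?s * (W (Suc i) J - W i J) + ?D i J * m i J (clamped i ?s) \<tau>)
      = (\<Sum>i<I. (W (Suc i) J - W i J) + ?D i J * \<tau>)"
    by (rule sum.cong) (auto simp: c1 shape_boundary[OF m \<tau>r])
  also have "\<dots> = W I J + (W I (Suc J) - W I J) * \<tau>"
    using sum_lessThan_telescope[of "\<lambda>i. W i J" I] I
    by (simp add: sum.distrib sum_distrib_right[symmetric] sum_mixed_difference1 W0)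
  finally show ?thesis
    by (simp add: \<sigma> cell_value_def cell_form_def \<sigma>_def[symmetric] \<tau>_def[symmetric] mixed_difference_def algebra_simps)
qed

text \<open>Either all shapes vanish, or the mixed differences telescope over a full mesh line to boundary values,
  which are zero.\<close>

lemma nodal_interpolant_outside:
  assumes m: "\<And>i j. m i j \<in> element_shapes" and W: "zero_boundary W" and p: "p \<notin> \<Omega>"
  shows "nodal_interpolant m W p = 0"
proof -
  let ?s = "fst p" and ?t = "snd p"
  have W0: "W i 0 = 0" "W 0 i = 0" "W i N = 0" "W N i = 0" if "i \<le> N" for i
    using W that by (auto simp: zero_boundary_def)
  have z: "clamped i s = 0" if "s \<le> 0" "i < N" for i s
    using that x_range(1)[of i] by (intro clamped_left) auto
  have o: "clamped i s = 1" if "1 \<le> s" "i < N" for i s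
    using that x_range(2)[of "Suc i"] by (intro clamped_right) auto
  note b = shape_boundary[OF m clamped_range]
  consider "?s \<le> 0" | "1 \<le> ?s" | "?t \<le> 0" | "1 \<le> ?t"
    using p by (cases p) (force simp: \<Omega>_def)
  then show ?thesis
  proof cases
    case 1
    then show ?thesis by (simp add: nodal_interpolant_def z b)
  next
    case 2
    have "nodal_interpolant m W p = (\<Sum>i<N. \<Sum>j<N. mixed_difference W i j * clamped j ?t)"
      using 2 by (simp add: nodal_interpolant_def o b)
    also have "\<dots> = (\<Sum>j<N. (\<Sum>i<N. mixed_difference W i j) * clamped j ?t)"
      by (subst sum.swap) (simp add: sum_distrib_right)
    also have "\<dots> = 0" by (simp add: sum_mixed_difference1 W0)
    finally show ?thesis .
  next
    case 3
    then show ?thesis by (simp add: nodal_interpolant_def z b)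
  next
    case 4
    have "nodal_interpolant m W p = (\<Sum>i<N. (\<Sum>j<N. mixed_difference W i j) * clamped i ?s)"
      using 4 by (simp add: nodal_interpolant_def o b sum_distrib_right)
    also have "\<dots> = 0" by (simp add: sum_mixed_difference2 W0)
    finally show ?thesis .
  qed
qed

lemma nodal_interpolant_lipschitz:
  assumes m: "\<And>i j. m i j \<in> element_shapes"
  shows "\<exists>L. \<forall>q q'. \<bar>nodal_interpolant m W q - nodal_interpolant m W q'\<bar> \<le> L * norm (q - q')"
proof (intro exI allI)
  fix q q' :: "real \<times> real"
  let ?L = "\<lambda>i j. \<bar>mixed_difference W i j\<bar> * (1 / width i + 1 / width j)"
  have "\<bar>m i j (clamped i (fst q)) (clamped j (snd q)) - m i j (clamped i (fst q')) (clamped j (snd q'))\<bar>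
      \<le> (1 / width i + 1 / width j) * norm (q - q')" if "i < N" "j < N" for i j
  proof -
    have "\<bar>m i j (clamped i (fst q)) (clamped j (snd q)) - m i j (clamped i (fst q')) (clamped j (snd q'))\<bar>
        \<le> \<bar>clamped i (fst q) - clamped i (fst q')\<bar> + \<bar>clamped j (snd q) - clamped j (snd q')\<bar>"
      by (rule shape_lipschitz[OF m]) (rule clamped_range)+
    also have "\<dots> \<le> \<bar>fst q - fst q'\<bar> / width i + \<bar>snd q - snd q'\<bar> / width j"
      by (intro add_mono clamped_lipschitz that)
    also have "\<dots> \<le> norm (q - q') / width i + norm (q - q') / width j"
      using abs_coords_le_norm[of "q - q'"] width_pos[OF that(1)] width_pos[OF that(2)]
      by (intro add_mono divide_right_mono) auto
    finally show ?thesis by (simp add: algebra_simps)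
  qed
  then have "\<bar>mixed_difference W i j * m i j (clamped i (fst q)) (clamped j (snd q))
      - mixed_difference W i j * m i j (clamped i (fst q')) (clamped j (snd q'))\<bar> \<le> ?L i j * norm (q - q')"
    if "i < N" "j < N" for i j
    using that by (simp add: right_diff_distrib[symmetric] abs_mult mult.assoc mult_left_mono)
  then have "(\<Sum>i<N. \<Sum>j<N. \<bar>mixed_difference W i j * m i j (clamped i (fst q)) (clamped j (snd q))
      - mixed_difference W i j * m i j (clamped i (fst q')) (clamped j (snd q'))\<bar>) \<le> (\<Sum>i<N. \<Sum>j<N. ?L i j * norm (q - q'))"
    by (intro sum_mono) auto
  moreover have "\<bar>nodal_interpolant m W q - nodal_interpolant m W q'\<bar> \<le>
      (\<Sum>i<N. \<Sum>j<N. \<bar>mixed_difference W i j * m i j (clamped i (fst q)) (clamped j (snd q))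
      - mixed_difference W i j * m i j (clamped i (fst q')) (clamped j (snd q'))\<bar>)"
    unfolding nodal_interpolant_def sum_subtractf[symmetric]
    by (intro order_trans[OF sum_abs] sum_mono) simp
  ultimately show "\<bar>nodal_interpolant m W q - nodal_interpolant m W q'\<bar> \<le> (\<Sum>i<N. \<Sum>j<N. ?L i j) * norm (q - q')"
    by (simp add: sum_distrib_right)
qed

lemma nodal_interpolant_diff:
  "nodal_interpolant m (\<lambda>i j. W i j - W' i j) p = nodal_interpolant m W p - nodal_interpolant m W' p"
  by (simp add: nodal_interpolant_def mixed_difference_def sum_subtractf[symmetric] algebra_simps)

lemma interval_index:
  assumes "0 \<le> s" "s < 1" shows "\<exists>i<N. x i \<le> s \<and> s < x (Suc i)"
proof -
  have "\<exists>i<n. x i \<le> s \<and> s < x (Suc i)" if "s < x n" "n \<le> N" for n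
    using that
  proof (induction n)
    case 0
    then show ?case using assms x_0 by simp
  next
    case (Suc n)
    then show ?case by (cases "s < x n") (auto simp: not_less less_Suc_eq)
  qed
  from this[of N] show ?thesis using assms x_N by simp
qed

lemma interval_index_unique:
  assumes "i < N" "j < N" "x i \<le> s" "s < x (Suc i)" "x j \<le> s" "s < x (Suc j)" shows "i = j"
proof (rule ccontr)
  assume "i \<noteq> j"
  then have "Suc i \<le> j \<or> Suc j \<le> i" by auto
  then show False using x_mono[of "Suc i" j] x_mono[of "Suc j" i] assms by force
qed

text \<open>The mesh lines and both diagonals of every cell, prolonged to full lines. Away from this null set nodal
  interpolants are locally bilinear.\<close>

definition skeleton :: "(real \<times> real) set" where
  "skeleton = (\<Union>i\<le>N. {p. fst p = x i} \<union> {p. snd p = x i}) \<union>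
     (\<Union>i<N. \<Union>j<N. {p. local_coord i (fst p) = local_coord j (snd p)} \<union>
        {p. local_coord i (fst p) + local_coord j (snd p) = 1})"

lemma skeleton_null: "skeleton \<in> null_sets lebesgue"
proof -
  have line: "negligible {p. a * fst p + b * snd p = c}" if "a \<noteq> 0 \<or> b \<noteq> 0" for a b c :: real
  proof -
    have "{p. a * fst p + b * snd p = c} = {p. (a, b) \<bullet> p = c}" by (auto simp: inner_prod_def)
    then show ?thesis using negligible_hyperplane[of "(a, b)" c] that by (simp add: zero_prod_def)
  qed
  have 1: "negligible {p :: real \<times> real. fst p = c}" "negligible {p :: real \<times> real. snd p = c}" for c
    using line[of 1 0 c] line[of 0 1 c] by auto
  have 2: "negligible {p. local_coord i (fst p) = local_coord j (snd p)}"
    "negligible {p. local_coord i (fst p) + local_coord j (snd p) = 1}" if "i < N" "j < N" for i j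
  proof -
    note w = width_pos[OF that(1)] width_pos[OF that(2)]
    have "{p. local_coord i (fst p) = local_coord j (snd p)} =
        {p. (1 / width i) * fst p + (- (1 / width j)) * snd p = x i / width i - x j / width j}"
      by (auto simp: local_coord_def diff_divide_distrib)
    then show "negligible {p. local_coord i (fst p) = local_coord j (snd p)}"
      using line[of "1 / width i" "- (1 / width j)"] w by simp
    have "{p. local_coord i (fst p) + local_coord j (snd p) = 1} =
        {p. (1 / width i) * fst p + (1 / width j) * snd p = 1 + x i / width i + x j / width j}"
      by (auto simp: local_coord_def diff_divide_distrib)
    then show "negligible {p. local_coord i (fst p) + local_coord j (snd p) = 1}"
      using line[of "1 / width i" "1 / width j"] w by simp
  qed
  have "negligible skeleton"
    unfolding skeleton_def by (intro negligible_Un negligible_Union) (use 1 2 in auto)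
  then show ?thesis by (simp add: negligible_iff_null_sets)
qed

lemma nodal_interpolant_strict_gradient:
  assumes m: "\<And>i j. m i j \<in> element_shapes" and W: "zero_boundary W"
    and ij: "i < N" "j < N" and p: "p \<notin> skeleton" "x i \<le> fst p" "fst p < x (Suc i)" "x j \<le> snd p" "snd p < x (Suc j)"
  shows "\<exists>G. strict_gradient (nodal_interpolant m W) p G"
proof -
  let ?s = "local_coord i" and ?t = "local_coord j"
  have ne: "?s (fst p) \<noteq> ?t (snd p)" "?s (fst p) + ?t (snd p) \<noteq> 1" "fst p \<noteq> x i" "snd p \<noteq> x j"
    using p(1) ij unfolding skeleton_def by auto
  obtain b0 b1 b2 b3 where b: "\<forall>s' t'. (s' < t' \<longleftrightarrow> ?s (fst p) < ?t (snd p)) \<and> (s' + t' < 1 \<longleftrightarrow> ?s (fst p) + ?t (snd p) < 1) \<longrightarrow>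
      m i j s' t' = b0 + b1 * s' + b2 * t' + b3 * s' * t'"
    using shape_locally_bilinear[OF m ne(1,2)] by blast
  have c: "continuous_on UNIV (\<lambda>q. ?s (fst q))" "continuous_on UNIV (\<lambda>q. ?t (snd q))"
    unfolding local_coord_def using width_pos[OF ij(1)] width_pos[OF ij(2)] by (intro continuous_intros; simp)+
  define U1 where "U1 = (if ?s (fst p) < ?t (snd p) then {q. ?s (fst q) < ?t (snd q)} else {q. ?t (snd q) < ?s (fst q)})"
  define U2 where "U2 = (if ?s (fst p) + ?t (snd p) < 1 then {q. ?s (fst q) + ?t (snd q) < 1} else {q. 1 < ?s (fst q) + ?t (snd q)})"
  define U where "U = {x i<..<x (Suc i)} \<times> {x j<..<x (Suc j)} \<inter> U1 \<inter> U2"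
  have "open U1" "open U2"
    unfolding U1_def U2_def by (auto intro!: open_Collect_less continuous_intros c)
  then have "open U" unfolding U_def by (intro open_Int open_Times) auto
  have "p \<in> U" using p ne by (cases p) (auto simp: U_def U1_def U2_def)
  have "\<exists>a0 a1 a2 a3. \<forall>q\<in>U. nodal_interpolant m W q = a0 + a1 * fst q + a2 * snd q + a3 * fst q * snd q"
  proof -
    have eq: "nodal_interpolant m W q = cell_form (\<lambda>s t. b0 + b1 * s + b2 * t + b3 * s * t)
        (W i j) (W (Suc i) j) (W i (Suc j)) (W (Suc i) (Suc j)) (?s (fst q)) (?t (snd q))" if "q \<in> U" for q
    proof -
      have "q \<in> rectangle x i j" using that by (cases q) (auto simp: U_def rectangle_def)
      moreover have "m i j (?s (fst q)) (?t (snd q)) = b0 + b1 * ?s (fst q) + b2 * ?t (snd q) + b3 * ?s (fst q) * ?t (snd q)"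
        using that by (intro b[rule_format]) (auto simp: U_def U1_def U2_def split: if_splits)
      ultimately show ?thesis
        using nodal_interpolant_on_cell[OF m W ij] by (simp add: cell_value_def cell_form_def)
    qed
    have lc: "?s v = 1 / width i * v - x i / width i" "?t v = 1 / width j * v - x j / width j" for v
      by (simp_all add: local_coord_def diff_divide_distrib)
    have poly: "\<exists>a0 a1 a2 a3. \<forall>X Y. cell_form (\<lambda>s t. b0 + b1 * s + b2 * t + b3 * s * t) a b c d (k * X - k') (l * Y - l')
        = a0 + a1 * X + a2 * Y + a3 * X * Y" for a b c d k k' l l' :: real
    proof -
      let ?D = "a + d - b - c"
      have "cell_form (\<lambda>s t. b0 + b1 * s + b2 * t + b3 * s * t) a b c d (k * X - k') (l * Y - l') =
        (a - (b - a) * k' - (c - a) * l' + ?D * (b0 - b1 * k' - b2 * l' + b3 * k' * l'))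
        + ((b - a) * k + ?D * (b1 * k - b3 * k * l')) * X + ((c - a) * l + ?D * (b2 * l - b3 * k' * l)) * Y
        + (?D * b3 * k * l) * X * Y" for X Y
        unfolding cell_form_def by algebra
      then show ?thesis by blast
    qed
    obtain a0 a1 a2 a3 where a: "\<forall>X Y. cell_form (\<lambda>s t. b0 + b1 * s + b2 * t + b3 * s * t)
        (W i j) (W (Suc i) j) (W i (Suc j)) (W (Suc i) (Suc j))
        (1 / width i * X - x i / width i) (1 / width j * Y - x j / width j) = a0 + a1 * X + a2 * Y + a3 * X * Y"
      using poly[of "W i j" "W (Suc i) j" "W i (Suc j)" "W (Suc i) (Suc j)"] by blast
    have "nodal_interpolant m W q = a0 + a1 * fst q + a2 * snd q + a3 * fst q * snd q" if "q \<in> U" for q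
      unfolding eq[OF that] lc by (rule a[rule_format])
    then show ?thesis by blast
  qed
  then obtain a0 a1 a2 a3 where "\<And>q. q \<in> U \<Longrightarrow> nodal_interpolant m W q = a0 + a1 * fst q + a2 * snd q + a3 * fst q * snd q"
    by blast
  with \<open>open U\<close> \<open>p \<in> U\<close> show ?thesis by (intro strict_gradient_bilinear[of U p "nodal_interpolant m W"])
qed

lemma nodal_interpolant_H01:
  assumes m: "\<And>i j. m i j \<in> element_shapes" and W: "zero_boundary W"
  shows "nodal_interpolant m W \<in> H01"
    and "AE p in lebesgue_on \<Omega>. p \<notin> skeleton \<and> strict_gradient (nodal_interpolant m W) p (wgrad (nodal_interpolant m W) p)"
proof -
  let ?w = "nodal_interpolant m W"
  obtain L where L: "\<forall>q q'. \<bar>?w q - ?w q'\<bar> \<le> L * norm (q - q')" using nodal_interpolant_lipschitz[OF m] ..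
  define G where "G p = (SOME g. strict_gradient ?w p g)" for p
  have G: "strict_gradient ?w p (G p)" if p: "p \<in> \<Omega>" "p \<notin> skeleton" for p
  proof -
    have "0 \<le> fst p" "fst p < 1" "0 \<le> snd p" "snd p < 1" using p(1) by (auto simp: \<Omega>_def)
    then obtain i j where "i < N" "j < N" "x i \<le> fst p" "fst p < x (Suc i)" "x j \<le> snd p" "snd p < x (Suc j)"
      using interval_index[of "fst p"] interval_index[of "snd p"] by blast
    from nodal_interpolant_strict_gradient[OF m W this(1,2) p(2) this(3-6)] show ?thesis
      unfolding G_def by (rule someI_ex)
  qed
  note * = lipschitz_in_H01[OF L[rule_format] nodal_interpolant_outside[OF m W] skeleton_null G]
  show "?w \<in> H01" by (rule *(1))
  have "AE p in lebesgue_on \<Omega>. wgrad ?w p = G p" by (rule *(2))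
  moreover have "AE p in lebesgue_on \<Omega>. p \<in> \<Omega> \<and> p \<notin> skeleton"
    using AE_not_in[OF skeleton_null] by (auto simp: AE_restrict_space_iff elim: eventually_mono)
  ultimately show "AE p in lebesgue_on \<Omega>. p \<notin> skeleton \<and> strict_gradient ?w p (wgrad ?w p)"
    by eventually_elim (simp add: G)
qed

end

section \<open>Bilinear and linear elements as nodal spaces\<close>

context mesh
begin

text \<open>The discrete space consists, up to the values outside the closed square, of the nodal interpolants of
  all nodal values that vanish on the boundary.\<close>

definition nodal_space ::
    "(nat \<Rightarrow> nat \<Rightarrow> real \<Rightarrow> real \<Rightarrow> real) \<Rightarrow> (real \<times> real \<Rightarrow> real) set \<Rightarrow> bool" where
  "nodal_space m V \<longleftrightarrow> (\<forall>i j. m i j \<in> element_shapes) \<and>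
     (\<forall>v\<in>V. zero_boundary (\<lambda>i j. v (x i, x j)) \<and>
        (\<forall>p\<in>closure \<Omega>. v p = nodal_interpolant m (\<lambda>i j. v (x i, x j)) p)) \<and>
     (\<forall>W. zero_boundary W \<longrightarrow> nodal_interpolant m W \<in> V)"

lemma cell_cover:
  assumes "p \<in> closure \<Omega>" shows "\<exists>i<N. \<exists>j<N. p \<in> rectangle x i j"
proof -
  have *: "\<exists>i<N. x i \<le> s \<and> s \<le> x (Suc i)" if s: "0 \<le> s" "s \<le> 1" for s
  proof (cases "s < 1")
    case True
    then show ?thesis using interval_index[OF s(1)] less_imp_le by blast
  next
    case False
    then show ?thesis using s N_pos x_N x_range(2)[of "N - 1"] by (intro exI[of _ "N - 1"]) auto
  qed
  have "0 \<le> fst p" "fst p \<le> 1" "0 \<le> snd p" "snd p \<le> 1" using assms by (auto simp: closure_Omega)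
  then show ?thesis using *[of "fst p"] *[of "snd p"] by (cases p) (auto simp: rectangle_def)
qed

lemma nodal_interpolant_corners:
  assumes m: "\<And>i j. m i j \<in> element_shapes" and W: "zero_boundary W" and ij: "i < N" "j < N"
  shows "nodal_interpolant m W (x i, x j) = W i j" "nodal_interpolant m W (x (Suc i), x j) = W (Suc i) j"
    "nodal_interpolant m W (x i, x (Suc j)) = W i (Suc j)" "nodal_interpolant m W (x (Suc i), x (Suc j)) = W (Suc i) (Suc j)"
proof -
  note w = width_pos[OF ij(1)] width_pos[OF ij(2)]
  have l: "local_coord i (x i) = 0" "local_coord i (x (Suc i)) = 1" "local_coord j (x j) = 0" "local_coord j (x (Suc j)) = 1"
    using w by (auto simp: local_coord_def width_def)
  have r: "(x i, x j) \<in> rectangle x i j" "(x (Suc i), x j) \<in> rectangle x i j" "(x i, x (Suc j)) \<in> rectangle x i j"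
    "(x (Suc i), x (Suc j)) \<in> rectangle x i j"
    using w by (auto simp: rectangle_def width_def)
  show "nodal_interpolant m W (x i, x j) = W i j" "nodal_interpolant m W (x (Suc i), x j) = W (Suc i) j"
    "nodal_interpolant m W (x i, x (Suc j)) = W i (Suc j)" "nodal_interpolant m W (x (Suc i), x (Suc j)) = W (Suc i) (Suc j)"
    using nodal_interpolant_on_cell[where m = m, OF m W ij] r
    by (simp_all add: cell_value_def l cell_form_corners[OF m])
qed

text \<open>It is enough that membership in the space is tested cell by cell and that on each cell it forces the
  form given by the corner values.\<close>

lemma nodal_spaceI:
  assumes m: "\<And>i j. m i j \<in> element_shapes"
    and V: "V = {v. continuous_on (closure \<Omega>) v \<and> (\<forall>p\<in>frontier \<Omega>. v p = 0) \<and> (\<forall>i<N. \<forall>j<N. P i j v)}"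
    and P: "\<And>i j v. i < N \<Longrightarrow> j < N \<Longrightarrow>
      P i j v \<longleftrightarrow> (\<forall>p\<in>rectangle x i j. v p = cell_value m (\<lambda>i j. v (x i, x j)) i j p)"
  shows "nodal_space m V"
  unfolding nodal_space_def
proof (intro conjI allI ballI impI m)
  fix v assume v: "v \<in> V"
  have fr: "(x i, x 0) \<in> frontier \<Omega>" "(x i, x N) \<in> frontier \<Omega>" "(x 0, x i) \<in> frontier \<Omega>" "(x N, x i) \<in> frontier \<Omega>"
    if "i \<le> N" for i
    using x_range[OF that] by (auto simp: frontier_Omega closure_Omega x_0 x_N) (auto simp: \<Omega>_def)
  show z: "zero_boundary (\<lambda>i j. v (x i, x j))"
    using v fr unfolding V zero_boundary_def by blast
  fix p assume "p \<in> closure \<Omega>"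
  then obtain i j where ij: "i < N" "j < N" "p \<in> rectangle x i j" using cell_cover by blast
  then show "v p = nodal_interpolant m (\<lambda>i j. v (x i, x j)) p"
    using v P[OF ij(1,2)] nodal_interpolant_on_cell[where m = m, OF m z ij] unfolding V by auto
next
  fix W assume W: "zero_boundary W"
  let ?w = "nodal_interpolant m W"
  obtain L where L: "\<forall>q q'. \<bar>?w q - ?w q'\<bar> \<le> L * norm (q - q')" using nodal_interpolant_lipschitz[OF m] ..
  have "L-lipschitz_on UNIV ?w"
  proof (rule lipschitz_onI)
    show "dist (?w q) (?w q') \<le> L * dist q q'" for q q'
      using L unfolding dist_norm real_norm_def by blast
    have "\<bar>?w (1, 0) - ?w 0\<bar> \<le> L * norm ((1, 0) - 0 :: real \<times> real)" using L by blast
    then have "\<bar>?w (1, 0) - ?w 0\<bar> \<le> L" by simp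
    then show "0 \<le> L" using abs_ge_zero order_trans by blast
  qed
  then have "continuous_on (closure \<Omega>) ?w"
    using lipschitz_on_continuous_on continuous_on_subset subset_UNIV by blast
  moreover have "\<forall>p\<in>frontier \<Omega>. ?w p = 0"
    using nodal_interpolant_outside[OF m W] by (simp add: frontier_Omega)
  moreover have "P i j ?w" if ij: "i < N" "j < N" for i j
    unfolding P[OF ij]
    using nodal_interpolant_on_cell[where m = m, OF m W ij] nodal_interpolant_corners[where m = m, OF m W ij] by (simp add: cell_value_def)
  ultimately show "?w \<in> V" unfolding V by blast
qed

lemma local_coord_affine: "local_coord i s = 1 / width i * s - x i / width i"
  by (simp add: local_coord_def diff_divide_distrib)

lemma local_coord_inverse: "i < N \<Longrightarrow> s = x i + width i * local_coord i s"
  using width_pos[of i] by (simp add: local_coord_def)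

lemma local_coord_point: "i < N \<Longrightarrow> local_coord i (x i + width i * s) = s"
  using width_pos[of i] by (simp add: local_coord_def)

lemma x_Suc: "x (Suc i) = x i + width i"
  by (simp add: width_def)

lemma affine_in_local_coords:
  "\<exists>a0 a1 a2. \<forall>s t. A + B * local_coord i s + C * local_coord j t = a0 + a1 * s + a2 * t"
proof (intro exI allI)
  show "A + B * local_coord i s + C * local_coord j t =
    (A - B * (x i / width i) - C * (x j / width j)) + (B * (1 / width i)) * s + (C * (1 / width j)) * t" for s t
    unfolding local_coord_affine by algebra
qed

lemma bilinear_on_iff:
  assumes ij: "i < N" "j < N"
  shows "bilinear_on (rectangle x i j) v \<longleftrightarrow>
    (\<forall>p\<in>rectangle x i j. v p = cell_value (\<lambda>i j s t. s * t) (\<lambda>i j. v (x i, x j)) i j p)" (is "?L \<longleftrightarrow> ?R")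
proof
  note w = width_pos[OF ij(1)] width_pos[OF ij(2)]
  assume ?L
  then obtain a0 a1 a2 a3 where a: "\<And>s t. (s, t) \<in> rectangle x i j \<Longrightarrow> v (s, t) = a0 + a1 * s + a2 * t + a3 * s * t"
    unfolding bilinear_on_def by blast
  show ?R
  proof
    fix p assume p: "p \<in> rectangle x i j"
    obtain s t where st: "p = (s, t)" by (cases p)
    have c: "v (x i, x j) = a0 + a1 * x i + a2 * x j + a3 * x i * x j"
      "v (x (Suc i), x j) = a0 + a1 * x (Suc i) + a2 * x j + a3 * x (Suc i) * x j"
      "v (x i, x (Suc j)) = a0 + a1 * x i + a2 * x (Suc j) + a3 * x i * x (Suc j)"
      "v (x (Suc i), x (Suc j)) = a0 + a1 * x (Suc i) + a2 * x (Suc j) + a3 * x (Suc i) * x (Suc j)"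
      using w by (auto intro!: a simp: rectangle_def width_def)
    have "v (s, t) = a0 + a1 * (x i + width i * local_coord i s) + a2 * (x j + width j * local_coord j t)
        + a3 * (x i + width i * local_coord i s) * (x j + width j * local_coord j t)"
      using a[of s t] p local_coord_inverse[OF ij(1), of s] local_coord_inverse[OF ij(2), of t] by (simp add: st)
    then show "v p = cell_value (\<lambda>i j s t. s * t) (\<lambda>i j. v (x i, x j)) i j p"
      unfolding st cell_value_def cell_form_def c by (simp add: x_Suc algebra_simps)
  qed
next
  assume ?R
  let ?a = "v (x i, x j)" and ?b = "v (x (Suc i), x j)" and ?c = "v (x i, x (Suc j))" and ?d = "v (x (Suc i), x (Suc j))"
  let ?k = "1 / width i" and ?l = "1 / width j" and ?k' = "x i / width i" and ?l' = "x j / width j"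
  have "v (s, t) = (?a - (?b - ?a) * ?k' - (?c - ?a) * ?l' + (?a + ?d - ?b - ?c) * ?k' * ?l')
      + ((?b - ?a) * ?k - (?a + ?d - ?b - ?c) * ?k * ?l') * s + ((?c - ?a) * ?l - (?a + ?d - ?b - ?c) * ?k' * ?l) * t
      + ((?a + ?d - ?b - ?c) * ?k * ?l) * s * t" if "(s, t) \<in> rectangle x i j" for s t
  proof -
    have "v (s, t) = ?a + (?b - ?a) * (?k * s - ?k') + (?c - ?a) * (?l * t - ?l') + (?a + ?d - ?b - ?c) * ((?k * s - ?k') * (?l * t - ?l'))"
      using \<open>?R\<close> that by (simp add: cell_value_def cell_form_def local_coord_affine)
    then show ?thesis by algebra
  qed
  then show ?L unfolding bilinear_on_def by blast
qed

lemma linear_on_convex_hull: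
  assumes "linear_on (convex hull {A, B, C}) v" "0 \<le> \<alpha>" "0 \<le> \<beta>" "0 \<le> \<gamma>" "\<alpha> + \<beta> + \<gamma> = 1"
  shows "v (\<alpha> *\<^sub>R A + \<beta> *\<^sub>R B + \<gamma> *\<^sub>R C) = \<alpha> * v A + \<beta> * v B + \<gamma> * v C"
proof -
  let ?H = "convex hull {A, B, C}"
  obtain a0 a1 a2 where a: "\<forall>(s, t)\<in>?H. v (s, t) = a0 + a1 * s + a2 * t"
    using assms(1) unfolding linear_on_def by blast
  have a': "v p = a0 + a1 * fst p + a2 * snd p" if "p \<in> ?H" for p
    using a that by (cases p) auto
  have mem: "\<alpha> *\<^sub>R A + \<beta> *\<^sub>R B + \<gamma> *\<^sub>R C \<in> ?H" unfolding convex_hull_3 using assms by blast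
  have ABC: "A \<in> ?H" "B \<in> ?H" "C \<in> ?H" by (auto intro: hull_inc)
  have "v (\<alpha> *\<^sub>R A + \<beta> *\<^sub>R B + \<gamma> *\<^sub>R C) = a0 * (\<alpha> + \<beta> + \<gamma>) + a1 * (\<alpha> * fst A + \<beta> * fst B + \<gamma> * fst C)
      + a2 * (\<alpha> * snd A + \<beta> * snd B + \<gamma> * snd C)"
    unfolding a'[OF mem] assms(5) by simp
  then show ?thesis unfolding a'[OF ABC(1)] a'[OF ABC(2)] a'[OF ABC(3)] by (simp add: algebra_simps)
qed

text \<open>In barycentric coordinates of a triangle the local coordinates \<open>\<sigma>\<close>, \<open>\<tau>\<close> are linear, and the triangle is
  the part of the cell on one side of the diagonal, where the shape is the affine function \<open>\<tau>\<close>, \<open>\<sigma>\<close>, \<open>0\<close> or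
  \<open>\<sigma> + \<tau> - 1\<close>, respectively.\<close>

lemma linear_elements_cell_iff:
  assumes ij: "i < N" "j < N"
  shows "(\<forall>T\<in>triangles x d i j. linear_on T v) \<longleftrightarrow>
    (\<forall>p\<in>rectangle x i j. v p =
      cell_value (\<lambda>i j. if d i j then min else (\<lambda>s t. max 0 (s + t - 1))) (\<lambda>i j. v (x i, x j)) i j p)" (is "?L \<longleftrightarrow> ?R")
proof -
  note w = width_pos[OF ij(1)] width_pos[OF ij(2)]
  define ll lr ul ur where "ll = (x i, x j)" and "lr = (x (Suc i), x j)" and "ul = (x i, x (Suc j))" and "ur = (x (Suc i), x (Suc j))"
  note corner_defs = ll_def lr_def ul_def ur_def
  define pt where "pt \<sigma> \<tau> = (x i + width i * \<sigma>, x j + width j * \<tau>)" for \<sigma> \<tau>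
  have pt: "pt (local_coord i (fst p)) (local_coord j (snd p)) = p" for p
    using local_coord_inverse[OF ij(1), of "fst p"] local_coord_inverse[OF ij(2), of "snd p"]
    by (simp add: pt_def prod_eq_iff)
  have lc: "local_coord i (fst (pt \<sigma> \<tau>)) = \<sigma>" "local_coord j (snd (pt \<sigma> \<tau>)) = \<tau>" for \<sigma> \<tau>
    using local_coord_point ij by (auto simp: pt_def)
  have rect: "p \<in> rectangle x i j \<longleftrightarrow> 0 \<le> local_coord i (fst p) \<and> local_coord i (fst p) \<le> 1 \<and>
      0 \<le> local_coord j (snd p) \<and> local_coord j (snd p) \<le> 1" for p
    using w by (cases p) (auto simp: rectangle_def local_coord_def width_def divide_simps)
  have comb: "\<alpha> *\<^sub>R ll + \<beta> *\<^sub>R lr + \<gamma> *\<^sub>R ur = pt (\<beta> + \<gamma>) \<gamma>" "\<alpha> *\<^sub>R ll + \<beta> *\<^sub>R ul + \<gamma> *\<^sub>R ur = pt \<gamma> (\<beta> + \<gamma>)"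
    "\<alpha> *\<^sub>R ll + \<beta> *\<^sub>R lr + \<gamma> *\<^sub>R ul = pt \<beta> \<gamma>" "\<alpha> *\<^sub>R lr + \<beta> *\<^sub>R ul + \<gamma> *\<^sub>R ur = pt (\<alpha> + \<gamma>) (\<beta> + \<gamma>)"
    if "\<alpha> + \<beta> + \<gamma> = 1" for \<alpha> \<beta> \<gamma>
  proof -
    have a: "\<alpha> = 1 - \<beta> - \<gamma>" using that by simp
    show "\<alpha> *\<^sub>R ll + \<beta> *\<^sub>R lr + \<gamma> *\<^sub>R ur = pt (\<beta> + \<gamma>) \<gamma>" "\<alpha> *\<^sub>R ll + \<beta> *\<^sub>R ul + \<gamma> *\<^sub>R ur = pt \<gamma> (\<beta> + \<gamma>)"
      "\<alpha> *\<^sub>R ll + \<beta> *\<^sub>R lr + \<gamma> *\<^sub>R ul = pt \<beta> \<gamma>" "\<alpha> *\<^sub>R lr + \<beta> *\<^sub>R ul + \<gamma> *\<^sub>R ur = pt (\<alpha> + \<gamma>) (\<beta> + \<gamma>)"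
      unfolding corner_defs pt_def x_Suc a by (simp_all add: algebra_simps)
  qed
  let ?m = "if d i j then min else (\<lambda>s t. max 0 (s + t - 1))"
  have cv: "cell_value (\<lambda>i j. if d i j then min else (\<lambda>s t. max 0 (s + t - 1))) (\<lambda>i j. v (x i, x j)) i j p
      = cell_form ?m (v ll) (v lr) (v ul) (v ur) (local_coord i (fst p)) (local_coord j (snd p))" for p
    by (simp add: cell_value_def corner_defs)
  have aff: "linear_on T v" if T: "\<And>p. p \<in> T \<Longrightarrow> v p = A + B * local_coord i (fst p) + C * local_coord j (snd p)" for T A B C
  proof -
    obtain a0 a1 a2 where "\<forall>s t. A + B * local_coord i s + C * local_coord j t = a0 + a1 * s + a2 * t"
      using affine_in_local_coords by blast
    then show ?thesis unfolding linear_on_def using T by fastforce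
  qed
  show ?thesis
  proof (cases "d i j")
    case True
    have tri: "triangles x d i j = {convex hull {ll, lr, ur}, convex hull {ll, ul, ur}}"
      using True by (simp add: triangles_def Let_def corner_defs)
    show ?thesis
    proof
      assume L: ?L
      show ?R
      proof
        fix p assume p: "p \<in> rectangle x i j"
        define \<sigma> \<tau> where "\<sigma> = local_coord i (fst p)" and "\<tau> = local_coord j (snd p)"
        have r: "0 \<le> \<sigma>" "\<sigma> \<le> 1" "0 \<le> \<tau>" "\<tau> \<le> 1" using p rect by (auto simp: \<sigma>_def \<tau>_def)
        have "v (pt \<sigma> \<tau>) = cell_form ?m (v ll) (v lr) (v ul) (v ur) \<sigma> \<tau>"
        proof (cases "\<tau> \<le> \<sigma>")
          case True
          have "v ((1 - \<sigma>) *\<^sub>R ll + (\<sigma> - \<tau>) *\<^sub>R lr + \<tau> *\<^sub>R ur) = (1 - \<sigma>) * v ll + (\<sigma> - \<tau>) * v lr + \<tau> * v ur"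
            by (rule linear_on_convex_hull) (use L r True in \<open>auto simp: tri\<close>)
          moreover have "(1 - \<sigma>) *\<^sub>R ll + (\<sigma> - \<tau>) *\<^sub>R lr + \<tau> *\<^sub>R ur = pt \<sigma> \<tau>"
            using comb(1)[of "1 - \<sigma>" "\<sigma> - \<tau>" \<tau>] by simp
          ultimately have vp: "v (pt \<sigma> \<tau>) = (1 - \<sigma>) * v ll + (\<sigma> - \<tau>) * v lr + \<tau> * v ur" by (simp only:)
          have mp: "?m \<sigma> \<tau> = \<tau>" using True \<open>d i j\<close> by simp
          show ?thesis unfolding cell_form_def mp vp by (simp add: algebra_simps)
        next
          case False
          have "v ((1 - \<tau>) *\<^sub>R ll + (\<tau> - \<sigma>) *\<^sub>R ul + \<sigma> *\<^sub>R ur) = (1 - \<tau>) * v ll + (\<tau> - \<sigma>) * v ul + \<sigma> * v ur"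
            by (rule linear_on_convex_hull) (use L r False in \<open>auto simp: tri\<close>)
          moreover have "(1 - \<tau>) *\<^sub>R ll + (\<tau> - \<sigma>) *\<^sub>R ul + \<sigma> *\<^sub>R ur = pt \<sigma> \<tau>"
            using comb(2)[of "1 - \<tau>" "\<tau> - \<sigma>" \<sigma>] by simp
          ultimately have vp: "v (pt \<sigma> \<tau>) = (1 - \<tau>) * v ll + (\<tau> - \<sigma>) * v ul + \<sigma> * v ur" by (simp only:)
          have mp: "?m \<sigma> \<tau> = \<sigma>" using False \<open>d i j\<close> by simp
          show ?thesis unfolding cell_form_def mp vp by (simp add: algebra_simps)
        qed
        then show "v p = cell_value (\<lambda>i j. if d i j then min else (\<lambda>s t. max 0 (s + t - 1))) (\<lambda>i j. v (x i, x j)) i j p"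
          unfolding cv \<sigma>_def \<tau>_def pt .
      qed
    next
      assume R: ?R
      have "linear_on (convex hull {ll, lr, ur}) v"
      proof (rule aff)
        fix p assume "p \<in> convex hull {ll, lr, ur}"
        then obtain \<alpha> \<beta> \<gamma> where c: "0 \<le> \<alpha>" "0 \<le> \<beta>" "0 \<le> \<gamma>" "\<alpha> + \<beta> + \<gamma> = 1" "p = pt (\<beta> + \<gamma>) \<gamma>"
          unfolding convex_hull_3 using comb(1) by blast
        then have p: "p \<in> rectangle x i j" by (simp add: rect lc)
        have vp: "v p = cell_form ?m (v ll) (v lr) (v ul) (v ur) (local_coord i (fst p)) (local_coord j (snd p))"
          using R p unfolding cv by blast
        have mp: "?m (local_coord i (fst p)) (local_coord j (snd p)) = local_coord j (snd p)"
          using c True by (simp add: lc)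
        show "v p = v ll + (v lr - v ll) * local_coord i (fst p)
            + (v ul - v ll + (v ll + v ur - v lr - v ul)) * local_coord j (snd p)"
          unfolding vp cell_form_def mp by (simp add: algebra_simps)
      qed
      moreover have "linear_on (convex hull {ll, ul, ur}) v"
      proof (rule aff)
        fix p assume "p \<in> convex hull {ll, ul, ur}"
        then obtain \<alpha> \<beta> \<gamma> where c: "0 \<le> \<alpha>" "0 \<le> \<beta>" "0 \<le> \<gamma>" "\<alpha> + \<beta> + \<gamma> = 1" "p = pt \<gamma> (\<beta> + \<gamma>)"
          unfolding convex_hull_3 using comb(2) by blast
        then have p: "p \<in> rectangle x i j" by (simp add: rect lc)
        have vp: "v p = cell_form ?m (v ll) (v lr) (v ul) (v ur) (local_coord i (fst p)) (local_coord j (snd p))"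
          using R p unfolding cv by blast
        have mp: "?m (local_coord i (fst p)) (local_coord j (snd p)) = local_coord i (fst p)"
          using c True by (simp add: lc)
        show "v p = v ll + (v lr - v ll + (v ll + v ur - v lr - v ul)) * local_coord i (fst p)
            + (v ul - v ll) * local_coord j (snd p)"
          unfolding vp cell_form_def mp by (simp add: algebra_simps)
      qed
      ultimately show ?L by (simp add: tri)
    qed
  next
    case False
    have tri: "triangles x d i j = {convex hull {ll, lr, ul}, convex hull {lr, ul, ur}}"
      using False by (simp add: triangles_def Let_def corner_defs)
    show ?thesis
    proof
      assume L: ?L
      show ?R
      proof
        fix p assume p: "p \<in> rectangle x i j"
        define \<sigma> \<tau> where "\<sigma> = local_coord i (fst p)" and "\<tau> = local_coord j (snd p)"
        have r: "0 \<le> \<sigma>" "\<sigma> \<le> 1" "0 \<le> \<tau>" "\<tau> \<le> 1" using p rect by (auto simp: \<sigma>_def \<tau>_def)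
        have "v (pt \<sigma> \<tau>) = cell_form ?m (v ll) (v lr) (v ul) (v ur) \<sigma> \<tau>"
        proof (cases "\<sigma> + \<tau> \<le> 1")
          case True
          have "v ((1 - \<sigma> - \<tau>) *\<^sub>R ll + \<sigma> *\<^sub>R lr + \<tau> *\<^sub>R ul) = (1 - \<sigma> - \<tau>) * v ll + \<sigma> * v lr + \<tau> * v ul"
            by (rule linear_on_convex_hull) (use L r True in \<open>auto simp: tri\<close>)
          moreover have "(1 - \<sigma> - \<tau>) *\<^sub>R ll + \<sigma> *\<^sub>R lr + \<tau> *\<^sub>R ul = pt \<sigma> \<tau>"
            using comb(3)[of "1 - \<sigma> - \<tau>" \<sigma> \<tau>] by simp
          ultimately have vp: "v (pt \<sigma> \<tau>) = (1 - \<sigma> - \<tau>) * v ll + \<sigma> * v lr + \<tau> * v ul" by (simp only:)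
          have mp: "?m \<sigma> \<tau> = 0" using True \<open>\<not> d i j\<close> by simp
          show ?thesis unfolding cell_form_def mp vp by (simp add: algebra_simps)
        next
          case False
          have "v ((1 - \<tau>) *\<^sub>R lr + (1 - \<sigma>) *\<^sub>R ul + (\<sigma> + \<tau> - 1) *\<^sub>R ur) = (1 - \<tau>) * v lr + (1 - \<sigma>) * v ul + (\<sigma> + \<tau> - 1) * v ur"
            by (rule linear_on_convex_hull) (use L r False in \<open>auto simp: tri\<close>)
          moreover have "(1 - \<tau>) *\<^sub>R lr + (1 - \<sigma>) *\<^sub>R ul + (\<sigma> + \<tau> - 1) *\<^sub>R ur = pt \<sigma> \<tau>"
            using comb(4)[of "1 - \<tau>" "1 - \<sigma>" "\<sigma> + \<tau> - 1"] by simp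
          ultimately have vp: "v (pt \<sigma> \<tau>) = (1 - \<tau>) * v lr + (1 - \<sigma>) * v ul + (\<sigma> + \<tau> - 1) * v ur" by (simp only:)
          have mp: "?m \<sigma> \<tau> = \<sigma> + \<tau> - 1" using False \<open>\<not> d i j\<close> by simp
          show ?thesis unfolding cell_form_def mp vp by (simp add: algebra_simps)
        qed
        then show "v p = cell_value (\<lambda>i j. if d i j then min else (\<lambda>s t. max 0 (s + t - 1))) (\<lambda>i j. v (x i, x j)) i j p"
          unfolding cv \<sigma>_def \<tau>_def pt .
      qed
    next
      assume R: ?R
      have "linear_on (convex hull {ll, lr, ul}) v"
      proof (rule aff)
        fix p assume "p \<in> convex hull {ll, lr, ul}"
        then obtain \<alpha> \<beta> \<gamma> where c: "0 \<le> \<alpha>" "0 \<le> \<beta>" "0 \<le> \<gamma>" "\<alpha> + \<beta> + \<gamma> = 1" "p = pt \<beta> \<gamma>"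
          unfolding convex_hull_3 using comb(3) by blast
        then have p: "p \<in> rectangle x i j" by (simp add: rect lc)
        have vp: "v p = cell_form ?m (v ll) (v lr) (v ul) (v ur) (local_coord i (fst p)) (local_coord j (snd p))"
          using R p unfolding cv by blast
        have mp: "?m (local_coord i (fst p)) (local_coord j (snd p)) = 0"
          using c False by (simp add: lc)
        show "v p = v ll + (v lr - v ll) * local_coord i (fst p) + (v ul - v ll) * local_coord j (snd p)"
          unfolding vp cell_form_def mp by (simp add: algebra_simps)
      qed
      moreover have "linear_on (convex hull {lr, ul, ur}) v"
      proof (rule aff)
        fix p assume "p \<in> convex hull {lr, ul, ur}"
        then obtain \<alpha> \<beta> \<gamma> where c: "0 \<le> \<alpha>" "0 \<le> \<beta>" "0 \<le> \<gamma>" "\<alpha> + \<beta> + \<gamma> = 1" "p = pt (\<alpha> + \<gamma>) (\<beta> + \<gamma>)"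
          unfolding convex_hull_3 using comb(4) by blast
        then have p: "p \<in> rectangle x i j" by (simp add: rect lc)
        have vp: "v p = cell_form ?m (v ll) (v lr) (v ul) (v ur) (local_coord i (fst p)) (local_coord j (snd p))"
          using R p unfolding cv by blast
        have mp: "?m (local_coord i (fst p)) (local_coord j (snd p)) = local_coord i (fst p) + local_coord j (snd p) - 1"
          using c False by (simp add: lc)
        show "v p = (v ll - (v ll + v ur - v lr - v ul)) + (v lr - v ll + (v ll + v ur - v lr - v ul)) * local_coord i (fst p)
            + (v ul - v ll + (v ll + v ur - v lr - v ul)) * local_coord j (snd p)"
          unfolding vp cell_form_def mp by (simp add: algebra_simps)
      qed
      ultimately show ?L by (simp add: tri)
    qed
  qed
qed

lemma nodal_space_bilinear: "nodal_space (\<lambda>i j s t. s * t) (bilinear_elements x N)"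
  by (rule nodal_spaceI[where P = "\<lambda>i j. bilinear_on (rectangle x i j)"])
    (auto simp: element_shapes_def bilinear_elements_def bilinear_on_iff)

lemma nodal_space_linear:
  "nodal_space (\<lambda>i j. if d i j then min else (\<lambda>s t. max 0 (s + t - 1))) (linear_elements x d N)"
  by (rule nodal_spaceI[where P = "\<lambda>i j v. \<forall>T\<in>triangles x d i j. linear_on T v"])
    (simp_all add: element_shapes_def linear_elements_def linear_elements_cell_iff)

lemma nodal_space_subset_H01:
  assumes V: "nodal_space m V" and v: "v \<in> V" shows "v \<in> H01"
proof (rule H01_cong)
  show "nodal_interpolant m (\<lambda>i j. v (x i, x j)) \<in> H01"
    by (rule nodal_interpolant_H01(1)) (use assms in \<open>auto simp: nodal_space_def\<close>)
  show "nodal_interpolant m (\<lambda>i j. v (x i, x j)) p = v p" if "p \<in> \<Omega>" for p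
    using assms that closure_subset[of \<Omega>] by (force simp: nodal_space_def)
qed

end

section \<open>Estimates by sums over cells\<close>

lemma integral_indicator_Omega:
  assumes "A \<in> sets lebesgue"
  shows "integrable (lebesgue_on \<Omega>) (indicator A :: _ \<Rightarrow> real)"
    and "(LINT p|lebesgue_on \<Omega>. indicator A p) = measure lebesgue (A \<inter> \<Omega>)"
proof -
  have A: "A \<inter> \<Omega> \<in> sets (lebesgue_on \<Omega>)" using assms by (auto simp: sets_restrict_space)
  have e: "indicator A p = (indicator (A \<inter> \<Omega>) p :: real)" if "p \<in> space (lebesgue_on \<Omega>)" for p
    using that by (auto simp: indicator_def)
  have "integrable (lebesgue_on \<Omega>) (indicator (A \<inter> \<Omega>) :: _ \<Rightarrow> real)"
    using A less_top[THEN iffD1, OF Omega.emeasure_finite[of "A \<inter> \<Omega>"]] by (intro integrable_real_indicator) simp_all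
  then show "integrable (lebesgue_on \<Omega>) (indicator A :: _ \<Rightarrow> real)"
    using Bochner_Integration.integrable_cong[of "lebesgue_on \<Omega>" "lebesgue_on \<Omega>" "indicator A" "indicator (A \<inter> \<Omega>)", OF refl e]
    by simp
  have "(LINT p|lebesgue_on \<Omega>. indicator A p :: real) = (LINT p|lebesgue_on \<Omega>. indicator (A \<inter> \<Omega>) p)"
    by (rule Bochner_Integration.integral_cong[OF refl e])
  also have "\<dots> = measure (lebesgue_on \<Omega>) (A \<inter> \<Omega>)" using A by (simp add: sets.Int_space_eq2)
  also have "\<dots> = measure lebesgue (A \<inter> \<Omega>)" by (rule measure_restrict_space) auto
  finally show "(LINT p|lebesgue_on \<Omega>. indicator A p :: real) = measure lebesgue (A \<inter> \<Omega>)" .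
qed

lemma measure_box_pair:
  assumes "a \<le> b" "c \<le> d"
  shows "measure lebesgue (cbox (a, c) (b, d)) = (b - a) * (d - c)"
    and "measure lebesgue (box (a, c) (b, d)) = (b - a) * (d - c)"
proof -
  show "measure lebesgue (cbox (a, c) (b, d)) = (b - a) * (d - c)"
    using assms content_Pair[of a c b d] by (simp add: measure_completion)
  then show "measure lebesgue (box (a, c) (b, d)) = (b - a) * (d - c)"
    by (simp add: measure_completion measure_lborel_box_eq measure_lborel_cbox_eq)
qed

lemma sum_shift_le:
  fixes g :: "nat \<Rightarrow> real"
  assumes "\<And>i. 0 \<le> g i"
  shows "(\<Sum>i<N. g i + g (Suc i)) \<le> 2 * (\<Sum>i\<le>N. g i)"
proof -
  have "(\<Sum>i<N. g i) \<le> (\<Sum>i\<le>N. g i)" by (rule sum_mono2) (use assms in auto)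
  moreover have "(\<Sum>i<N. g (Suc i)) \<le> (\<Sum>i\<le>N. g i)"
    using sum.lessThan_Suc_shift[of g N] assms[of 0] by (simp add: lessThan_Suc_atMost)
  ultimately show ?thesis by (simp add: sum.distrib)
qed

text \<open>Every node between \<open>k\<close> and \<open>l\<close> is an end point of an interval between \<open>k\<close> and \<open>l\<close>. The nodes on the
  interface thus count as nodes of coarse cells.\<close>

lemma sum_le_cell_sum:
  fixes g :: "nat \<Rightarrow> real"
  assumes g: "\<And>i. 0 \<le> g i" and K: "k < l" "l \<le> N" and 0: "\<And>i. i < k \<or> l < i \<Longrightarrow> g i = 0"
  shows "(\<Sum>i\<le>N. g i) \<le> (\<Sum>i<N. if k \<le> i \<and> i < l then g i + g (Suc i) else 0)"
proof -
  have "(\<Sum>i\<le>N. g i) = (\<Sum>i\<in>{k..l}. g i)"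
    by (rule sum.mono_neutral_right) (use K 0 in auto)
  also have "{k..l} = insert l {k..<l}" using K by auto
  also have "(\<Sum>i\<in>insert l {k..<l}. g i) = g (Suc (l - 1)) + (\<Sum>i\<in>{k..<l}. g i)" using K by simp
  also have "g (Suc (l - 1)) \<le> (\<Sum>i\<in>{k..<l}. g (Suc i))"
    by (rule member_le_sum[of "l - 1" _ "\<lambda>i. g (Suc i)"]) (use K g in auto)
  also have "(\<Sum>i\<in>{k..<l}. g (Suc i)) + (\<Sum>i\<in>{k..<l}. g i) = (\<Sum>i\<in>{k..<l}. g i + g (Suc i))"
    by (simp add: sum.distrib)
  also have "\<dots> = (\<Sum>i\<in>{..<N} \<inter> {i. k \<le> i \<and> i < l}. g i + g (Suc i))"
    by (rule sum.cong) (use K in auto)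
  also have "\<dots> = (\<Sum>i<N. if k \<le> i \<and> i < l then g i + g (Suc i) else 0)"
    by (subst sum.inter_restrict) auto
  finally show ?thesis by simp
qed

context mesh
begin

definition corner_square_sum :: "(nat \<Rightarrow> nat \<Rightarrow> real) \<Rightarrow> nat \<Rightarrow> nat \<Rightarrow> real" where
  "corner_square_sum W i j = (W i j)\<^sup>2 + (W (Suc i) j)\<^sup>2 + (W i (Suc j))\<^sup>2 + (W (Suc i) (Suc j))\<^sup>2"

lemma corner_square_sum_nonneg: "0 \<le> corner_square_sum W i j"
  by (simp add: corner_square_sum_def)

lemma corner_abs_le:
  "\<bar>W i j\<bar> \<le> sqrt (corner_square_sum W i j)" "\<bar>W (Suc i) j\<bar> \<le> sqrt (corner_square_sum W i j)"
  "\<bar>W i (Suc j)\<bar> \<le> sqrt (corner_square_sum W i j)" "\<bar>W (Suc i) (Suc j)\<bar> \<le> sqrt (corner_square_sum W i j)"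
  by (auto intro!: real_le_rsqrt simp: corner_square_sum_def)

lemma sum_corner_square_sum_le:
  "(\<Sum>i<N. \<Sum>j<N. corner_square_sum W i j) \<le> 4 * (\<Sum>i\<le>N. \<Sum>j\<le>N. (W i j)\<^sup>2)"
proof -
  have "(\<Sum>i<N. \<Sum>j<N. corner_square_sum W i j) =
      (\<Sum>i<N. \<Sum>j<N. ((W i j)\<^sup>2 + (W (Suc i) j)\<^sup>2) + ((W i (Suc j))\<^sup>2 + (W (Suc i) (Suc j))\<^sup>2))"
    by (simp add: corner_square_sum_def algebra_simps)
  also have "\<dots> \<le> (\<Sum>i<N. 2 * (\<Sum>j\<le>N. (W i j)\<^sup>2 + (W (Suc i) j)\<^sup>2))"
    by (intro sum_mono sum_shift_le) simp
  also have "\<dots> = 2 * (\<Sum>i<N. (\<Sum>j\<le>N. (W i j)\<^sup>2) + (\<Sum>j\<le>N. (W (Suc i) j)\<^sup>2))"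
    by (simp add: sum_distrib_left sum.distrib)
  also have "\<dots> \<le> 2 * (2 * (\<Sum>i\<le>N. \<Sum>j\<le>N. (W i j)\<^sup>2))"
    by (intro mult_left_mono sum_shift_le[where g = "\<lambda>i. \<Sum>j\<le>N. (W i j)\<^sup>2"] sum_nonneg) auto
  finally show ?thesis by simp
qed

definition half_open_cell :: "nat \<Rightarrow> nat \<Rightarrow> (real \<times> real) set" where
  "half_open_cell i j = {x i..<x (Suc i)} \<times> {x j..<x (Suc j)}"

lemma half_open_cell_exists: "p \<in> \<Omega> \<Longrightarrow> \<exists>i<N. \<exists>j<N. p \<in> half_open_cell i j"
  using interval_index[of "fst p"] interval_index[of "snd p"]
  by (cases p) (force simp: half_open_cell_def \<Omega>_def)

lemma half_open_cell_rectangle: "half_open_cell i j \<subseteq> rectangle x i j"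
  by (auto simp: half_open_cell_def rectangle_def)

lemma integral_le_cell_sum:
  assumes g: "integrable (lebesgue_on \<Omega>) g" and B: "\<And>i j. 0 \<le> B i j"
    and gB: "AE p in lebesgue_on \<Omega>. \<forall>i<N. \<forall>j<N. p \<in> half_open_cell i j \<longrightarrow> g p \<le> B i j"
  shows "(LINT p|lebesgue_on \<Omega>. g p) \<le> (\<Sum>i<N. \<Sum>j<N. B i j * (width i * width j))"
proof -
  have rect: "rectangle x i j = cbox (x i, x j) (x (Suc i), x (Suc j))" for i j
    by (auto simp: rectangle_def cbox_Pair_eq)
  have int: "integrable (lebesgue_on \<Omega>) (\<lambda>p. B i j * indicator (rectangle x i j) p)" for i j
    using integral_indicator_Omega(1)[of "rectangle x i j"] by (simp add: rect)
  have "(LINT p|lebesgue_on \<Omega>. g p) \<le> (LINT p|lebesgue_on \<Omega>. (\<Sum>i<N. \<Sum>j<N. B i j * indicator (rectangle x i j) p))"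
  proof (rule integral_mono_AE[OF g])
    show "integrable (lebesgue_on \<Omega>) (\<lambda>p. \<Sum>i<N. \<Sum>j<N. B i j * indicator (rectangle x i j) p)"
      by (intro Bochner_Integration.integrable_sum int)
    show "AE p in lebesgue_on \<Omega>. g p \<le> (\<Sum>i<N. \<Sum>j<N. B i j * indicator (rectangle x i j) p)"
      using gB AE_space[of "lebesgue_on \<Omega>"]
    proof eventually_elim
      case (elim p)
      then obtain i j where ij: "i < N" "j < N" "p \<in> half_open_cell i j" using half_open_cell_exists[of p] by auto
      have "p \<in> rectangle x i j" using ij half_open_cell_rectangle by blast
      then have "g p \<le> B i j * indicator (rectangle x i j) p"
        using elim ij by simp
      also have "\<dots> \<le> (\<Sum>j<N. B i j * indicator (rectangle x i j) p)"
        by (rule member_le_sum[where f = "\<lambda>j. B i j * indicator (rectangle x i j) p"]) (use ij B in auto)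
      also have "\<dots> \<le> (\<Sum>i<N. \<Sum>j<N. B i j * indicator (rectangle x i j) p)"
        by (rule member_le_sum[where f = "\<lambda>i. \<Sum>j<N. B i j * indicator (rectangle x i j) p"])
          (use ij B in \<open>auto intro!: sum_nonneg\<close>)
      finally show ?case .
    qed
  qed
  also have "\<dots> = (\<Sum>i<N. (LINT p|lebesgue_on \<Omega>. (\<Sum>j<N. B i j * indicator (rectangle x i j) p)))"
    by (intro Bochner_Integration.integral_sum Bochner_Integration.integrable_sum int)
  also have "\<dots> = (\<Sum>i<N. \<Sum>j<N. (LINT p|lebesgue_on \<Omega>. B i j * indicator (rectangle x i j) p))"
    by (intro sum.cong refl Bochner_Integration.integral_sum int)
  also have "\<dots> = (\<Sum>i<N. \<Sum>j<N. B i j * measure lebesgue (rectangle x i j \<inter> \<Omega>))"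
    using integral_indicator_Omega(2)[of "rectangle x _ _"] by (intro sum.cong refl) (simp add: rect)
  also have "\<dots> \<le> (\<Sum>i<N. \<Sum>j<N. B i j * (width i * width j))"
  proof (intro sum_mono mult_left_mono B)
    fix i j assume ij: "i \<in> {..<N}" "j \<in> {..<N}"
    have "measure lebesgue (rectangle x i j \<inter> \<Omega>) \<le> measure lebesgue (rectangle x i j)"
      by (rule measure_mono_fmeasurable) (auto simp: rect)
    also have "\<dots> = width i * width j"
      unfolding rect width_def by (rule measure_box_pair(1)) (use ij x_step[of i] x_step[of j] in auto)
    finally show "measure lebesgue (rectangle x i j \<inter> \<Omega>) \<le> width i * width j" .
  qed
  finally show ?thesis .
qed

lemma box_sum_le_integral:
  assumes g: "integrable (lebesgue_on \<Omega>) g" "\<And>p. 0 \<le> g p"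
    and R: "\<And>i j. i < N \<Longrightarrow> j < N \<Longrightarrow> R i j \<in> sets lebesgue"
      "\<And>i j. i < N \<Longrightarrow> j < N \<Longrightarrow> R i j \<subseteq> half_open_cell i j \<inter> \<Omega>"
    and gB: "\<And>i j p. i < N \<Longrightarrow> j < N \<Longrightarrow> p \<in> R i j \<Longrightarrow> B i j \<le> g p"
  shows "(\<Sum>i<N. \<Sum>j<N. B i j * measure lebesgue (R i j)) \<le> (LINT p|lebesgue_on \<Omega>. g p)"
proof -
  have int: "integrable (lebesgue_on \<Omega>) (\<lambda>p. B i j * indicator (R i j) p)" if "i < N" "j < N" for i j
    using integral_indicator_Omega(1)[OF R(1)[OF that]] by simp
  have "B i j * measure lebesgue (R i j) = (LINT p|lebesgue_on \<Omega>. B i j * indicator (R i j) p)" if "i < N" "j < N" for i j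
  proof -
    have "R i j \<inter> \<Omega> = R i j" using R(2)[OF that] by blast
    then show ?thesis using integral_indicator_Omega(2)[OF R(1)[OF that]] by simp
  qed
  then have "(\<Sum>i<N. \<Sum>j<N. B i j * measure lebesgue (R i j)) =
      (\<Sum>i<N. \<Sum>j<N. (LINT p|lebesgue_on \<Omega>. B i j * indicator (R i j) p))"
    by (intro sum.cong refl) simp
  also have "\<dots> = (\<Sum>i<N. (LINT p|lebesgue_on \<Omega>. (\<Sum>j<N. B i j * indicator (R i j) p)))"
    by (intro sum.cong refl Bochner_Integration.integral_sum[symmetric] int) auto
  also have "\<dots> = (LINT p|lebesgue_on \<Omega>. (\<Sum>i<N. \<Sum>j<N. B i j * indicator (R i j) p))"
    by (intro Bochner_Integration.integral_sum[symmetric] Bochner_Integration.integrable_sum int) auto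
  also have "\<dots> \<le> (LINT p|lebesgue_on \<Omega>. g p)"
  proof (rule Bochner_Integration.integral_mono[OF _ g(1)])
    show "integrable (lebesgue_on \<Omega>) (\<lambda>p. \<Sum>i<N. \<Sum>j<N. B i j * indicator (R i j) p)"
      by (intro Bochner_Integration.integrable_sum int) auto
    fix p assume "p \<in> space (lebesgue_on \<Omega>)"
    then obtain I J where IJ: "I < N" "J < N" "p \<in> half_open_cell I J" using half_open_cell_exists[of p] by auto
    have 0: "B i j * indicator (R i j) p = 0" if "i < N" "j < N" "i \<noteq> I \<or> j \<noteq> J" for i j
    proof -
      have "p \<notin> R i j"
      proof
        assume "p \<in> R i j"
        then have "p \<in> half_open_cell i j" using R(2) that by blast
        then have "i = I" "j = J"
          using IJ that interval_index_unique[of i I "fst p"] interval_index_unique[of j J "snd p"]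
          by (auto simp: half_open_cell_def)
        then show False using that by blast
      qed
      then show ?thesis by simp
    qed
    have "(\<Sum>j<N. B i j * indicator (R i j) p) = 0" if "i < N" "i \<noteq> I" for i
      by (rule sum.neutral) (use 0[OF that(1)] that(2) in blast)
    then have "(\<Sum>i<N. \<Sum>j<N. B i j * indicator (R i j) p) = (\<Sum>i\<in>{I}. \<Sum>j<N. B i j * indicator (R i j) p)"
      by (intro sum.mono_neutral_right) (use IJ in auto)
    also have "\<dots> = (\<Sum>j<N. B I j * indicator (R I j) p)" by simp
    also have "\<dots> = (\<Sum>j\<in>{J}. B I j * indicator (R I j) p)"
      by (rule sum.mono_neutral_right) (use IJ in simp, use IJ in simp, use 0[OF IJ(1)] in blast)
    also have "\<dots> = B I J * indicator (R I J) p"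
      by (subst sum.insert) (simp_all only: finite.emptyI empty_iff not_False_eq_True sum.empty add_0_right)
    also have "\<dots> \<le> g p" using gB[OF IJ(1,2)] g(2) by (auto simp: indicator_def)
    finally show "(\<Sum>i<N. \<Sum>j<N. B i j * indicator (R i j) p) \<le> g p" .
  qed
  finally show ?thesis .
qed

text \<open>At the corner where the modulus of the corner values attains its maximum \<open>M\<close>, the Lipschitz constant
  \<open>2 M\<close> in each coordinate keeps the function above \<open>M/2\<close> within distance \<open>1/8\<close>. This replaces the
  computation of element mass matrices for each of the three shapes.\<close>

lemma cell_form_large_near_corner:
  assumes m: "m \<in> element_shapes"
  shows "\<exists>l k. 0 \<le> l \<and> l \<le> 7 / 8 \<and> 0 \<le> k \<and> k \<le> (7 / 8 :: real) \<and>
    (\<forall>s t. l \<le> s \<and> s \<le> l + 1 / 8 \<and> k \<le> t \<and> t \<le> k + 1 / 8 \<longrightarrow>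
      (a\<^sup>2 + b\<^sup>2 + c\<^sup>2 + d\<^sup>2) / 16 \<le> (cell_form m a b c d s t)\<^sup>2)"
proof -
  define M where "M = max (max \<bar>a\<bar> \<bar>b\<bar>) (max \<bar>c\<bar> \<bar>d\<bar>)"
  have M: "\<bar>a\<bar> \<le> M" "\<bar>b\<bar> \<le> M" "\<bar>c\<bar> \<le> M" "\<bar>d\<bar> \<le> M"
    unfolding M_def by (simp_all add: le_max_iff_disj)
  have M0: "0 \<le> M" using M(1) by simp
  have sq: "a\<^sup>2 + b\<^sup>2 + c\<^sup>2 + d\<^sup>2 \<le> 4 * M\<^sup>2"
    using power_mono[OF M(1) abs_ge_zero, of 2] power_mono[OF M(2) abs_ge_zero, of 2]
      power_mono[OF M(3) abs_ge_zero, of 2] power_mono[OF M(4) abs_ge_zero, of 2] by simp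
  have near: "(a\<^sup>2 + b\<^sup>2 + c\<^sup>2 + d\<^sup>2) / 16 \<le> (cell_form m a b c d s t)\<^sup>2"
    if v: "\<bar>cell_form m a b c d s0 t0\<bar> = M" and r: "0 \<le> s0" "s0 \<le> 1" "0 \<le> s" "s \<le> 1" "0 \<le> t0" "t0 \<le> 1" "0 \<le> t" "t \<le> 1"
      and d: "\<bar>s - s0\<bar> \<le> 1 / 8" "\<bar>t - t0\<bar> \<le> 1 / 8" for s0 t0 s t
  proof -
    have "2 * M * \<bar>s - s0\<bar> \<le> 2 * M * (1 / 8)" "2 * M * \<bar>t - t0\<bar> \<le> 2 * M * (1 / 8)"
      by (rule mult_left_mono; use d M0 in simp)+
    with cell_form_diff[OF m M r] have "M / 2 \<le> \<bar>cell_form m a b c d s t\<bar>" using v by simp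
    from power_mono[OF this, of 2] have "M\<^sup>2 / 4 \<le> (cell_form m a b c d s t)\<^sup>2"
      using M0 by (simp add: power_divide)
    then show ?thesis using sq by simp
  qed
  have "M = \<bar>a\<bar> \<or> M = \<bar>b\<bar> \<or> M = \<bar>c\<bar> \<or> M = \<bar>d\<bar>" unfolding M_def by (auto simp: max_def)
  then consider "M = \<bar>a\<bar>" | "M = \<bar>b\<bar>" | "M = \<bar>c\<bar>" | "M = \<bar>d\<bar>" by blast
  then show ?thesis
  proof cases
    case 1
    show ?thesis by (rule exI[of _ 0], rule exI[of _ 0]) (use near[of 0 0] 1 in \<open>auto simp: cell_form_corners[OF m]\<close>)
  next
    case 2
    show ?thesis by (rule exI[of _ "7/8"], rule exI[of _ 0]) (use near[of 1 0] 2 in \<open>auto simp: cell_form_corners[OF m]\<close>)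
  next
    case 3
    show ?thesis by (rule exI[of _ 0], rule exI[of _ "7/8"]) (use near[of 0 1] 3 in \<open>auto simp: cell_form_corners[OF m]\<close>)
  next
    case 4
    show ?thesis by (rule exI[of _ "7/8"], rule exI[of _ "7/8"]) (use near[of 1 1] 4 in \<open>auto simp: cell_form_corners[OF m]\<close>)
  qed
qed

text \<open>An inverse estimate: nodal values are controlled by the \<open>L\<^sub>2\<close> norm. The constant is \<open>16 * 64\<close>, where \<open>64\<close>
  accounts for the area of the sub-box near a corner.\<close>

lemma corner_squares_le_L2:
  assumes m: "\<And>i j. m i j \<in> element_shapes" and W: "zero_boundary W"
  shows "(\<Sum>i<N. \<Sum>j<N. corner_square_sum W i j * (width i * width j))
    \<le> 1024 * L2_inner (nodal_interpolant m W) (nodal_interpolant m W)"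
proof -
  let ?w = "nodal_interpolant m W"
  define P where "P i j l k \<longleftrightarrow> 0 \<le> l \<and> l \<le> 7 / 8 \<and> 0 \<le> k \<and> k \<le> (7 / 8 :: real) \<and>
    (\<forall>s t. l \<le> s \<and> s \<le> l + 1 / 8 \<and> k \<le> t \<and> t \<le> k + 1 / 8 \<longrightarrow>
      corner_square_sum W i j / 16 \<le> (cell_form (m i j) (W i j) (W (Suc i) j) (W i (Suc j)) (W (Suc i) (Suc j)) s t)\<^sup>2)"
    for i j l k
  have "\<exists>l k. P i j l k" for i j
    unfolding P_def corner_square_sum_def by (rule cell_form_large_near_corner[OF m])
  then obtain l k where "\<forall>i j. P i j (l i j) (k i j)" by metis
  note P = this[rule_format, unfolded P_def]
  have lk: "0 \<le> l i j" "l i j \<le> 7 / 8" "0 \<le> k i j" "k i j \<le> 7 / 8"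
    "\<And>s t. l i j \<le> s \<Longrightarrow> s \<le> l i j + 1 / 8 \<Longrightarrow> k i j \<le> t \<Longrightarrow> t \<le> k i j + 1 / 8 \<Longrightarrow>
      corner_square_sum W i j / 16 \<le> (cell_form (m i j) (W i j) (W (Suc i) j) (W i (Suc j)) (W (Suc i) (Suc j)) s t)\<^sup>2" for i j
    using P[of i j] by blast+
  define R where "R i j = box (x i + width i * l i j, x j + width j * k i j)
     (x i + width i * (l i j + 1 / 8), x j + width j * (k i j + 1 / 8))" for i j
  have Rin: "x i < s \<and> s < x (Suc i) \<and> l \<le> local_coord i s \<and> local_coord i s \<le> l + 1 / 8"
    if "x i + width i * l < s" "s < x i + width i * (l + 1 / 8)" "0 \<le> l" "l \<le> 7 / 8" "i < N" for i s l
  proof -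
    note w = width_pos[OF that(5)]
    have "0 \<le> width i * l" "width i * (l + 1 / 8) \<le> width i * 1" using w that by (auto intro: mult_left_mono)
    moreover have "l \<le> local_coord i s" "local_coord i s \<le> l + 1 / 8"
      using that(1,2) w by (auto simp: local_coord_def pos_le_divide_eq pos_divide_le_eq mult.commute)
    ultimately show ?thesis using that(1,2) by (simp add: x_Suc)
  qed
  have Rp: "(x i < fst p \<and> fst p < x (Suc i) \<and> l i j \<le> local_coord i (fst p) \<and> local_coord i (fst p) \<le> l i j + 1 / 8) \<and>
     (x j < snd p \<and> snd p < x (Suc j) \<and> k i j \<le> local_coord j (snd p) \<and> local_coord j (snd p) \<le> k i j + 1 / 8)"
    if "p \<in> R i j" "i < N" "j < N" for p i j
  proof -
    have b: "x i + width i * l i j < fst p" "fst p < x i + width i * (l i j + 1 / 8)"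
      "x j + width j * k i j < snd p" "snd p < x j + width j * (k i j + 1 / 8)"
      using that(1) unfolding R_def by (cases p; auto simp: mem_box Basis_prod_def ball_Un)+
    from Rin[OF b(1,2) lk(1,2) that(2)] Rin[OF b(3,4) lk(3,4) that(3)] show ?thesis ..
  qed
  have L2w: "?w \<in> L2" by (intro H1_L2 H01_H1 nodal_interpolant_H01(1) m W)
  have "(\<Sum>i<N. \<Sum>j<N. corner_square_sum W i j / 16 * measure lebesgue (R i j)) \<le> (LINT p|lebesgue_on \<Omega>. (?w p)\<^sup>2)"
  proof (rule box_sum_le_integral[OF L2D(2)[OF L2w]])
    show "R i j \<in> sets lebesgue" for i j unfolding R_def by simp
    show "R i j \<subseteq> half_open_cell i j \<inter> \<Omega>" if ij: "i < N" "j < N" for i j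
    proof
      fix p assume "p \<in> R i j"
      note r = Rp[OF this ij]
      have "0 \<le> x i" "x (Suc i) \<le> 1" "0 \<le> x j" "x (Suc j) \<le> 1" using x_range ij by auto
      then show "p \<in> half_open_cell i j \<inter> \<Omega>" using r by (cases p) (auto simp: half_open_cell_def \<Omega>_def)
    qed
    show "corner_square_sum W i j / 16 \<le> (?w p)\<^sup>2" if ij: "i < N" "j < N" and p: "p \<in> R i j" for i j p
    proof -
      note r = Rp[OF p ij]
      have "p \<in> rectangle x i j" using r by (cases p) (auto simp: rectangle_def)
      from nodal_interpolant_on_cell[where m = m, OF m W ij this] show ?thesis
        using r lk(5) by (simp add: cell_value_def)
    qed
  qed simp
  moreover have "(\<Sum>i<N. \<Sum>j<N. corner_square_sum W i j / 16 * measure lebesgue (R i j))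
      = (\<Sum>i<N. \<Sum>j<N. corner_square_sum W i j * (width i * width j) / 1024)"
  proof (intro sum.cong refl)
    fix i j assume "i \<in> {..<N}" "j \<in> {..<N}"
    then have w: "0 < width i" "0 < width j" using width_pos by auto
    have "measure lebesgue (R i j) = width i * (1 / 8) * (width j * (1 / 8))"
      unfolding R_def using w by (subst measure_box_pair(2)) (auto simp: algebra_simps)
    then show "corner_square_sum W i j / 16 * measure lebesgue (R i j) = corner_square_sum W i j * (width i * width j) / 1024"
      by simp
  qed
  ultimately show ?thesis by (simp add: L2_inner_def power2_eq_square sum_divide_distrib[symmetric])
qed

text \<open>In local coordinates the Lipschitz constant is \<open>2 M\<close> in each direction, where the largest modulus \<open>M\<close> of
  the corner values is at most the root of their square sum; the chain rule divides by the width.\<close>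

lemma nodal_interpolant_gradient_bound:
  assumes m: "\<And>i j. m i j \<in> element_shapes" and W: "zero_boundary W" and ij: "i < N" "j < N"
    and p: "p \<in> half_open_cell i j" and G: "strict_gradient (nodal_interpolant m W) p G"
  shows "G \<bullet> G \<le> 4 * corner_square_sum W i j * (1 / (width i)\<^sup>2 + 1 / (width j)\<^sup>2)"
proof -
  let ?w = "nodal_interpolant m W" and ?M = "sqrt (corner_square_sum W i j)"
  note w = width_pos[OF ij(1)] width_pos[OF ij(2)]
  obtain s t where st: "p = (s, t)" by (cases p)
  have s: "x i \<le> s" "s < x (Suc i)" "x j \<le> t" "t < x (Suc j)" using p by (auto simp: st half_open_cell_def)
  have cell: "?w q = cell_form (m i j) (W i j) (W (Suc i) j) (W i (Suc j)) (W (Suc i) (Suc j))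
      (local_coord i (fst q)) (local_coord j (snd q))" if "q \<in> rectangle x i j" for q
    using nodal_interpolant_on_cell[where m = m, OF m W ij that] by (simp add: cell_value_def)
  have f: "\<bar>fst G\<bar> \<le> 2 * ?M / width i"
  proof -
    have "\<bar>(1, 0) \<bullet> G\<bar> \<le> 2 * ?M / width i"
    proof (rule strict_gradient_bound[OF G])
      show "0 < x (Suc i) - s" using s by simp
      fix h assume h: "0 < h" "h < x (Suc i) - s"
      have r: "(s + h, t) \<in> rectangle x i j" "(s, t) \<in> rectangle x i j" using h s by (auto simp: rectangle_def)
      have "\<bar>?w (s + h, t) - ?w (s, t)\<bar> \<le> 2 * ?M * \<bar>local_coord i (s + h) - local_coord i s\<bar>"
        unfolding cell[OF r(1)] cell[OF r(2)] fst_conv snd_conv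
        by (rule cell_form_lipschitz1[OF m corner_abs_le]) (use s h ij local_coord_range in auto)
      also have "local_coord i (s + h) - local_coord i s = h / width i"
        by (simp add: local_coord_def diff_divide_distrib add_divide_distrib)
      finally show "\<bar>?w (p + h *\<^sub>R (1, 0)) - ?w p\<bar> \<le> 2 * ?M / width i * h"
        using h w by (simp add: st)
    qed simp
    then show ?thesis by (simp add: inner_prod_def)
  qed
  have g: "\<bar>snd G\<bar> \<le> 2 * ?M / width j"
  proof -
    have "\<bar>(0, 1) \<bullet> G\<bar> \<le> 2 * ?M / width j"
    proof (rule strict_gradient_bound[OF G])
      show "0 < x (Suc j) - t" using s by simp
      fix h assume h: "0 < h" "h < x (Suc j) - t"
      have r: "(s, t + h) \<in> rectangle x i j" "(s, t) \<in> rectangle x i j" using h s by (auto simp: rectangle_def)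
      have "\<bar>?w (s, t + h) - ?w (s, t)\<bar> \<le> 2 * ?M * \<bar>local_coord j (t + h) - local_coord j t\<bar>"
        unfolding cell[OF r(1)] cell[OF r(2)] fst_conv snd_conv
        by (rule cell_form_lipschitz2[OF m corner_abs_le]) (use s h ij local_coord_range in auto)
      also have "local_coord j (t + h) - local_coord j t = h / width j"
        by (simp add: local_coord_def diff_divide_distrib add_divide_distrib)
      finally show "\<bar>?w (p + h *\<^sub>R (0, 1)) - ?w p\<bar> \<le> 2 * ?M / width j * h"
        using h w by (simp add: st)
    qed simp
    then show ?thesis by (simp add: inner_prod_def)
  qed
  have "(fst G)\<^sup>2 \<le> (2 * ?M / width i)\<^sup>2" "(snd G)\<^sup>2 \<le> (2 * ?M / width j)\<^sup>2"
    using power_mono[OF f abs_ge_zero, of 2] power_mono[OF g abs_ge_zero, of 2] by simp_all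
  then show ?thesis
    using corner_square_sum_nonneg[of W i j]
    by (simp add: inner_prod_def power2_eq_square[symmetric] power_mult_distrib power_divide distrib_left)
qed

end

section \<open>Truncation of nodal values on a two-scale mesh\<close>

locale two_scale_mesh = mesh +
  fixes k l :: nat and h H :: real
  assumes kl: "k < l" "l \<le> N" and hH: "0 < h" "h \<le> H"
    and coarse: "\<And>i. k \<le> i \<Longrightarrow> i < l \<Longrightarrow> width i = H"
    and fine: "\<And>i. i < N \<Longrightarrow> \<not> (k \<le> i \<and> i < l) \<Longrightarrow> width i = h"
begin

definition core :: "(real \<times> real) set" where
  "core = {x k<..<x l} \<times> {x k<..<x l}"

text \<open>The nodal values in the closure of the core are kept, including those on its boundary. The
  interpolant then agrees with the original one on the core and extends by one fine cell beyond it.\<close>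

definition truncation :: "(nat \<Rightarrow> nat \<Rightarrow> real) \<Rightarrow> nat \<Rightarrow> nat \<Rightarrow> real" where
  "truncation W i j = (if k \<le> i \<and> i \<le> l \<and> k \<le> j \<and> j \<le> l then W i j else 0)"

definition core_square_sum :: "(nat \<Rightarrow> nat \<Rightarrow> real) \<Rightarrow> real" where
  "core_square_sum W = (\<Sum>i\<le>N. \<Sum>j\<le>N. (truncation W i j)\<^sup>2)"

lemma zero_boundary_truncation: "zero_boundary W \<Longrightarrow> zero_boundary (truncation W)"
  by (auto simp: zero_boundary_def truncation_def)

lemma width_bounds: "i < N \<Longrightarrow> h \<le> width i" "i < N \<Longrightarrow> width i \<le> H"
  using coarse[of i] fine[of i] hH by (cases "k \<le> i \<and> i < l"; simp)+

text \<open>Each node of the core is a corner of a coarse cell, whose area is \<open>H\<^sup>2\<close>.\<close>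

lemma core_square_sum_le_L2:
  assumes m: "\<And>i j. m i j \<in> element_shapes" and W: "zero_boundary W"
  shows "H\<^sup>2 * core_square_sum W \<le> 1024 * L2_inner (nodal_interpolant m W) (nodal_interpolant m W)"
proof -
  let ?f = "\<lambda>i j. (truncation W i j)\<^sup>2"
  let ?c = "\<lambda>i. k \<le> i \<and> i < l"
  have "core_square_sum W \<le> (\<Sum>i<N. if ?c i then (\<Sum>j\<le>N. ?f i j) + (\<Sum>j\<le>N. ?f (Suc i) j) else 0)"
    unfolding core_square_sum_def
    by (rule sum_le_cell_sum[OF _ kl]) (auto intro!: sum_nonneg simp: truncation_def)
  also have "\<dots> \<le> (\<Sum>i<N. if ?c i then \<Sum>j<N. if ?c j then (?f i j + ?f (Suc i) j) + (?f i (Suc j) + ?f (Suc i) (Suc j)) else 0 else 0)"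
  proof (intro sum_mono)
    fix i
    have "(\<Sum>j\<le>N. ?f i j) + (\<Sum>j\<le>N. ?f (Suc i) j) = (\<Sum>j\<le>N. ?f i j + ?f (Suc i) j)"
      by (simp add: sum.distrib)
    also have "\<dots> \<le> (\<Sum>j<N. if ?c j then (?f i j + ?f (Suc i) j) + (?f i (Suc j) + ?f (Suc i) (Suc j)) else 0)"
      by (rule sum_le_cell_sum[OF _ kl]) (auto simp: truncation_def)
    finally show "(if ?c i then (\<Sum>j\<le>N. ?f i j) + (\<Sum>j\<le>N. ?f (Suc i) j) else 0)
      \<le> (if ?c i then \<Sum>j<N. if ?c j then (?f i j + ?f (Suc i) j) + (?f i (Suc j) + ?f (Suc i) (Suc j)) else 0 else 0)"
      by simp
  qed
  finally have "H\<^sup>2 * core_square_sum W \<le> H\<^sup>2 * (\<Sum>i<N. if ?c i then \<Sum>j<N. if ?c j then (?f i j + ?f (Suc i) j) + (?f i (Suc j) + ?f (Suc i) (Suc j)) else 0 else 0)"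
    by (rule mult_left_mono) simp
  also have "\<dots> = (\<Sum>i<N. \<Sum>j<N. H\<^sup>2 * (if ?c i \<and> ?c j then (?f i j + ?f (Suc i) j) + (?f i (Suc j) + ?f (Suc i) (Suc j)) else 0))"
    unfolding sum_distrib_left[of "H\<^sup>2"] by (intro sum.cong refl) (auto simp: sum_distrib_left)
  also have "\<dots> \<le> (\<Sum>i<N. \<Sum>j<N. corner_square_sum W i j * (width i * width j))"
  proof (intro sum_mono)
    fix i j assume ij: "i \<in> {..<N}" "j \<in> {..<N}"
    show "H\<^sup>2 * (if ?c i \<and> ?c j then (?f i j + ?f (Suc i) j) + (?f i (Suc j) + ?f (Suc i) (Suc j)) else 0)
      \<le> corner_square_sum W i j * (width i * width j)"
    proof (cases "?c i \<and> ?c j")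
      case True
      then show ?thesis
        by (simp add: coarse truncation_def corner_square_sum_def power2_eq_square[of H] algebra_simps)
    next
      case False
      have "0 \<le> corner_square_sum W i j * (width i * width j)"
        using ij corner_square_sum_nonneg width_pos[of i] width_pos[of j] by (intro mult_nonneg_nonneg) auto
      then show ?thesis using False by auto
    qed
  qed
  also have "\<dots> \<le> 1024 * L2_inner (nodal_interpolant m W) (nodal_interpolant m W)"
    by (rule corner_squares_le_L2[where m = m, OF m W])
  finally show ?thesis .
qed

text \<open>On a cell with widths \<open>w\<^sub>1\<close> and \<open>w\<^sub>2\<close> the square of the gradient integrates to at most a multiple of
  \<open>w\<^sub>1/w\<^sub>2 + w\<^sub>2/w\<^sub>1\<close> times the corner values squared, and the aspect ratio is at most \<open>H/h\<close>.\<close>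

lemma grad_truncation_le:
  assumes m: "\<And>i j. m i j \<in> element_shapes" and W: "zero_boundary W"
  defines "w \<equiv> nodal_interpolant m (truncation W)"
  shows "grad_inner w w \<le> 32 * (H / h) * core_square_sum W"
proof -
  note T = zero_boundary_truncation[OF W]
  let ?q = "corner_square_sum (truncation W)"
  have H1: "w \<in> H1" unfolding w_def by (intro H01_H1 nodal_interpolant_H01(1) m T)
  note g = weak_gradient_L2[OF weak_gradient_wgrad[OF H1]]
  have "grad_inner w w \<le> (\<Sum>i<N. \<Sum>j<N. 4 * ?q i j * (1 / (width i)\<^sup>2 + 1 / (width j)\<^sup>2) * (width i * width j))"
    unfolding grad_inner_def
  proof (rule integral_le_cell_sum)
    show "integrable (lebesgue_on \<Omega>) (\<lambda>p. wgrad w p \<bullet> wgrad w p)"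
      unfolding inner_prod_def using integrable_L2_mult g by simp
    show "0 \<le> 4 * ?q i j * (1 / (width i)\<^sup>2 + 1 / (width j)\<^sup>2)" for i j
      using corner_square_sum_nonneg by simp
    have "AE p in lebesgue_on \<Omega>. p \<notin> skeleton \<and> strict_gradient w p (wgrad w p)"
      unfolding w_def by (rule nodal_interpolant_H01(2)[where m = m, OF m T])
    then show "AE p in lebesgue_on \<Omega>. \<forall>i<N. \<forall>j<N. p \<in> half_open_cell i j \<longrightarrow>
        wgrad w p \<bullet> wgrad w p \<le> 4 * ?q i j * (1 / (width i)\<^sup>2 + 1 / (width j)\<^sup>2)"
    proof eventually_elim
      case (elim p)
      then show ?case
        using nodal_interpolant_gradient_bound[where m = m, OF m T] unfolding w_def by blast
    qed
  qed
  also have "\<dots> \<le> (\<Sum>i<N. \<Sum>j<N. 8 * (H / h) * ?q i j)"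
  proof (intro sum_mono)
    fix i j assume ij: "i \<in> {..<N}" "j \<in> {..<N}"
    then have w: "0 < width i" "0 < width j" using width_pos by auto
    have r: "width j / width i \<le> H / h" "width i / width j \<le> H / h"
      using ij width_bounds hH w by (auto intro!: frac_le)
    have "(1 / (width i)\<^sup>2 + 1 / (width j)\<^sup>2) * (width i * width j) = width j / width i + width i / width j"
      using w by (simp add: field_simps power2_eq_square)
    then have "4 * ?q i j * (1 / (width i)\<^sup>2 + 1 / (width j)\<^sup>2) * (width i * width j) = 4 * ?q i j * (width j / width i + width i / width j)"
      by (simp add: mult.assoc)
    also have "\<dots> \<le> 4 * ?q i j * (H / h + H / h)"
      by (intro mult_left_mono add_mono r) (use corner_square_sum_nonneg in simp)
    finally show "4 * ?q i j * (1 / (width i)\<^sup>2 + 1 / (width j)\<^sup>2) * (width i * width j) \<le> 8 * (H / h) * ?q i j"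
      by (simp add: algebra_simps)
  qed
  also have "\<dots> = 8 * (H / h) * (\<Sum>i<N. \<Sum>j<N. ?q i j)" by (simp add: sum_distrib_left)
  also have "\<dots> \<le> 8 * (H / h) * (4 * core_square_sum W)"
    unfolding core_square_sum_def by (intro mult_left_mono sum_corner_square_sum_le) (use hH in simp)
  finally show ?thesis by simp
qed

text \<open>A cell that is not coarse in both directions has area at most \<open>h H\<close>.\<close>

lemma layer_truncation_le:
  assumes m: "\<And>i j. m i j \<in> element_shapes" and W: "zero_boundary W"
  defines "w \<equiv> \<lambda>p. indicator (\<Omega> - core) p * nodal_interpolant m (truncation W) p"
  shows "L2_inner w w \<le> 100 * (h * H) * core_square_sum W"
proof -
  note T = zero_boundary_truncation[OF W]
  let ?q = "corner_square_sum (truncation W)" and ?c = "\<lambda>i. k \<le> i \<and> i < l"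
  have v: "nodal_interpolant m (truncation W) \<in> L2" by (intro H1_L2 H01_H1 nodal_interpolant_H01(1) m T)
  have core: "core = box (x k, x k) (x l, x l)" by (auto simp: core_def mem_box Basis_prod_def ball_Un)
  have wL2: "w \<in> L2"
    unfolding w_def by (intro L2_indicator_mult sets.Diff Omega_lebesgue v) (simp add: core)
  have "L2_inner w w \<le> (\<Sum>i<N. \<Sum>j<N. (if ?c i \<and> ?c j then 0 else 25 * ?q i j) * (width i * width j))"
    unfolding L2_inner_def
  proof (rule integral_le_cell_sum)
    show "integrable (lebesgue_on \<Omega>) (\<lambda>p. w p * w p)" by (rule integrable_L2_mult[OF wL2 wL2])
    show "0 \<le> (if ?c i \<and> ?c j then 0 else 25 * ?q i j)" for i j
      using corner_square_sum_nonneg by simp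
    have "AE p in lebesgue_on \<Omega>. p \<notin> skeleton \<and> strict_gradient (nodal_interpolant m (truncation W)) p (wgrad (nodal_interpolant m (truncation W)) p)"
      by (rule nodal_interpolant_H01(2)[where m = m, OF m T])
    then show "AE p in lebesgue_on \<Omega>. \<forall>i<N. \<forall>j<N. p \<in> half_open_cell i j \<longrightarrow>
        w p * w p \<le> (if ?c i \<and> ?c j then 0 else 25 * ?q i j)"
    proof eventually_elim
      case (elim p)
      show ?case
      proof (intro allI impI)
        fix i j assume ij: "i < N" "j < N" and p: "p \<in> half_open_cell i j"
        then have pr: "p \<in> rectangle x i j" using half_open_cell_rectangle by blast
        show "w p * w p \<le> (if ?c i \<and> ?c j then 0 else 25 * ?q i j)"
        proof (cases "?c i \<and> ?c j")
          case True
          \<comment> \<open>The half-open cell contains points on the boundary of the open core; they lie on the skeleton.\<close>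
          have "fst p \<noteq> x i" "snd p \<noteq> x j" using elim ij unfolding skeleton_def by auto
          moreover have "x k \<le> x i" "x (Suc i) \<le> x l" "x k \<le> x j" "x (Suc j) \<le> x l"
            using True ij kl x_mono by auto
          ultimately have "p \<in> core" using p by (cases p) (auto simp: half_open_cell_def core_def)
          then show ?thesis using True by (simp add: w_def)
        next
          case False
          have "\<bar>nodal_interpolant m (truncation W) p\<bar> \<le> 5 * sqrt (?q i j)"
            unfolding nodal_interpolant_on_cell[where m = m, OF m T ij pr] cell_value_def
            by (rule cell_form_bound[OF m corner_abs_le])
              (use pr ij local_coord_range in \<open>auto simp: rectangle_def\<close>)
          from power_mono[OF this, of 2] have "(nodal_interpolant m (truncation W) p)\<^sup>2 \<le> 25 * ?q i j"
            using corner_square_sum_nonneg by (simp add: power_mult_distrib)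
          then have "w p * w p \<le> 25 * ?q i j"
            using corner_square_sum_nonneg by (auto simp: w_def indicator_def power2_eq_square)
          then show ?thesis using False by auto
        qed
      qed
    qed
  qed
  also have "\<dots> \<le> (\<Sum>i<N. \<Sum>j<N. 25 * (h * H) * ?q i j)"
  proof (intro sum_mono)
    fix i j assume ij: "i \<in> {..<N}" "j \<in> {..<N}"
    then have w: "0 < width i" "0 < width j" using width_pos by auto
    show "(if ?c i \<and> ?c j then 0 else 25 * ?q i j) * (width i * width j) \<le> 25 * (h * H) * ?q i j"
    proof (cases "?c i \<and> ?c j")
      case True
      then show ?thesis using hH corner_square_sum_nonneg by auto
    next
      case False
      have "width i * width j \<le> h * H"
      proof (cases "?c i")
        case True
        then have "width j = h" using False fine ij by auto
        then show ?thesis using width_bounds(2)[of i] ij hH by (simp add: mult.commute)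
      next
        case False
        then have "width i = h" using fine ij by auto
        then show ?thesis using width_bounds(2)[of j] ij hH by simp
      qed
      then have "25 * ?q i j * (width i * width j) \<le> 25 * ?q i j * (h * H)"
        by (intro mult_left_mono) (use corner_square_sum_nonneg in simp_all)
      then show ?thesis using False by (auto simp: mult_ac)
    qed
  qed
  also have "\<dots> = 25 * (h * H) * (\<Sum>i<N. \<Sum>j<N. ?q i j)" by (simp add: sum_distrib_left)
  also have "\<dots> \<le> 25 * (h * H) * (4 * core_square_sum W)"
    unfolding core_square_sum_def by (intro mult_left_mono sum_corner_square_sum_le) (use hH in simp)
  finally show ?thesis by simp
qed

lemma core_square_sum_bound:
  assumes m: "\<And>i j. m i j \<in> element_shapes" and W: "zero_boundary W"
  shows "core_square_sum W \<le> 1024 / H\<^sup>2 * L2_inner (nodal_interpolant m W) (nodal_interpolant m W)"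
  using core_square_sum_le_L2[where m = m, OF m W] hH by (simp add: field_simps)

lemma grad_truncation_bound:
  assumes m: "\<And>i j. m i j \<in> element_shapes" and W: "zero_boundary W"
  defines "w \<equiv> nodal_interpolant m (truncation W)" and "v \<equiv> nodal_interpolant m W"
  shows "grad_inner w w \<le> 32768 / (h * H) * L2_inner v v"
proof -
  have "grad_inner w w \<le> 32 * (H / h) * core_square_sum W"
    unfolding w_def by (rule grad_truncation_le[where m = m, OF m W])
  also have "\<dots> \<le> 32 * (H / h) * (1024 / H\<^sup>2 * L2_inner v v)"
    unfolding v_def by (intro mult_left_mono core_square_sum_bound m W) (use hH in simp)
  also have "\<dots> = 32768 / (h * H) * L2_inner v v" using hH by (simp add: field_simps power2_eq_square)
  finally show ?thesis .
qed

lemma layer_truncation_bound: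
  assumes m: "\<And>i j. m i j \<in> element_shapes" and W: "zero_boundary W"
  defines "w \<equiv> \<lambda>p. indicator (\<Omega> - core) p * nodal_interpolant m (truncation W) p" and "v \<equiv> nodal_interpolant m W"
  shows "L2_inner w w \<le> 102400 * (h / H) * L2_inner v v"
proof -
  have "L2_inner w w \<le> 100 * (h * H) * core_square_sum W"
    unfolding w_def by (rule layer_truncation_le[where m = m, OF m W])
  also have "\<dots> \<le> 100 * (h * H) * (1024 / H\<^sup>2 * L2_inner v v)"
    unfolding v_def by (intro mult_left_mono core_square_sum_bound m W) (use hH in simp)
  also have "\<dots> = 102400 * (h / H) * L2_inner v v" using hH by (simp add: field_simps power2_eq_square)
  finally show ?thesis .
qed

lemma truncation_on_core:
  assumes m: "\<And>i j. m i j \<in> element_shapes" and W: "zero_boundary W" and p: "p \<in> core"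
  shows "nodal_interpolant m (truncation W) p = nodal_interpolant m W p"
proof -
  have kl': "0 \<le> x k" "x l \<le> 1" using x_range kl by auto
  have idx: "\<exists>i. k \<le> i \<and> i < l \<and> x i \<le> s \<and> s < x (Suc i)" if s: "x k < s" "s < x l" for s
  proof -
    obtain i where i: "i < N" "x i \<le> s" "s < x (Suc i)" using interval_index[of s] s kl' by auto
    have "k \<le> i" using i s x_mono[of "Suc i" k] kl by force
    moreover have "i < l" using i s x_mono[of l i] kl by force
    ultimately show ?thesis using i by blast
  qed
  have "x k < fst p" "fst p < x l" "x k < snd p" "snd p < x l" using p by (auto simp: core_def)
  then obtain i j where ij: "k \<le> i" "i < l" "x i \<le> fst p" "fst p < x (Suc i)" "k \<le> j" "j < l" "x j \<le> snd p" "snd p < x (Suc j)"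
    using idx[of "fst p"] idx[of "snd p"] by blast
  then have r: "p \<in> rectangle x i j" by (cases p) (auto simp: rectangle_def)
  have N: "i < N" "j < N" using ij kl by auto
  show ?thesis
    unfolding nodal_interpolant_on_cell[where m = m, OF m W N r]
      nodal_interpolant_on_cell[where m = m, OF m zero_boundary_truncation[OF W] N r]
    using ij by (simp add: cell_value_def truncation_def)
qed

end

section \<open>Energy estimates and the Shishkin mesh\<close>

definition energy :: "real \<Rightarrow> real \<Rightarrow> (real \<times> real \<Rightarrow> real) \<Rightarrow> (real \<times> real \<Rightarrow> real) \<Rightarrow> real" where
  "energy \<epsilon> c v w = \<epsilon> * grad_inner v w + c * L2_inner v w"

lemma energy_diff_left:
  assumes "u \<in> H1" "v \<in> H1" "w \<in> H1"
  shows "energy \<epsilon> c (\<lambda>p. u p - v p) w = energy \<epsilon> c u w - energy \<epsilon> c v w"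
  using assms by (simp add: energy_def grad_inner_diff_left L2_inner_diff_left H1_L2 algebra_simps)

text \<open>Expanding the squares of \<open>u - v\<close> and \<open>u + v\<close>; the latter is written as \<open>u - (0 - v)\<close>.\<close>

lemma grad_inner_young:
  assumes "u \<in> H1" "v \<in> H1"
  shows "2 * grad_inner u v \<le> grad_inner u u + grad_inner v v"
    and "grad_inner (\<lambda>p. u p - v p) (\<lambda>p. u p - v p) \<le> 2 * grad_inner u u + 2 * grad_inner v v"
proof -
  have e: "grad_inner (\<lambda>p. u p - w p) (\<lambda>p. u p - w p) = grad_inner u u - 2 * grad_inner u w + grad_inner w w"
    if "w \<in> H1" for w
    using grad_inner_diff_left[OF assms(1) that H1_diff[OF assms(1) that]]
      grad_inner_diff_left[OF assms(1) that assms(1)] grad_inner_diff_left[OF assms(1) that that]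
      grad_inner_commute[of u "\<lambda>p. u p - w p"] grad_inner_commute[of w "\<lambda>p. u p - w p"] grad_inner_commute[of w u]
    by simp
  show Y: "2 * grad_inner u v \<le> grad_inner u u + grad_inner v v"
    using grad_inner_nonneg[of "\<lambda>p. u p - v p"] e[OF assms(2)] by simp
  have z: "(\<lambda>p. 0) \<in> H1" using H1_diff[OF assms(1) assms(1)] by simp
  have neg: "(\<lambda>p. 0 - v p) \<in> H1" by (rule H1_diff[OF z assms(2)])
  have gz: "grad_inner (\<lambda>p. 0) w = 0" if "w \<in> H1" for w
    using grad_inner_diff_left[OF assms(1) assms(1) that] by simp
  have n: "grad_inner (\<lambda>p. 0 - v p) w = - grad_inner v w" if "w \<in> H1" for w
    using grad_inner_diff_left[OF z assms(2) that] gz[OF that] by simp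
  have "grad_inner u (\<lambda>p. 0 - v p) = - grad_inner u v"
    using n[OF assms(1)] grad_inner_commute by metis
  moreover have "grad_inner (\<lambda>p. 0 - v p) (\<lambda>p. 0 - v p) = grad_inner v v"
    using n[OF neg] n[OF assms(2)] grad_inner_commute[of v "\<lambda>p. 0 - v p"] by simp
  ultimately have "- 2 * grad_inner u v \<le> grad_inner u u + grad_inner v v"
    using grad_inner_nonneg[of "\<lambda>p. u p - (0 - v p)"] e[OF neg] by simp
  then show "grad_inner (\<lambda>p. u p - v p) (\<lambda>p. u p - v p) \<le> 2 * grad_inner u u + 2 * grad_inner v v"
    using e[OF assms(2)] by simp
qed

lemma L2_inner_young:
  assumes "u \<in> L2" "v \<in> L2"
  shows "2 * L2_inner u v \<le> L2_inner u u + L2_inner v v"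
    and "L2_inner (\<lambda>p. u p - v p) (\<lambda>p. u p - v p) \<le> 2 * L2_inner u u + 2 * L2_inner v v"
proof -
  have young: "2 * (a * b) \<le> a * a + b * b" "(a - b) * (a - b) \<le> 2 * (a * a) + 2 * (b * b)" for a b :: real
    using zero_le_square[of "a - b"] zero_le_square[of "a + b"] by (simp_all add: algebra_simps)
  note i = integrable_L2_mult[OF assms(1,1)] integrable_L2_mult[OF assms(1,2)] integrable_L2_mult[OF assms(2,2)]
  have "(LINT p|lebesgue_on \<Omega>. 2 * (u p * v p)) \<le> (LINT p|lebesgue_on \<Omega>. u p * u p + v p * v p)"
    by (intro Bochner_Integration.integral_mono Bochner_Integration.integrable_add integrable_mult_right i young)
  then show "2 * L2_inner u v \<le> L2_inner u u + L2_inner v v" using i by (simp add: L2_inner_def)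
  have "(LINT p|lebesgue_on \<Omega>. (u p - v p) * (u p - v p)) \<le> (LINT p|lebesgue_on \<Omega>. 2 * (u p * u p) + 2 * (v p * v p))"
    by (intro Bochner_Integration.integral_mono Bochner_Integration.integrable_add integrable_mult_right i
        integrable_L2_mult L2_diff assms young)
  then show "L2_inner (\<lambda>p. u p - v p) (\<lambda>p. u p - v p) \<le> 2 * L2_inner u u + 2 * L2_inner v v"
    using i by (simp add: L2_inner_def)
qed

lemma energy_young:
  assumes "u \<in> H1" "v \<in> H1" "0 \<le> \<epsilon>" "0 \<le> c"
  shows "2 * energy \<epsilon> c u v \<le> energy \<epsilon> c u u + energy \<epsilon> c v v"
proof -
  have "\<epsilon> * (2 * grad_inner u v) \<le> \<epsilon> * (grad_inner u u + grad_inner v v)"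
    "c * (2 * L2_inner u v) \<le> c * (L2_inner u u + L2_inner v v)"
    using assms grad_inner_young(1) L2_inner_young(1) H1_L2 by (auto intro!: mult_left_mono)
  then show ?thesis by (simp add: energy_def algebra_simps)
qed

lemma energy_quasi_best:
  assumes "e \<in> H1" "\<xi> \<in> H1" "0 \<le> \<epsilon>" "0 \<le> c" and "energy \<epsilon> c \<xi> \<xi> = energy \<epsilon> c e \<xi>"
  shows "energy \<epsilon> c \<xi> \<xi> \<le> energy \<epsilon> c e e"
  using energy_young[OF assms(1-4)] assms(5) by simp

text \<open>The energy of \<open>\<xi>1\<close> equals its energy product with \<open>e - \<xi>0\<close>. Since \<open>\<xi>1\<close> vanishes off \<open>A\<close>, the
  \<open>L\<^sub>2\<close> part of that product sees \<open>e - \<xi>0\<close> only on \<open>A\<close>, and Young's inequality absorbs \<open>\<xi>1\<close>.\<close>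

lemma energy_localised:
  assumes e: "e \<in> H1" and \<xi>: "\<xi> \<in> H1" and \<xi>0: "\<xi>0 \<in> H1" and pos: "0 \<le> \<epsilon>" "0 \<le> c"
    and A: "A \<in> sets lebesgue" and core: "\<And>p. p \<in> \<Omega> \<Longrightarrow> p \<notin> A \<Longrightarrow> \<xi> p = \<xi>0 p"
  defines "\<xi>1 \<equiv> \<lambda>p. \<xi> p - \<xi>0 p"
  assumes orth: "energy \<epsilon> c \<xi> \<xi>1 = energy \<epsilon> c e \<xi>1"
  shows "\<epsilon> * grad_inner \<xi>1 \<xi>1 + c * L2_inner \<xi>1 \<xi>1 \<le>
    \<epsilon> * (2 * grad_inner e e + 2 * grad_inner \<xi>0 \<xi>0) +
    c * (2 * L2_inner (\<lambda>p. indicator A p * e p) (\<lambda>p. indicator A p * e p)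
       + 2 * L2_inner (\<lambda>p. indicator A p * \<xi>0 p) (\<lambda>p. indicator A p * \<xi>0 p))"
proof -
  have \<xi>1: "\<xi>1 \<in> H1" unfolding \<xi>1_def by (rule H1_diff[OF \<xi> \<xi>0])
  let ?\<chi> = "\<lambda>p. e p - \<xi>0 p"
  have \<chi>: "?\<chi> \<in> H1" by (rule H1_diff[OF e \<xi>0])
  note ind = L2_indicator_mult[OF A]
  have "energy \<epsilon> c \<xi>1 \<xi>1 = energy \<epsilon> c \<xi> \<xi>1 - energy \<epsilon> c \<xi>0 \<xi>1"
    using energy_diff_left[OF \<xi> \<xi>0 \<xi>1] by (simp add: \<xi>1_def)
  also have "\<dots> = energy \<epsilon> c ?\<chi> \<xi>1"
    using energy_diff_left[OF e \<xi>0 \<xi>1] orth by simp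
  also have "L2_inner ?\<chi> \<xi>1 = L2_inner (\<lambda>p. indicator A p * ?\<chi> p) \<xi>1"
    by (rule L2_inner_cong) (use core in \<open>auto simp: \<xi>1_def indicator_def\<close>)
  then have "energy \<epsilon> c ?\<chi> \<xi>1 = \<epsilon> * grad_inner ?\<chi> \<xi>1 + c * L2_inner (\<lambda>p. indicator A p * ?\<chi> p) \<xi>1"
    by (simp add: energy_def)
  finally have 1: "energy \<epsilon> c \<xi>1 \<xi>1 = \<epsilon> * grad_inner ?\<chi> \<xi>1 + c * L2_inner (\<lambda>p. indicator A p * ?\<chi> p) \<xi>1" .
  have 2: "\<epsilon> * (2 * grad_inner ?\<chi> \<xi>1) \<le> \<epsilon> * (grad_inner ?\<chi> ?\<chi> + grad_inner \<xi>1 \<xi>1)"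
    by (intro mult_left_mono grad_inner_young(1) \<chi> \<xi>1 pos)
  have 3: "c * (2 * L2_inner (\<lambda>p. indicator A p * ?\<chi> p) \<xi>1) \<le>
      c * (L2_inner (\<lambda>p. indicator A p * ?\<chi> p) (\<lambda>p. indicator A p * ?\<chi> p) + L2_inner \<xi>1 \<xi>1)"
    by (intro mult_left_mono L2_inner_young(1) ind H1_L2 \<chi> \<xi>1 pos)
  have 4: "\<epsilon> * grad_inner ?\<chi> ?\<chi> \<le> \<epsilon> * (2 * grad_inner e e + 2 * grad_inner \<xi>0 \<xi>0)"
    by (intro mult_left_mono grad_inner_young(2) e \<xi>0 pos)
  have "L2_inner (\<lambda>p. indicator A p * ?\<chi> p) (\<lambda>p. indicator A p * ?\<chi> p)
      = L2_inner (\<lambda>p. indicator A p * e p - indicator A p * \<xi>0 p) (\<lambda>p. indicator A p * e p - indicator A p * \<xi>0 p)"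
    by (simp add: right_diff_distrib)
  also have "\<dots> \<le> 2 * L2_inner (\<lambda>p. indicator A p * e p) (\<lambda>p. indicator A p * e p)
       + 2 * L2_inner (\<lambda>p. indicator A p * \<xi>0 p) (\<lambda>p. indicator A p * \<xi>0 p)"
    by (intro L2_inner_young(2) ind H1_L2 e \<xi>0)
  finally have 5: "c * L2_inner (\<lambda>p. indicator A p * ?\<chi> p) (\<lambda>p. indicator A p * ?\<chi> p) \<le>
    c * (2 * L2_inner (\<lambda>p. indicator A p * e p) (\<lambda>p. indicator A p * e p)
       + 2 * L2_inner (\<lambda>p. indicator A p * \<xi>0 p) (\<lambda>p. indicator A p * \<xi>0 p))"
    by (rule mult_left_mono[OF _ pos(2)])
  have E: "energy \<epsilon> c \<xi>1 \<xi>1 = \<epsilon> * grad_inner \<xi>1 \<xi>1 + c * L2_inner \<xi>1 \<xi>1" by (simp add: energy_def)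
  show ?thesis
    using 1 2 3 4 5 unfolding E by (simp only: distrib_left)
qed

text \<open>The cells with indices from \<open>N/4\<close> up to \<open>3N/4\<close> are the coarse ones. The condition \<open>\<lambda> \<le> 1/4\<close> is
  what makes \<open>h \<le> H\<close>.\<close>

lemma shishkin_two_scale_mesh:
  assumes N: "N \<in> mesh_sizes" and lam: "0 < lam" "lam \<le> 1 / 4"
  shows "two_scale_mesh (shishkin_node lam N) N (N div 4) (3 * (N div 4)) (4 * lam / N) (2 * (1 - 2 * lam) / N)"
    and "shishkin_node lam N (N div 4) = lam" "shishkin_node lam N (3 * (N div 4)) = 1 - lam"
proof -
  obtain K where K: "N = 4 * K" "0 < K" using N by (auto simp: mesh_sizes_def elim!: dvdE)
  define h H where "h = 4 * lam / N" and "H = 2 * (1 - 2 * lam) / N"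
  let ?x = "shishkin_node lam N"
  have Kh: "real K * h = lam" and KH: "real K * H = 1 / 2 - lam" using K by (auto simp: h_def H_def field_simps)
  have n1: "?x i = real i * h" if "i \<le> K" for i
    using that K by (simp add: shishkin_node_def Let_def h_def)
  have n2: "?x i = lam + (real i - real K) * H" if "K \<le> i" "i \<le> 3 * K" for i
  proof (cases "i = K")
    case True
    then show ?thesis using n1[of K] Kh by simp
  next
    case False
    then show ?thesis using that K by (simp add: shishkin_node_def Let_def H_def)
  qed
  have n3: "?x i = 1 - (4 * real K - real i) * h" if "3 * K \<le> i" for i
  proof (cases "i = 3 * K")
    case True
    have "lam + 2 * (real K * H) = 1 - real K * h" unfolding Kh KH by simp
    then show ?thesis using n2[of i] True by (simp add: algebra_simps)
  next
    case False
    then show ?thesis using that K by (simp add: shishkin_node_def Let_def h_def)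
  qed
  have h: "0 < h" using lam K by (simp add: h_def)
  have hH: "h \<le> H" unfolding h_def H_def by (intro divide_right_mono) (use lam in auto)
  have step: "?x (Suc i) - ?x i = (if K \<le> i \<and> i < 3 * K then H else h)" for i
  proof -
    consider "i < K" | "K \<le> i" "i < 3 * K" | "3 * K \<le> i" by linarith
    then show ?thesis
      by cases (simp_all add: n1 n2 n3 algebra_simps)
  qed
  have div: "N div 4 = K" using K by simp
  interpret mesh ?x N
  proof
    show "?x 0 = 0" using n1[of 0] by simp
    show "?x N = 1" using n3[of N] K by simp
    show "?x i < ?x (Suc i)" for i
    proof -
      have "0 < ?x (Suc i) - ?x i" unfolding step using h hH by simp
      then show ?thesis by simp
    qed
  qed
  show "two_scale_mesh ?x N (N div 4) (3 * (N div 4)) (4 * lam / N) (2 * (1 - 2 * lam) / N)"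
    unfolding div h_def[symmetric] H_def[symmetric]
  proof unfold_locales
    have w: "width i = (if K \<le> i \<and> i < 3 * K then H else h)" for i
      using step by (simp add: width_def)
    show "K < 3 * K" "3 * K \<le> N" "0 < h" "h \<le> H" using K h hH by auto
    show "width i = H" if "K \<le> i" "i < 3 * K" for i using w that by simp
    show "width i = h" if "\<not> (K \<le> i \<and> i < 3 * K)" for i using w that by auto
  qed
  show "?x (N div 4) = lam" "?x (3 * (N div 4)) = 1 - lam"
    unfolding div using n1[of K] n3[of "3 * K"] Kh by (simp_all add: algebra_simps)
qed

text \<open>The layer region has area \<open>1 - (1 - 2 \<lambda>)\<^sup>2 \<le> 4 \<lambda>\<close>.\<close>

lemma layer_L2_bound:
  assumes lam: "0 < lam" "lam \<le> 1 / 4" and e: "e \<in> L2" and B: "0 \<le> B" and bound: "Linf_norm (\<Omega> - \<Omega>\<^sub>0 lam) e \<le> ereal B"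
  shows "L2_inner (\<lambda>p. indicator (\<Omega> - \<Omega>\<^sub>0 lam) p * e p) (\<lambda>p. indicator (\<Omega> - \<Omega>\<^sub>0 lam) p * e p) \<le> 4 * lam * B\<^sup>2"
proof -
  let ?A = "\<Omega> - \<Omega>\<^sub>0 lam"
  have O0: "\<Omega>\<^sub>0 lam = box (lam, lam) (1 - lam, 1 - lam)" by (auto simp: \<Omega>\<^sub>0_def mem_box Basis_prod_def ball_Un)
  have sub: "\<Omega>\<^sub>0 lam \<subseteq> \<Omega>" using lam by (auto simp: \<Omega>\<^sub>0_def \<Omega>_def)
  have A: "?A \<in> sets lebesgue" by (intro sets.Diff Omega_lebesgue) (simp add: O0)
  have "AE p in lebesgue_on ?A. ereal \<bar>e p\<bar> \<le> esssup (lebesgue_on ?A) (\<lambda>p. ereal \<bar>e p\<bar>)"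
    by (rule esssup_AE)
  then have "AE p in lebesgue_on ?A. \<bar>e p\<bar> \<le> B"
    using bound unfolding Linf_norm_def by (auto elim!: eventually_mono dest: order_trans)
  then have "AE p in lebesgue. p \<in> ?A \<longrightarrow> \<bar>e p\<bar> \<le> B"
    using A by (subst (asm) AE_restrict_space_iff) auto
  then have ae: "AE p in lebesgue_on \<Omega>. p \<in> ?A \<longrightarrow> \<bar>e p\<bar> \<le> B"
    by (subst AE_restrict_space_iff) (auto elim: eventually_mono)
  have "L2_inner (\<lambda>p. indicator ?A p * e p) (\<lambda>p. indicator ?A p * e p) \<le> (LINT p|lebesgue_on \<Omega>. B\<^sup>2 * indicator ?A p)"
    unfolding L2_inner_def
  proof (rule integral_mono_AE)
    show "integrable (lebesgue_on \<Omega>) (\<lambda>p. B\<^sup>2 * indicator ?A p)"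
      using integral_indicator_Omega(1)[OF A] by simp
    show "AE p in lebesgue_on \<Omega>. indicator ?A p * e p * (indicator ?A p * e p) \<le> B\<^sup>2 * indicator ?A p"
      using ae
    proof eventually_elim
      case (elim p)
      show ?case
      proof (cases "p \<in> ?A")
        case True
        then have "\<bar>e p\<bar>\<^sup>2 \<le> B\<^sup>2" using elim by (intro power_mono) auto
        then show ?thesis using True by (simp add: power2_eq_square)
      qed simp
    qed
    show "integrable (lebesgue_on \<Omega>) (\<lambda>p. indicator ?A p * e p * (indicator ?A p * e p))"
      by (intro integrable_L2_mult L2_indicator_mult A e)
  qed
  also have "\<dots> = B\<^sup>2 * measure lebesgue (?A \<inter> \<Omega>)"
    using integral_indicator_Omega[OF A] by simp
  also have "?A \<inter> \<Omega> = \<Omega> - \<Omega>\<^sub>0 lam" by auto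
  also have "measure lebesgue (\<Omega> - \<Omega>\<^sub>0 lam) = measure lebesgue \<Omega> - measure lebesgue (\<Omega>\<^sub>0 lam)"
    by (rule measurable_measure_Diff[OF Omega_lmeasurable _ sub]) (simp add: O0)
  also have "\<dots> = 1 - (1 - 2 * lam)\<^sup>2"
    unfolding Omega_box O0 using measure_box_pair(2)[of 0 1 0 1] measure_box_pair(2)[of lam "1 - lam" lam "1 - lam"] lam
    by (simp add: power2_eq_square)
  also have "B\<^sup>2 * (1 - (1 - 2 * lam)\<^sup>2) \<le> B\<^sup>2 * (4 * lam)"
    by (intro mult_left_mono) (auto simp: power2_eq_square algebra_simps)
  finally show ?thesis by (simp add: mult.commute)
qed


text \<open>The first summand is the constant for large \<open>\<epsilon>\<close>. For small \<open>\<epsilon>\<close> the others add the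
  contributions of the gradients of the truncation and of the interpolation error, and of their \<open>L\<^sub>2\<close>
  norms over the layer region, with \<open>\<kappa>\<close> and \<open>\<rho>\<close> the constants in \<open>\<kappa> \<epsilon>\<^bsup>1/2\<^esup> \<le> \<lambda> \<le> \<rho> \<epsilon>\<^bsup>1/2\<^esup> ln N\<close>.\<close>

definition gradient_constant :: "real \<Rightarrow> real \<Rightarrow> real \<Rightarrow> real" where
  "gradient_constant c \<kappa> \<rho> = (1 + c) + 16384 / \<kappa> * ((1 + c) / c) +
     2 * (2 + 16384 / \<kappa> * ((1 + c) / c) + 2 * c * (4 * \<rho> + 409600 * \<rho> * ((1 + c) / c)))"

text \<open>The letters stand for \<open>s = \<epsilon>\<^bsup>1/2\<^esup>\<close>, \<open>n = N\<close>, \<open>L = ln N\<close>; \<open>Ae\<close>, \<open>A0\<close>, \<open>A1\<close>, \<open>A\<xi>\<close> for the squared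
  seminorms of \<open>e\<close>, \<open>\<xi>\<^sub>0\<close>, \<open>\<xi>\<^sub>1\<close>, \<open>\<xi>\<close>; \<open>Be\<close>, \<open>B1\<close>, \<open>B\<xi>\<close> for squared \<open>L\<^sub>2\<close> norms, and \<open>Bl\<close>, \<open>B0\<close> for those of \<open>e\<close>
  and \<open>\<xi>\<^sub>0\<close> over the layer region. Two facts carry the second case: \<open>B\<xi>\<close> gains a factor \<open>n\<^bsup>-2\<^esup>\<close>
  over \<open>Q\<close>, and \<open>h H\<close> is at least \<open>4 \<kappa> s/n\<^sup>2\<close>, because \<open>\<lambda>\<close> is never much smaller than \<open>s\<close>.\<close>

lemma error_constants:
  fixes s n L lam h H c \<kappa> \<rho> C :: real
  assumes s: "0 < s" "s \<le> 1" and n: "4 \<le> n" and L: "1 \<le> L" "L \<le> n" and c: "0 < c" and \<kappa>: "0 < \<kappa>" and \<rho>: "0 \<le> \<rho>"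
    and lam: "\<kappa> * s \<le> lam" "lam \<le> \<rho> * L * s" "lam \<le> 1 / 4"
    and h: "h = 4 * lam / n" and H: "H = 2 * (1 - 2 * lam) / n"
    and pos: "0 \<le> A0" "0 \<le> B\<xi>" "0 \<le> A\<xi>" "0 \<le> B1" "0 \<le> Ae"
    and Ae: "s * Ae \<le> C\<^sup>2 * (L\<^sup>2 / n\<^sup>2)" and Be: "Be \<le> C\<^sup>2 / n ^ 4" and Bl: "Bl \<le> 4 * lam * (C * (L / n)\<^sup>2)\<^sup>2"
    and en: "s\<^sup>2 * A\<xi> + c * B\<xi> \<le> s\<^sup>2 * Ae + c * Be"
    and A0: "A0 \<le> 32768 / (h * H) * B\<xi>" and B0: "B0 \<le> 102400 * (h / H) * B\<xi>"
    and loc: "s\<^sup>2 * A1 + c * B1 \<le> s\<^sup>2 * (2 * Ae + 2 * A0) + c * (2 * Bl + 2 * B0)"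
    and A\<xi>: "A\<xi> \<le> 2 * A0 + 2 * A1"
  defines "K1 \<equiv> (1 + c) / c" and "Q \<equiv> C\<^sup>2 * (L ^ 3 / n\<^sup>2)"
  shows "s * Ae \<le> Q" "Be \<le> Q" "B\<xi> \<le> K1 * Q"
    "s * A\<xi> \<le> gradient_constant c \<kappa> \<rho> * Q"
proof -
  have n0: "0 < n" using n by simp
  have K1: "0 < K1" using c by (simp add: K1_def)
  have K1_eq: "q + c * q = c * (K1 * q)" for q using c by (simp add: K1_def field_simps)
  have L3: "L\<^sup>2 \<le> L ^ 3" "1 \<le> L ^ 3" using L(1) by (auto intro: power_increasing one_le_power)
  have Q0: "0 \<le> Q" using L by (simp add: Q_def)
  have Q1: "C\<^sup>2 / n\<^sup>2 \<le> Q"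
  proof -
    have "C\<^sup>2 * (1 / n\<^sup>2) \<le> C\<^sup>2 * (L ^ 3 / n\<^sup>2)" by (intro mult_left_mono divide_right_mono L3) auto
    then show ?thesis by (simp add: Q_def)
  qed
  have n2: "1 \<le> n\<^sup>2" using n by (simp add: one_le_power)
  have Q2: "C\<^sup>2 / n ^ 4 \<le> Q / n\<^sup>2"
  proof -
    have "C\<^sup>2 / n ^ 4 = C\<^sup>2 / n\<^sup>2 / n\<^sup>2" by (simp add: power_add[symmetric])
    also have "\<dots> \<le> Q / n\<^sup>2" by (intro divide_right_mono Q1) simp
    finally show ?thesis .
  qed
  have Qn: "Q / n\<^sup>2 \<le> Q" using divide_left_mono[OF n2 Q0] n0 by simp
  have "C\<^sup>2 * (L\<^sup>2 / n\<^sup>2) \<le> Q" unfolding Q_def by (intro mult_left_mono divide_right_mono L3) auto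
  with Ae show sAe: "s * Ae \<le> Q" by simp
  show BeQ: "Be \<le> Q" using Be Q2 Qn by linarith
  \<comment> \<open>Dropping the gradient of \<open>\<xi>\<close> from the energy estimate.\<close>
  have cB: "c * B\<xi> \<le> s * (s * Ae) + c * Be"
    using en pos(3) by (simp add: power2_eq_square mult.assoc) (smt (verit) mult_nonneg_nonneg s(1))
  have "s * (s * Ae) \<le> 1 * Q" by (intro mult_mono sAe s) (use s pos in auto)
  then have "c * B\<xi> \<le> Q + c * Q" using cB mult_left_mono[OF BeQ less_imp_le[OF c]] by simp
  also have "\<dots> = c * (K1 * Q)" by (rule K1_eq)
  finally show "B\<xi> \<le> K1 * Q" using c by simp
  define \<alpha> \<beta> where "\<alpha> = 16384 / \<kappa> * K1" and "\<beta> = 2 * c * (4 * \<rho> + 409600 * \<rho> * K1)"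
  have \<alpha>\<beta>: "0 \<le> \<alpha>" "0 \<le> \<beta>" using \<kappa> K1 c \<rho> by (auto simp: \<alpha>_def \<beta>_def)
  let ?K2 = "(1 + c) + \<alpha> + 2 * (2 + \<alpha> + \<beta>)"
  have "s * A\<xi> \<le> ?K2 * Q"
  \<comment> \<open>The condition means \<open>\<epsilon>\<^bsup>1/4\<^esup> \<ge> 1/N\<close>.\<close>
  proof (cases "1 \<le> s * n\<^sup>2")
    case True
    have "s * (s * A\<xi>) \<le> s * (s * Ae) + c * Be"
      using en pos(2) c by (simp add: power2_eq_square mult.assoc) (smt (verit) mult_nonneg_nonneg)
    also have "c * Be \<le> c * (Q / n\<^sup>2)" using Be Q2 c by (intro mult_left_mono) auto
    also have "Q / n\<^sup>2 \<le> s * Q"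
    proof -
      have "1 * Q \<le> (s * n\<^sup>2) * Q" by (rule mult_right_mono[OF True Q0])
      then show ?thesis using n0 by (simp add: pos_divide_le_eq mult_ac)
    qed
    then have "s * (s * Ae) + c * (Q / n\<^sup>2) \<le> s * Q + c * (s * Q)"
      using s c sAe by (intro add_mono mult_left_mono) auto
    finally have "s * (s * A\<xi>) \<le> s * ((1 + c) * Q)" by (simp add: algebra_simps)
    then have "s * A\<xi> \<le> (1 + c) * Q" using s by simp
    also have "\<dots> \<le> ?K2 * Q" by (rule mult_right_mono[OF _ Q0]) (use \<alpha>\<beta> in simp)
    finally show ?thesis .
  next
    case False
    then have sn: "s * n\<^sup>2 \<le> 1" by simp
    have sQ: "s * Q \<le> Q / n\<^sup>2" using mult_right_mono[OF sn Q0] n0 by (simp add: pos_le_divide_eq mult_ac)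
    have "s * (s * Ae) \<le> s * Q" using s sAe by simp
    then have "c * B\<xi> \<le> Q / n\<^sup>2 + c * (Q / n\<^sup>2)"
      using cB sQ mult_left_mono[OF order_trans[OF Be Q2] less_imp_le[OF c]] by linarith
    also have "\<dots> = c * (K1 * (Q / n\<^sup>2))" by (rule K1_eq)
    finally have B: "B\<xi> \<le> K1 * (Q / n\<^sup>2)" by (rule mult_left_le_imp_le[OF _ c])
    have lam0: "0 < lam" using lam(1) mult_pos_pos[OF \<kappa> s(1)] by linarith
    have Hn: "1 / n \<le> H" unfolding H using lam n0 by (intro divide_right_mono) auto
    have H0: "0 < H" using Hn n0 by (meson less_le_trans zero_less_divide_1_iff)
    have h0: "0 < h" unfolding h using lam0 n0 by simp
    have hs: "4 * \<kappa> * s / n \<le> h" unfolding h using lam n0 by (intro divide_right_mono) auto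
    have hH: "4 * \<kappa> * s / n\<^sup>2 \<le> h * H"
    proof -
      have "4 * \<kappa> * s / n * (1 / n) \<le> h * H"
        by (intro mult_mono hs Hn) (use h0 n0 in auto)
      then show ?thesis by (simp add: power2_eq_square)
    qed
    have shH: "s / (h * H) \<le> n\<^sup>2 / (4 * \<kappa>)"
    proof -
      have "s * (4 * \<kappa>) \<le> n\<^sup>2 * (h * H)" using hH n0 by (simp add: pos_divide_le_eq mult_ac)
      then show ?thesis using h0 H0 \<kappa> by (simp add: pos_divide_le_eq pos_le_divide_eq mult_ac)
    qed
    have sA0: "s * A0 \<le> 8192 / \<kappa> * K1 * Q"
    proof -
      have "s * A0 \<le> s * (32768 / (h * H) * B\<xi>)" using A0 s by (intro mult_left_mono) auto
      also have "\<dots> = 32768 * (s / (h * H)) * B\<xi>" by simp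
      also have "\<dots> \<le> 32768 * (n\<^sup>2 / (4 * \<kappa>)) * (K1 * (Q / n\<^sup>2))"
        by (intro mult_mono shH B order_refl) (use pos \<kappa> n0 s h0 H0 in auto)
      also have "\<dots> = 8192 / \<kappa> * K1 * Q" using n0 by simp
      finally show ?thesis .
    qed
    have hHs: "h / H \<le> 4 * \<rho> * L * s"
    proof -
      have "h / H \<le> h / (1 / n)" by (intro divide_left_mono Hn) (use h0 n0 H0 in auto)
      also have "\<dots> = 4 * lam" unfolding h using n0 by simp
      also have "\<dots> \<le> 4 * \<rho> * L * s" using lam(2) by simp
      finally show ?thesis .
    qed
    have Ln: "L / n\<^sup>2 \<le> 1"
    proof -
      have "L \<le> n * n" using L n mult_mono[of 1 n L n] by simp
      then show ?thesis using n0 by (simp add: power2_eq_square)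
    qed
    have B0s: "B0 \<le> s * (409600 * \<rho> * K1 * Q)"
    proof -
      have "B0 \<le> 102400 * (4 * \<rho> * L * s) * (K1 * (Q / n\<^sup>2))"
        by (rule order_trans[OF B0]) (intro mult_mono hHs B order_refl; use pos \<rho> L s h0 H0 in auto)
      also have "\<dots> = s * (409600 * \<rho> * K1 * Q) * (L / n\<^sup>2)" by simp
      also have "\<dots> \<le> s * (409600 * \<rho> * K1 * Q) * 1"
        by (rule mult_left_mono[OF Ln]) (use s \<rho> K1 Q0 in auto)
      finally show ?thesis by simp
    qed
    have Bls: "Bl \<le> s * (4 * \<rho> * Q)"
    proof -
      have "Bl \<le> 4 * (\<rho> * L * s) * (C * (L / n)\<^sup>2)\<^sup>2"
        using order_trans[OF Bl mult_right_mono[OF mult_left_mono[OF lam(2)]]] by simp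
      also have "\<dots> = s * (4 * \<rho> * Q) * (L / n)\<^sup>2"
        unfolding Q_def by (simp add: power_mult_distrib power_divide power2_eq_square power3_eq_cube)
      also have "\<dots> \<le> s * (4 * \<rho> * Q) * 1"
      proof (rule mult_left_mono)
        show "(L / n)\<^sup>2 \<le> 1" using L n0 by (intro power_le_one) auto
      qed (use s \<rho> Q0 in auto)
      finally show ?thesis by simp
    qed
    have "s * (s * A1) \<le> s * (2 * (s * Ae) + 2 * (s * A0)) + c * (2 * Bl + 2 * B0)"
    proof -
      have "0 \<le> c * B1" using c pos by simp
      then have "s\<^sup>2 * A1 \<le> s\<^sup>2 * (2 * Ae + 2 * A0) + c * (2 * Bl + 2 * B0)" using loc by linarith
      then show ?thesis by (simp add: power2_eq_square algebra_simps)
    qed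
    also have "\<dots> \<le> s * (2 * Q + 2 * (8192 / \<kappa> * K1 * Q)) + c * (2 * (s * (4 * \<rho> * Q)) + 2 * (s * (409600 * \<rho> * K1 * Q)))"
      by (intro add_mono mult_left_mono sAe sA0 B0s Bls) (use s c in auto)
    also have "\<dots> = s * ((2 + \<alpha> + \<beta>) * Q)"
      unfolding \<alpha>_def \<beta>_def by (simp add: algebra_simps)
    finally have sA1: "s * A1 \<le> (2 + \<alpha> + \<beta>) * Q" using s by simp
    have sA0': "2 * (s * A0) \<le> \<alpha> * Q" using sA0 by (simp add: \<alpha>_def)
    have "s * A\<xi> \<le> 2 * (s * A0) + 2 * (s * A1)"
      using mult_left_mono[OF A\<xi> less_imp_le[OF s(1)]] by (simp add: algebra_simps)
    also have "\<dots> \<le> \<alpha> * Q + 2 * ((2 + \<alpha> + \<beta>) * Q)"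
      using sA0' sA1 by linarith
    also have "\<dots> = (?K2 - (1 + c)) * Q" by (simp add: algebra_simps)
    also have "\<dots> \<le> ?K2 * Q" by (rule mult_right_mono[OF _ Q0]) (use c in simp)
    finally show ?thesis .
  qed
  then show "s * A\<xi> \<le> gradient_constant c \<kappa> \<rho> * Q"
    unfolding gradient_constant_def \<alpha>_def \<beta>_def K1_def .
qed

section \<open>The error of the Galerkin solution\<close>

text \<open>The nodal values of \<open>u\<^sup>N - u\<^sup>I\<close> define \<open>\<xi>\<close>, their truncation defines \<open>\<xi>0\<close>, and the difference of the
  two interpolants lies again in the discrete space, which makes it an admissible test function.\<close>

lemma galerkin_error_squared:
  fixes \<epsilon> c cs C :: real and N :: nat
  defines "lam \<equiv> transition cs \<epsilon> N"
  defines "x \<equiv> shishkin_node lam N"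
  assumes pos: "0 < cs" "0 < c" "0 < \<epsilon>" "\<epsilon> \<le> 1" and N: "N \<in> mesh_sizes" and C: "0 \<le> C"
    and u: "variational_solution \<epsilon> c f H01 u" and V: "mesh.nodal_space x N m V"
    and uI: "uI \<in> V" and uN: "variational_solution \<epsilon> c f V uN"
  defines "e \<equiv> \<lambda>p. u p - uI p"
  assumes e0: "L2_norm e \<le> C * (1 / real N ^ 2)" and e1: "\<epsilon> powr (1/4) * H1_seminorm e \<le> C * (1 / real N * ln (real N))"
    and einf: "Linf_norm (\<Omega> - \<Omega>\<^sub>0 lam) e \<le> ereal (C * (1 / real N * ln (real N)) ^ 2)"
  defines "\<kappa> \<equiv> min (1 / 4) (2 / sqrt cs)" and "\<rho> \<equiv> 2 / sqrt cs" and "K1 \<equiv> (1 + c) / c"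
  defines "Q \<equiv> C\<^sup>2 * (ln (real N) ^ 3 / (real N)\<^sup>2)"
  shows "L2_inner (\<lambda>p. u p - uN p) (\<lambda>p. u p - uN p) \<le> (2 + 2 * K1) * Q"
    and "sqrt \<epsilon> * grad_inner (\<lambda>p. u p - uN p) (\<lambda>p. u p - uN p)
      \<le> (2 + 2 * gradient_constant c \<kappa> \<rho>) * Q"
proof -
  define s L n where "s = sqrt \<epsilon>" and "L = ln (real N)" and "n = real N"
  have s: "0 < s" "s \<le> 1" "s\<^sup>2 = \<epsilon>" using pos by (auto simp: s_def)
  have N4: "4 \<le> N" using N by (auto simp: mesh_sizes_def dest: dvd_imp_le)
  have n: "4 \<le> n" using N4 by (simp add: n_def)
  have L: "1 \<le> L" "L \<le> n"
  proof -
    have "exp 1 \<le> (3 :: real)" by (rule exp_le)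
    also have "3 \<le> real N" using N4 by simp
    finally have "exp 1 \<le> real N" .
    then show "1 \<le> L" unfolding L_def using N4 by (subst ln_ge_iff) auto
    show "L \<le> n" unfolding L_def n_def using ln_le_minus_one[of "real N"] N4 by simp
  qed
  have lam_eq: "lam = min (1 / 4) (\<rho> * L * s)"
    using pos by (simp add: lam_def transition_def \<rho>_def L_def s_def real_sqrt_divide mult_ac)
  have \<rho>: "0 < \<rho>" using pos by (simp add: \<rho>_def)
  have \<kappa>: "0 < \<kappa>" "\<kappa> \<le> 1 / 4" "\<kappa> \<le> \<rho>" using \<rho> by (auto simp: \<kappa>_def \<rho>_def)
  have lam: "\<kappa> * s \<le> lam" "lam \<le> \<rho> * L * s" "lam \<le> 1 / 4"
  proof -
    have "\<kappa> * s \<le> 1 / 4 * 1" using \<kappa> s by (intro mult_mono) auto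
    moreover have "\<kappa> * 1 * s \<le> \<rho> * L * s" using \<kappa> \<rho> L s by (intro mult_mono) auto
    ultimately show "\<kappa> * s \<le> lam" by (simp add: lam_eq)
  qed (auto simp: lam_eq)
  have lam0: "0 < lam" using lam(1) mult_pos_pos[OF \<kappa>(1) s(1)] by linarith
  note shishkin = shishkin_two_scale_mesh[OF N lam0 lam(3), folded x_def n_def]
  define h H where "h = 4 * lam / n" and "H = 2 * (1 - 2 * lam) / n"
  interpret two_scale_mesh x N "N div 4" "3 * (N div 4)" h H
    unfolding h_def H_def by (rule shishkin(1))
  have core: "core = \<Omega>\<^sub>0 lam" by (simp add: core_def \<Omega>\<^sub>0_def shishkin(2,3))
  have shapes: "m i j \<in> element_shapes" for i j using V by (simp add: nodal_space_def)
  have V01: "v \<in> V \<Longrightarrow> v \<in> H01" for v by (rule nodal_space_subset_H01[OF V])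
  have uN_V: "uN \<in> V" using uN by (simp add: variational_solution_def)
  have H1s: "u \<in> H1" "uI \<in> H1" "uN \<in> H1"
    using u V01[OF uI] V01[OF uN_V] H01_H1 by (auto simp: variational_solution_def)
  have eH: "e \<in> H1" unfolding e_def by (rule H1_diff[OF H1s(1,2)])
  define W where "W i j = uN (x i, x j) - uI (x i, x j)" for i j
  have W: "zero_boundary W"
  proof -
    have "zero_boundary (\<lambda>i j. v (x i, x j))" if "v \<in> V" for v
      using V that unfolding nodal_space_def by blast
    from this[OF uI] this[OF uN_V] show ?thesis by (simp add: zero_boundary_def W_def)
  qed
  define \<xi> \<xi>0 where "\<xi> = nodal_interpolant m W" and "\<xi>0 = nodal_interpolant m (truncation W)"
  have \<xi>V: "\<xi> \<in> V" using V W by (simp add: nodal_space_def \<xi>_def)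
  have \<xi>0V: "\<xi>0 \<in> V" using V zero_boundary_truncation[OF W] by (simp add: nodal_space_def \<xi>0_def)
  have W1: "zero_boundary (\<lambda>i j. W i j - truncation W i j)"
    using W zero_boundary_truncation[OF W] by (simp add: zero_boundary_def)
  have \<xi>1V: "(\<lambda>p. \<xi> p - \<xi>0 p) \<in> V"
  proof -
    have "nodal_interpolant m (\<lambda>i j. W i j - truncation W i j) \<in> V" using V W1 by (simp add: nodal_space_def)
    then show ?thesis unfolding \<xi>_def \<xi>0_def nodal_interpolant_diff[abs_def] .
  qed
  have \<xi>H: "\<xi> \<in> H1" "\<xi>0 \<in> H1" using \<xi>V \<xi>0V V01 H01_H1 by blast+
  have \<xi>_eq: "\<xi> p = uN p - uI p" if "p \<in> \<Omega>" for p
  proof -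
    have p: "p \<in> closure \<Omega>" using that closure_subset by blast
    have "uN p = nodal_interpolant m (\<lambda>i j. uN (x i, x j)) p" "uI p = nodal_interpolant m (\<lambda>i j. uI (x i, x j)) p"
      using V uI uN_V p unfolding nodal_space_def by blast+
    then show ?thesis unfolding \<xi>_def W_def nodal_interpolant_diff by simp
  qed
  have galerkin: "energy \<epsilon> c \<xi> v = energy \<epsilon> c e v" if v: "v \<in> V" for v
  proof -
    have vH: "v \<in> H1" using V01[OF v] H01_H1 by blast
    have "energy \<epsilon> c u v = L2_inner f v" "energy \<epsilon> c uN v = L2_inner f v"
      using u uN v V01[OF v] by (auto simp: variational_solution_def energy_def)
    moreover have "energy \<epsilon> c \<xi> v = energy \<epsilon> c (\<lambda>p. uN p - uI p) v"
      unfolding energy_def grad_inner_def using wgrad_cong(2)[of \<xi> "\<lambda>p. uN p - uI p"] \<xi>_eq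
        L2_inner_cong[of \<xi> v "\<lambda>p. uN p - uI p" v] by simp
    ultimately show ?thesis
      using energy_diff_left[OF H1s(3,2) vH] energy_diff_left[OF H1s(1,2) vH] by (simp add: e_def)
  qed
  define \<xi>1 where "\<xi>1 = (\<lambda>p. \<xi> p - \<xi>0 p)"
  have \<xi>1H: "\<xi>1 \<in> H1" unfolding \<xi>1_def by (rule H1_diff[OF \<xi>H])
  let ?A = "\<Omega> - \<Omega>\<^sub>0 lam"
  have O0: "\<Omega>\<^sub>0 lam = box (lam, lam) (1 - lam, 1 - lam)" by (auto simp: \<Omega>\<^sub>0_def mem_box Basis_prod_def ball_Un)
  have A: "?A \<in> sets lebesgue" by (intro sets.Diff Omega_lebesgue) (simp add: O0)
  let ?Be = "L2_inner (\<lambda>p. indicator ?A p * e p) (\<lambda>p. indicator ?A p * e p)"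
  let ?B0 = "L2_inner (\<lambda>p. indicator ?A p * \<xi>0 p) (\<lambda>p. indicator ?A p * \<xi>0 p)"
  have nL: "1 / real N * ln (real N) = L / n" by (simp add: L_def n_def)
  have Ae: "s * grad_inner e e \<le> C\<^sup>2 * (L\<^sup>2 / n\<^sup>2)"
  proof -
    have "(\<epsilon> powr (1/4) * H1_seminorm e)\<^sup>2 \<le> (C * (L / n))\<^sup>2"
      using e1 unfolding nL by (rule power_mono) (use grad_inner_nonneg in \<open>auto simp: H1_seminorm_def\<close>)
    moreover have "(\<epsilon> powr (1/4))\<^sup>2 = s"
      using pos by (simp add: power2_eq_square powr_add[symmetric] s_def powr_half_sqrt)
    ultimately show ?thesis
      by (simp add: power_mult_distrib H1_seminorm_def grad_inner_nonneg power_divide)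
  qed
  have Be: "L2_inner e e \<le> C\<^sup>2 / n ^ 4"
  proof -
    have "(L2_norm e)\<^sup>2 \<le> (C * (1 / real N ^ 2))\<^sup>2"
      using e0 by (rule power_mono) (use L2_inner_nonneg in \<open>auto simp: L2_norm_def\<close>)
    then show ?thesis by (simp add: L2_norm_def L2_inner_nonneg power_mult_distrib power_divide n_def power_mult[symmetric])
  qed
  have Bl: "?Be \<le> 4 * lam * (C * (L / n)\<^sup>2)\<^sup>2"
    by (rule layer_L2_bound[OF lam0 lam(3) H1_L2[OF eH]]) (use C einf[unfolded nL] in auto)
  have en: "s\<^sup>2 * grad_inner \<xi> \<xi> + c * L2_inner \<xi> \<xi> \<le> s\<^sup>2 * grad_inner e e + c * L2_inner e e"
    using energy_quasi_best[OF eH \<xi>H(1) _ _ galerkin[OF \<xi>V]] pos s(3) by (simp add: energy_def)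
  have A0: "grad_inner \<xi>0 \<xi>0 \<le> 32768 / (h * H) * L2_inner \<xi> \<xi>"
    unfolding \<xi>_def \<xi>0_def by (rule grad_truncation_bound[where m = m, OF shapes W])
  have B0: "?B0 \<le> 102400 * (h / H) * L2_inner \<xi> \<xi>"
    using layer_truncation_bound[where m = m, OF shapes W] unfolding \<xi>_def \<xi>0_def core .
  have loc: "s\<^sup>2 * grad_inner \<xi>1 \<xi>1 + c * L2_inner \<xi>1 \<xi>1 \<le>
      s\<^sup>2 * (2 * grad_inner e e + 2 * grad_inner \<xi>0 \<xi>0) + c * (2 * ?Be + 2 * ?B0)"
    unfolding s(3) \<xi>1_def
  proof (rule energy_localised[OF eH \<xi>H _ _ A])
    show "\<xi> p = \<xi>0 p" if "p \<in> \<Omega>" "p \<notin> ?A" for p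
      using truncation_on_core[where m = m, OF shapes W, of p] that unfolding \<xi>_def \<xi>0_def core by auto
    show "energy \<epsilon> c \<xi> (\<lambda>p. \<xi> p - \<xi>0 p) = energy \<epsilon> c e (\<lambda>p. \<xi> p - \<xi>0 p)" by (rule galerkin[OF \<xi>1V])
  qed (use pos in auto)
  have A\<xi>: "grad_inner \<xi> \<xi> \<le> 2 * grad_inner \<xi>0 \<xi>0 + 2 * grad_inner \<xi>1 \<xi>1"
  proof -
    have z: "(\<lambda>p. \<xi>0 p - \<xi> p) \<in> H1" by (rule H1_diff[OF \<xi>H(2,1)])
    have "grad_inner (\<lambda>p. \<xi>0 p - (\<xi>0 p - \<xi> p)) (\<lambda>p. \<xi>0 p - (\<xi>0 p - \<xi> p))
        \<le> 2 * grad_inner \<xi>0 \<xi>0 + 2 * grad_inner (\<lambda>p. \<xi>0 p - \<xi> p) (\<lambda>p. \<xi>0 p - \<xi> p)"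
      by (rule grad_inner_young(2)[OF \<xi>H(2) z])
    moreover have "grad_inner (\<lambda>p. \<xi>0 p - \<xi> p) (\<lambda>p. \<xi>0 p - \<xi> p) = grad_inner \<xi>1 \<xi>1"
      unfolding \<xi>1_def
      using grad_inner_diff_left[OF \<xi>H(2,1) z] grad_inner_diff_left[OF \<xi>H \<xi>1H[unfolded \<xi>1_def]]
        grad_inner_diff_left[OF \<xi>H(2,1) \<xi>H(1)] grad_inner_diff_left[OF \<xi>H(2,1) \<xi>H(2)]
        grad_inner_diff_left[OF \<xi>H \<xi>H(1)] grad_inner_diff_left[OF \<xi>H \<xi>H(2)]
        grad_inner_commute[of \<xi> "\<lambda>p. \<xi>0 p - \<xi> p"] grad_inner_commute[of \<xi>0 "\<lambda>p. \<xi>0 p - \<xi> p"]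
        grad_inner_commute[of \<xi> "\<lambda>p. \<xi> p - \<xi>0 p"] grad_inner_commute[of \<xi>0 "\<lambda>p. \<xi> p - \<xi>0 p"]
      by simp
    ultimately show ?thesis by simp
  qed
  note est = error_constants[OF s(1,2) n L pos(2) \<kappa>(1) less_imp_le[OF \<rho>] lam h_def H_def
      grad_inner_nonneg L2_inner_nonneg grad_inner_nonneg L2_inner_nonneg grad_inner_nonneg
      Ae Be Bl en A0 B0 loc A\<xi>, folded K1_def]
  have Qeq: "C\<^sup>2 * (L ^ 3 / n\<^sup>2) = Q" by (simp add: Q_def L_def n_def)
  note est = est[unfolded Qeq]
  have diff: "u p - uN p = e p - \<xi> p" if "p \<in> \<Omega>" for p using \<xi>_eq[OF that] by (simp add: e_def)
  have "L2_inner (\<lambda>p. u p - uN p) (\<lambda>p. u p - uN p) = L2_inner (\<lambda>p. e p - \<xi> p) (\<lambda>p. e p - \<xi> p)"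
    by (rule L2_inner_cong) (simp add: diff)
  also have "\<dots> \<le> 2 * L2_inner e e + 2 * L2_inner \<xi> \<xi>" by (intro L2_inner_young(2) H1_L2 eH \<xi>H)
  also have "\<dots> \<le> 2 * Q + 2 * (K1 * Q)" using est(2,3) by linarith
  finally show "L2_inner (\<lambda>p. u p - uN p) (\<lambda>p. u p - uN p) \<le> (2 + 2 * K1) * Q" by (simp add: algebra_simps)
  have "grad_inner (\<lambda>p. u p - uN p) (\<lambda>p. u p - uN p) = grad_inner (\<lambda>p. e p - \<xi> p) (\<lambda>p. e p - \<xi> p)"
    unfolding grad_inner_def using wgrad_cong(2)[of "\<lambda>p. u p - uN p" "\<lambda>p. e p - \<xi> p"] diff by simp
  also have "\<dots> \<le> 2 * grad_inner e e + 2 * grad_inner \<xi> \<xi>" by (intro grad_inner_young(2) eH \<xi>H)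
  finally have "s * grad_inner (\<lambda>p. u p - uN p) (\<lambda>p. u p - uN p) \<le> s * (2 * grad_inner e e + 2 * grad_inner \<xi> \<xi>)"
    using s by (intro mult_left_mono) auto
  also have "\<dots> = 2 * (s * grad_inner e e) + 2 * (s * grad_inner \<xi> \<xi>)" by (simp add: algebra_simps)
  also have "\<dots> \<le> 2 * Q + 2 * (gradient_constant c \<kappa> \<rho> * Q)"
    using est(1,4) by linarith
  also have "\<dots> = (2 + 2 * gradient_constant c \<kappa> \<rho>) * Q"
    by (simp only: distrib_right mult.assoc)
  finally show "sqrt \<epsilon> * grad_inner (\<lambda>p. u p - uN p) (\<lambda>p. u p - uN p)
      \<le> (2 + 2 * gradient_constant c \<kappa> \<rho>) * Q"
    by (simp add: s_def)
qed

theorem theorem1: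
  fixes f :: "real \<times> real \<Rightarrow> real" and c cs \<epsilon>\<^sub>0 :: real and k :: nat
    and u :: "real \<Rightarrow> real \<times> real \<Rightarrow> real"
    and V :: "real \<Rightarrow> nat \<Rightarrow> (real \<times> real \<Rightarrow> real) set"
    and uI uN :: "real \<Rightarrow> nat \<Rightarrow> real \<times> real \<Rightarrow> real"
  assumes "0 < cs" and "cs < c" and "0 < \<epsilon>\<^sub>0" and "\<epsilon>\<^sub>0 \<le> 1"
    and "Ck_on (closure \<Omega>) k f"
    and "\<forall>\<epsilon>\<in>{0<..\<epsilon>\<^sub>0}. solves_reaction_diffusion \<epsilon> c f (u \<epsilon>)"
    and "(\<forall>\<epsilon>\<in>{0<..\<epsilon>\<^sub>0}. \<forall>N\<in>mesh_sizes.
            V \<epsilon> N = bilinear_elements (shishkin_node (transition cs \<epsilon> N) N) N) \<or>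
         (\<exists>d. \<forall>\<epsilon>\<in>{0<..\<epsilon>\<^sub>0}. \<forall>N\<in>mesh_sizes.
            V \<epsilon> N = linear_elements (shishkin_node (transition cs \<epsilon> N) N) (d \<epsilon> N) N)"
    and "\<forall>\<epsilon>\<in>{0<..\<epsilon>\<^sub>0}. \<forall>N\<in>mesh_sizes.
           lagrange_interpolant (shishkin_node (transition cs \<epsilon> N) N) N (V \<epsilon> N) (u \<epsilon>) (uI \<epsilon> N)"
    and "\<exists>C\<^sub>0. \<forall>\<epsilon>\<in>{0<..\<epsilon>\<^sub>0}. \<forall>N\<in>mesh_sizes.
           (let e = (\<lambda>p. u \<epsilon> p - uI \<epsilon> N p); \<Omega>' = \<Omega>\<^sub>0 (transition cs \<epsilon> N) in
            L2_norm e \<le> C\<^sub>0 * (1 / real N ^ 2) \<and>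
            \<epsilon> powr (1/4) * H1_seminorm e \<le> C\<^sub>0 * (1 / real N * ln (real N)) \<and>
            Linf_norm \<Omega>' e \<le> ereal (C\<^sub>0 * (1 / real N ^ 2)) \<and>
            Linf_norm (\<Omega> - \<Omega>') e \<le> ereal (C\<^sub>0 * (1 / real N * ln (real N)) ^ 2))"
    and "\<forall>\<epsilon>\<in>{0<..\<epsilon>\<^sub>0}. \<forall>N\<in>mesh_sizes. variational_solution \<epsilon> c f (V \<epsilon> N) (uN \<epsilon> N)"
  shows "\<exists>C. \<forall>\<epsilon>\<in>{0<..\<epsilon>\<^sub>0}. \<forall>N\<in>mesh_sizes.
           (let e = (\<lambda>p. u \<epsilon> p - uN \<epsilon> N p) in
            \<epsilon> powr (1/4) * H1_seminorm e + L2_norm e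
              \<le> C * (1 / real N * ln (real N) powr (3/2) + 1 / real N ^ 2))"
proof -
  obtain C\<^sub>0 where C\<^sub>0: "\<And>\<epsilon> N. \<epsilon> \<in> {0<..\<epsilon>\<^sub>0} \<Longrightarrow> N \<in> mesh_sizes \<Longrightarrow>
      L2_norm (\<lambda>p. u \<epsilon> p - uI \<epsilon> N p) \<le> C\<^sub>0 * (1 / real N ^ 2) \<and>
      \<epsilon> powr (1/4) * H1_seminorm (\<lambda>p. u \<epsilon> p - uI \<epsilon> N p) \<le> C\<^sub>0 * (1 / real N * ln (real N)) \<and>
      Linf_norm (\<Omega> - \<Omega>\<^sub>0 (transition cs \<epsilon> N)) (\<lambda>p. u \<epsilon> p - uI \<epsilon> N p) \<le> ereal (C\<^sub>0 * (1 / real N * ln (real N)) ^ 2)"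
    using assms(9) unfolding Let_def by blast
  define \<kappa> \<rho> K1 where "\<kappa> = min (1 / 4) (2 / sqrt cs)" and "\<rho> = 2 / sqrt cs" and "K1 = (1 + c) / c"
  define P where "P = (2 + 2 * gradient_constant c \<kappa> \<rho>)"
  define R where "R = 2 + 2 * K1"
  have c: "0 < c" using assms by simp
  have KP: "0 \<le> K1" "0 < \<kappa>" "0 \<le> \<rho>" using c assms(1) by (auto simp: K1_def \<kappa>_def \<rho>_def)
  have PR: "0 \<le> P" "0 \<le> R" using c KP by (auto simp: P_def R_def gradient_constant_def)
  \<comment> \<open>\<open>P\<close> and \<open>R\<close> bound squared norms in terms of \<open>C\<^sub>0\<^sup>2 L\<^sup>3/N\<^sup>2\<close>, whence the square roots.\<close>
  define D where "D = (sqrt P + sqrt R) * \<bar>C\<^sub>0\<bar>"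
  have D0: "0 \<le> D" using PR by (simp add: D_def)
  have "\<epsilon> powr (1/4) * H1_seminorm (\<lambda>p. u \<epsilon> p - uN \<epsilon> N p) + L2_norm (\<lambda>p. u \<epsilon> p - uN \<epsilon> N p)
      \<le> D * (1 / real N * ln (real N) powr (3/2) + 1 / real N ^ 2)"
    if \<epsilon>: "\<epsilon> \<in> {0<..\<epsilon>\<^sub>0}" and N: "N \<in> mesh_sizes" for \<epsilon> N
  proof -
    let ?lam = "transition cs \<epsilon> N" and ?x = "shishkin_node (transition cs \<epsilon> N) N"
    let ?L = "ln (real N)" and ?e = "\<lambda>p. u \<epsilon> p - uN \<epsilon> N p"
    have \<epsilon>': "0 < \<epsilon>" "\<epsilon> \<le> 1" using \<epsilon> assms(4) by auto
    have N4: "4 \<le> N" using N by (auto simp: mesh_sizes_def dest: dvd_imp_le)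
    have L0: "0 < ?L" using N4 by simp
    have C0: "0 \<le> C\<^sub>0"
    proof -
      have "0 \<le> L2_norm (\<lambda>p. u \<epsilon> p - uI \<epsilon> N p)" by (simp add: L2_norm_def L2_inner_nonneg)
      then have "0 \<le> C\<^sub>0 * (1 / real N ^ 2)" using C\<^sub>0[OF \<epsilon> N] by linarith
      then show ?thesis using N4 by (simp add: zero_le_mult_iff zero_le_divide_iff)
    qed
    have "0 < sqrt (\<epsilon> / cs)" using \<epsilon>' assms(1) by simp
    then have lam: "0 < ?lam" "?lam \<le> 1 / 4" using L0 by (auto simp: transition_def)
    interpret two_scale_mesh ?x N "N div 4" "3 * (N div 4)" "4 * ?lam / N" "2 * (1 - 2 * ?lam) / N"
      by (rule shishkin_two_scale_mesh(1)[OF N lam])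
    have "\<exists>m. nodal_space m (V \<epsilon> N)"
      using assms(7)
    proof
      assume "\<forall>\<epsilon>\<in>{0<..\<epsilon>\<^sub>0}. \<forall>N\<in>mesh_sizes. V \<epsilon> N = bilinear_elements (shishkin_node (transition cs \<epsilon> N) N) N"
      then have "V \<epsilon> N = bilinear_elements ?x N" using \<epsilon> N by blast
      then show ?thesis using nodal_space_bilinear by metis
    next
      assume "\<exists>d. \<forall>\<epsilon>\<in>{0<..\<epsilon>\<^sub>0}. \<forall>N\<in>mesh_sizes. V \<epsilon> N = linear_elements (shishkin_node (transition cs \<epsilon> N) N) (d \<epsilon> N) N"
      then obtain d where "V \<epsilon> N = linear_elements ?x d N" using \<epsilon> N by blast
      then show ?thesis using nodal_space_linear by metis
    qed
    then obtain m where V: "nodal_space m (V \<epsilon> N)" ..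
    have uI: "uI \<epsilon> N \<in> V \<epsilon> N" using assms(8) \<epsilon> N by (simp add: lagrange_interpolant_def)
    have u: "variational_solution \<epsilon> c f H01 (u \<epsilon>)" using assms(6) \<epsilon> by (simp add: solves_reaction_diffusion_def)
    have uN: "variational_solution \<epsilon> c f (V \<epsilon> N) (uN \<epsilon> N)" using assms(10) \<epsilon> N by blast
    note bounds = C\<^sub>0[OF \<epsilon> N]
    note est = galerkin_error_squared[OF assms(1) c \<epsilon>' N C0 u V uI uN, folded \<kappa>_def \<rho>_def K1_def, folded P_def R_def]
    have B: "L2_inner ?e ?e \<le> R * (C\<^sub>0\<^sup>2 * (?L ^ 3 / (real N)\<^sup>2))"
      by (rule est(1)) (use bounds in auto)
    have A: "sqrt \<epsilon> * grad_inner ?e ?e \<le> P * (C\<^sub>0\<^sup>2 * (?L ^ 3 / (real N)\<^sup>2))"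
      by (rule est(2)) (use bounds in auto)
    have root: "sqrt (K * (C\<^sub>0\<^sup>2 * (?L ^ 3 / (real N)\<^sup>2))) = sqrt K * \<bar>C\<^sub>0\<bar> * (1 / real N * ?L powr (3/2))" for K
    proof -
      have "sqrt (?L ^ 3) = ?L powr (3/2)"
      proof -
        have "sqrt (?L ^ 3) = (?L powr 3) powr (1/2)"
          using L0 powr_realpow[of ?L 3] powr_half_sqrt[of "?L ^ 3"] by simp
        then show ?thesis unfolding powr_powr by simp
      qed
      then show ?thesis by (simp add: real_sqrt_mult real_sqrt_divide)
    qed
    have "L2_norm ?e \<le> sqrt R * \<bar>C\<^sub>0\<bar> * (1 / real N * ?L powr (3/2))"
      using real_sqrt_le_mono[OF B] unfolding root by (simp add: L2_norm_def)
    moreover have "\<epsilon> powr (1/4) * H1_seminorm ?e \<le> sqrt P * \<bar>C\<^sub>0\<bar> * (1 / real N * ?L powr (3/2))"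
    proof -
      have "sqrt (sqrt \<epsilon>) = \<epsilon> powr (1/4)"
      proof -
        have "sqrt (sqrt \<epsilon>) = (\<epsilon> powr (1/2)) powr (1/2)"
          using \<epsilon>' powr_half_sqrt[of \<epsilon>] powr_half_sqrt[of "sqrt \<epsilon>"] by simp
        then show ?thesis unfolding powr_powr by simp
      qed
      then have "\<epsilon> powr (1/4) * H1_seminorm ?e = sqrt (sqrt \<epsilon> * grad_inner ?e ?e)"
        by (simp add: H1_seminorm_def real_sqrt_mult)
      then show ?thesis using real_sqrt_le_mono[OF A] unfolding root by simp
    qed
    ultimately have "\<epsilon> powr (1/4) * H1_seminorm ?e + L2_norm ?e \<le> D * (1 / real N * ?L powr (3/2))"
      unfolding D_def distrib_right by linarith
    also have "\<dots> \<le> D * (1 / real N * ?L powr (3/2) + 1 / real N ^ 2)"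
      by (rule mult_left_mono[OF _ D0]) simp
    finally show ?thesis .
  qed
  then show ?thesis unfolding Let_def by blast
qed

end
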